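(* Let $(X_t)_{t\ge 0}$ be a Lévy process in $\mathbb{R}^d$ with Lévy triplet $(b,0,\nu)$ and characteristic exponent $\psi$ satisfying the sector condition, i.e. there is a constant $C>0$ with $|\operatorname{Im}\psi(\xi)|\le C\operatorname{Re}\psi(\xi)$ for all $\xi\in\mathbb{R}^d$. Let $f:[0,1]\to(0,\infty)$ be non-decreasing, and assume that at least one of the following two conditions holds. (A1) $\displaystyle \limsup_{r\to 0}\frac{\int_{|y|\le r}|y|^2\,\nu(dy)}{r^2\,\nu(\{|y|>r\})}<\infty$. (A2) There is a constant $M>0$ such that $\displaystyle \int_{\{t\in[0,1]:\,r<f(t)\}}\frac{1}{f(t)^2}\,dt\le M\,\frac{f^{-1}(r)}{r^2}$ for all $r\in(0,1)$. Then the following statements are equivalent: (L1) $\int_0^1\nu(\{|y|\ge c f(t)\})\,dt<\infty$ for some $c>0$; (L2) $\int_0^1\sup_{|\xi|\le 1/(\varepsilon f(t))}|\psi(\xi)|\,dt<\infty$ for some $\varepsilon>0$ (equivalently, for all $\varepsilon>0$); (L3) $\int_0^1\mathbb{P}\left(\sup_{s\le t}|X_s|\ge\varepsilon f(t)\right)\frac1t\,dt<\infty$ for all $\varepsilon>0$; (L4) $\int_0^1\mathbb{P}(|X_t|\ge\varepsilon f(t))\frac1t\,dt<\infty$ for all $\varepsilon>0$; (L5) $\limsup_{t\to0}\frac{1}{f(t)}\sup_{s\le t}|X_s|=0$ almost surely; (L6) $\limsup_{t\to0}\frac{1}{f(t)}|X_t|=0$ almost surely; (L7) $\limsup_{t\to0}\frac{1}{f(t)}|X_t|<\infty$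 almost surely. In particular, $\limsup_{t\to0}\frac1{f(t)}|X_t|\in\{0,\infty\}$ almost surely. Moreover, in (L5)-(L7) one may replace "almost surely" by "with positive probability".
   Context: A Lévy process is a stochastic process with $X_0=0$, stationary and independent increments and càdlàg sample paths in $\mathbb{R}^d$. It has Lévy triplet $(b,Q,\nu)$ and characteristic exponent $\psi$ if $\mathbb{E}e^{i\xi\cdot X_t}=e^{-t\psi(\xi)}$ with $$\psi(\xi)=-ib\cdot\xi+\tfrac12\xi\cdot Q\xi+\int_{y\ne0}\left(1-e^{iy\cdot\xi}+iy\cdot\xi\,\mathbf 1_{(0,1)}(|y|)\right)\nu(dy),$$ where $b\in\mathbb{R}^d$, $Q$ is positive semi-definite, and $\nu$ is a measure on $\mathbb{R}^d\setminus\{0\}$ with $\int\min\{1,|y|^2\}\,\nu(dy)<\infty$. Here $Q=0$. Notation: $\nu(\{|y|>r\}):=\nu(\{y\in\mathbb{R}^d:|y|>r\})$. $f^{-1}$ denotes the generalized inverse $f^{-1}(r):=\sup\{t\in[0,1]:f(t)\le r\}$ with $\sup\emptyset:=0$. The ratio in (A1) is taken in $[0,\infty]$ with $a/0=\infty$ for $a>0$ and $0/0=0$. *)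

theory Defs
  imports "HOL-Probability.Probability"
begin

definition cadlag :: "(real \<Rightarrow> 'a::topological_space) \<Rightarrow> bool" where
  "cadlag x \<longleftrightarrow>
     (\<forall>t\<ge>0. (x \<longlongrightarrow> x t) (at_right t)) \<and> (\<forall>t>0. \<exists>l. (x \<longlongrightarrow> l) (at_left t))"

text \<open>The time set is \<open>[0, \<infinity>)\<close>; the values \<open>X t\<close> for negative \<open>t\<close> play no role.\<close>

locale levy_process = prob_space M for M :: "'w measure" +
  fixes X :: "real \<Rightarrow> 'w \<Rightarrow> real ^ 'd"
  assumes random_variable_X: "\<And>t. 0 \<le> t \<Longrightarrow> X t \<in> borel_measurable M"
    and start_at_zero: "\<And>\<omega>. \<omega> \<in> space M \<Longrightarrow> X 0 \<omega> = 0"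
    and stationary_increments:
      "\<And>s t. 0 \<le> s \<Longrightarrow> s \<le> t \<Longrightarrow>
         distr M borel (\<lambda>\<omega>. X t \<omega> - X s \<omega>) = distr M borel (X (t - s))"
    and independent_increments:
      "\<And>(n::nat) (\<tau>::nat \<Rightarrow> real). 0 \<le> \<tau> 0 \<Longrightarrow> (\<And>i. i < n \<Longrightarrow> \<tau> i < \<tau> (Suc i)) \<Longrightarrow>
         indep_vars (\<lambda>_. borel) (\<lambda>i \<omega>. X (\<tau> (Suc i)) \<omega> - X (\<tau> i) \<omega>) {..<n}"
    and cadlag_paths: "\<And>\<omega>. \<omega> \<in> space M \<Longrightarrow> cadlag (\<lambda>t. X t \<omega>)"

text \<open>A measure on \<open>\<real>\<^sup>d - {0}\<close> is represented by its extension to \<open>\<real>\<^sup>d\<close> that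
  gives no mass to the origin.\<close>

definition levy_measure :: "(real ^ 'd) measure \<Rightarrow> bool" where
  "levy_measure \<nu> \<longleftrightarrow> sets \<nu> = sets borel \<and> emeasure \<nu> {0} = 0 \<and>
     (\<integral>\<^sup>+y. ennreal (min 1 ((norm y)\<^sup>2)) \<partial>\<nu>) < \<infinity>"

definition positive_semidefinite :: "real ^ 'd ^ 'd \<Rightarrow> bool" where
  "positive_semidefinite Q \<longleftrightarrow> transpose Q = Q \<and> (\<forall>\<xi>. 0 \<le> \<xi> \<bullet> (Q *v \<xi>))"

definition levy_exponent ::
    "real ^ 'd \<Rightarrow> real ^ 'd ^ 'd \<Rightarrow> (real ^ 'd) measure \<Rightarrow> real ^ 'd \<Rightarrow> complex" where
  "levy_exponent b Q \<nu> \<xi> =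
     - \<i> * complex_of_real (b \<bullet> \<xi>) + complex_of_real (1/2 * (\<xi> \<bullet> (Q *v \<xi>))) +
     (CLINT y:- {0}|\<nu>. 1 - iexp (y \<bullet> \<xi>) +
        \<i> * complex_of_real (y \<bullet> \<xi> * indicator {0<..<1} (norm y)))"

definition has_levy_triplet ::
    "'w measure \<Rightarrow> (real \<Rightarrow> 'w \<Rightarrow> real ^ 'd) \<Rightarrow>
     real ^ 'd \<Rightarrow> real ^ 'd ^ 'd \<Rightarrow> (real ^ 'd) measure \<Rightarrow> bool" where
  "has_levy_triplet M X b Q \<nu> \<longleftrightarrow> positive_semidefinite Q \<and> levy_measure \<nu> \<and>
     (\<forall>t\<ge>0. \<forall>\<xi>. (CLINT \<omega>|M. iexp (\<xi> \<bullet> X t \<omega>)) =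
        exp (- complex_of_real t * levy_exponent b Q \<nu> \<xi>))"

definition sector_condition :: "('a \<Rightarrow> complex) \<Rightarrow> bool" where
  "sector_condition \<psi> \<longleftrightarrow> (\<exists>C>0. \<forall>\<xi>. \<bar>Im (\<psi> \<xi>)\<bar> \<le> C * Re (\<psi> \<xi>))"

text \<open>Suprema and upper limits are formed in \<open>ennreal\<close>, so that they exist unconditionally
  and may be infinite.\<close>

definition running_sup ::
    "(real \<Rightarrow> 'w \<Rightarrow> 'a::real_normed_vector) \<Rightarrow> real \<Rightarrow> 'w \<Rightarrow> ennreal" where
  "running_sup X t \<omega> = (SUP s\<in>{0..t}. ennreal (norm (X s \<omega>)))"

definition generalized_inverse :: "(real \<Rightarrow> real) \<Rightarrow> real \<Rightarrow> real" where
  "generalized_inverse f r =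
     (if {t \<in> {0..1}. f t \<le> r} = {} then 0 else Sup {t \<in> {0..1}. f t \<le> r})"

text \<open>Division in \<open>ennreal\<close> satisfies \<open>a / 0 = \<infinity>\<close> for \<open>a > 0\<close> and \<open>0 / 0 = 0\<close>.\<close>

definition condition_A1 :: "(real ^ 'd) measure \<Rightarrow> bool" where
  "condition_A1 \<nu> \<longleftrightarrow>
     Limsup (at_right 0) (\<lambda>r::real.
       (\<integral>\<^sup>+y\<in>{y. norm y \<le> r}. ennreal ((norm y)\<^sup>2) \<partial>\<nu>) /
       (ennreal (r\<^sup>2) * emeasure \<nu> {y. norm y > r})) < \<infinity>"

definition condition_A2 :: "(real \<Rightarrow> real) \<Rightarrow> bool" where
  "condition_A2 f \<longleftrightarrow> (\<exists>K>0. \<forall>r\<in>{0<..<1}.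
     (\<integral>\<^sup>+t\<in>{t \<in> {0..1}. r < f t}. ennreal (1 / (f t)\<^sup>2) \<partial>lborel)
       \<le> ennreal (K * generalized_inverse f r / r\<^sup>2))"

definition all_equivalent :: "bool list \<Rightarrow> bool" where
  "all_equivalent Ps \<longleftrightarrow> (\<forall>P\<in>set Ps. \<forall>Q\<in>set Ps. P \<longleftrightarrow> Q)"

end

theory Submission
  imports Defs
begin

text \<open>
  The function \<open>K(r) = \<integral> min (1, |y|\<^sup>2/r\<^sup>2) \<nu>(dy)\<close> is, up to constants and thanks to the sector condition,
  the same as \<open>sup {|\<psi>(\<xi>)| : |\<xi>| \<le> 1/r}\<close>: one bound is immediate, the other follows by averaging
  \<open>1 - cos (\<xi> \<bullet> y)\<close> over \<open>\<xi>\<close> on the coordinate axes. The same averaging applied to the law of \<open>X\<^sub>s\<close> gives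
  \<open>P(|X\<^sub>s| \<ge> r) \<le> c s K(r)\<close>, which Ottaviani's inequality extends to the running supremum. Hence (L2), i.e.
  \<open>\<integral> K(f(t)) dt < \<infinity>\<close>, gives (L3) directly and (L5) by Borel--Cantelli along \<open>t = 2\<^sup>-\<^sup>k\<close>. Each of (A1), (A2)
  allows \<open>K(f(t))\<close> to be controlled by the tail of \<open>\<nu>\<close> alone, so that (L1) implies (L2).

  For the converse directions, \<open>P(|X\<^sub>s| > a) \<ge> s \<kappa>(a)\<close> for small \<open>s\<close>, where \<open>\<kappa>(a)\<close> is a multiple of a tail of
  \<open>\<nu>\<close>; this comes from the Levy continuity theorem for the laws of the coordinates of \<open>X\<^sub>s\<close>, reweighted so as
  to vanish at the origin. Independence of the increments over a fine grid then shows that the path makes no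
  increment larger than \<open>c f\<close> near 0 with probability at most \<open>exp (- \<integral> \<kappa>(c f(t)) dt)\<close>. So if (L1) fails the
  upper limit is infinite almost surely, and (L4) implies (L1) because Ottaviani's inequality bounds the maximum
  over the grid by the endpoint.
\<close>

section \<open>The weight \<open>1 - sinc\<close>\<close>

text \<open>The weight 1 - sinc is the mean of \<open>1 - cos (v * x)\<close> over v in [0,1] and is
  comparable to min(1, x^2). So it turns bounds on exponents into bounds on truncated second
  moments, and it tames the measures (1/s) P(X_s in dy), whose mass at the origin blows up as s
  tends to 0, while their Fourier transforms stay explicit.

  The obstacle in the converse directions is that \<open>s * jump_rate a\<close> bounds P(|X_s| > a)
  from below only for s under a threshold depending on a, so it cannot be used with a = f(s). It is
  applied to increments over one grid step, with finitely many levels a fixed before the mesh is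
  chosen. (L4), in turn, says nothing about any single time, whereas Ottaviani's inequality asks for
  a bound at all times up to t; this bound is extracted from the smallness of the set of bad times.

  Since the upper limit is almost surely 0 if (L1) holds and almost surely infinite otherwise, the
  almost-sure and the positive-probability versions all agree with (L1).\<close>

definition sinc_weight :: "real \<Rightarrow> real" where
  "sinc_weight x = 1 - sinc x"

text \<open>For 0 < x <= 2 the Taylor bound of order 5 gives sin x <= x - x^3/6 + x^5/120 <= x -
  x^3/8, the last step because x^2 <= 5. For x > 2, sinc x <= 1/2. Evenness covers negative
  x.\<close>

lemma sinc_weight_ge: "min 1 (x\<^sup>2) \<le> 8 * sinc_weight x"
proof -
  have pos: "min 1 (x\<^sup>2) \<le> 8 * (1 - sinc x)" if "x > 0" for x :: real
  proof (cases "x \<le> 2")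
    case True
    have "\<bar>sin x - (\<Sum>m<5. sin_coeff m * x ^ m)\<bar> \<le> inverse (fact 5) * \<bar>x\<bar> ^ 5"
      by (rule Maclaurin_sin_bound)
    moreover have "(\<Sum>m<5. sin_coeff m * x ^ m) = x - x ^ 3 / 6"
      by (simp add: sin_coeff_def lessThan_nat_numeral fact_numeral)
    moreover have "inverse (fact 5) * \<bar>x\<bar> ^ 5 = x ^ 5 / 120"
      using that by (simp add: fact_numeral)
    ultimately have "sin x \<le> x - x ^ 3 / 6 + x ^ 5 / 120"
      by linarith
    also have "\<dots> \<le> x * (1 - x\<^sup>2 / 8)"
    proof -
      have "x\<^sup>2 \<le> 2\<^sup>2" using True that by (intro power_mono) auto
      then have "x ^ 3 * (x\<^sup>2 - 5) \<le> 0"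
        using that by (intro mult_nonneg_nonpos) auto
      then show ?thesis by (simp add: field_simps eval_nat_numeral)
    qed
    finally have "sin x / x \<le> 1 - x\<^sup>2 / 8"
      using that by (simp add: field_simps)
    then show ?thesis using that by simp
  next
    case False
    have "sin x * 2 \<le> x"
      using False sin_le_one[of x] by linarith
    then have "1 \<le> 8 * (1 - sinc x)"
      using that False by (simp add: field_simps)
    then show ?thesis by linarith
  qed
  consider "x > 0" | "x = 0" | "- x > 0" by linarith
  then show ?thesis
    unfolding sinc_weight_def using pos[of x] pos[of "- x"] by cases auto
qed

lemma sinc_weight_nonneg [simp]: "0 \<le> sinc_weight x"
proof -
  have "0 \<le> min 1 (x\<^sup>2)" by simp
  also note sinc_weight_ge[of x]
  finally show ?thesis by simp
qed

lemma sinc_weight_pos: "x \<noteq> 0 \<Longrightarrow> 0 < sinc_weight x"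
  using sinc_weight_ge[of x] by (smt (verit) zero_less_power2 min_less_iff_conj)

lemma sinc_weight_measurable [measurable]: "sinc_weight \<in> borel_measurable borel"
  unfolding sinc_weight_def by measurable

lemma isCont_sinc_weight: "isCont sinc_weight x"
  unfolding sinc_weight_def using isCont_sinc[of x] by (intro continuous_intros)

definition unit_uniform :: "real measure" where
  "unit_uniform = density lborel (\<lambda>v. ennreal (indicator {0..1} v))"

lemma sets_unit_uniform [measurable_cong, simp]: "sets unit_uniform = sets borel"
  by (simp add: unit_uniform_def)

lemma prob_space_unit_uniform: "prob_space unit_uniform"
  by standard (simp add: unit_uniform_def emeasure_density ennreal_indicator)

lemma AE_unit_uniform: "AE v in unit_uniform. v \<in> {0..1}"
  unfolding unit_uniform_def by (subst AE_density) (auto simp: indicator_def)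

text \<open>The primitive in v is \<open>v - sin (v * x) / x\<close>, replaced by the constant 0
  when x = 0, in agreement with sinc 0 = 1. This identity is the origin of the weight.\<close>

lemma has_bochner_integral_sinc_weight:
  "has_bochner_integral unit_uniform (\<lambda>v. 1 - cos (v * x)) (sinc_weight x)"
proof -
  have "has_bochner_integral lborel (\<lambda>v. (1 - cos (v * x)) * indicator {0..1} v)
     ((1 - (if x = 0 then 1 else sin (1 * x) / x)) - (0 - (if x = 0 then 0 else sin (0 * x) / x)))"
  proof (rule has_bochner_integral_FTC_Icc_real)
    fix v :: real assume "0 \<le> v" "v \<le> 1"
    show "DERIV (\<lambda>v. v - (if x = 0 then v else sin (v * x) / x)) v :> 1 - cos (v * x)"
      by (cases "x = 0") (auto intro!: derivative_eq_intros)
  qed (auto intro!: continuous_intros)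
  then show ?thesis
    unfolding unit_uniform_def sinc_weight_def
    by (subst has_bochner_integral_density) (auto simp: mult.commute)
qed

text \<open>A second difference in the frequency amounts to multiplication by
  \<open>1 - cos\<close>, the factor whose average over y is \<open>sinc_weight\<close>; terms
  affine in the frequency are annihilated.\<close>

lemma iexp_second_difference:
  "2 * (iexp x * (1 - complex_of_real (cos y))) = 2 * iexp x - iexp (x + y) - iexp (x - y)"
proof -
  have "iexp y + iexp (- y) = 2 * cos y"
    by (simp add: complex_eq_iff Re_exp Im_exp)
  then have "iexp x * (iexp y + iexp (- y)) = iexp x * (2 * cos y)"
    by simp
  then have "iexp (x + y) + iexp (x - y) = iexp x * (2 * cos y)"
    by (simp add: distrib_left right_diff_distrib exp_add exp_diff exp_minus field_simps)
  then show ?thesis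
    by (simp add: algebra_simps)
qed

text \<open>Mean value inequality on the right half-plane, where the derivative of
  \<open>exp (- w)\<close> has modulus at most 1.\<close>

lemma norm_one_minus_exp_le:
  assumes "0 \<le> Re z" shows "cmod (1 - exp (- z)) \<le> cmod z"
proof -
  have "norm (exp (- z) - exp (- 0)) \<le> 1 * norm (z - 0)"
  proof (rule field_differentiable_bound)
    show "convex {w. 0 \<le> Re w}" using convex_halfspace_Re_ge[of 0] by simp
    show "((\<lambda>w. exp (- w)) has_field_derivative - exp (- w)) (at w within {w. 0 \<le> Re w})" for w
      by (auto intro!: derivative_eq_intros)
    show "cmod (- exp (- w)) \<le> 1" if "w \<in> {w. 0 \<le> Re w}" for w
      using that by simp
  qed (use assms in auto)
  then show ?thesis by (simp add: norm_minus_commute)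
qed

lemma tendsto_one_minus_exp:
  fixes z :: complex
  assumes "s \<longlonglongrightarrow> 0" "\<And>n. s n > 0"
  shows "(\<lambda>n. (1 - exp (- complex_of_real (s n) * z)) / complex_of_real (s n)) \<longlonglongrightarrow> z"
proof -
  have "((\<lambda>w. 1 - exp (- w * z)) has_field_derivative z) (at 0)"
    by (auto intro!: derivative_eq_intros)
  then have lim: "((\<lambda>w. (1 - exp (- w * z)) / w) \<longlongrightarrow> z) (at 0)"
    by (simp add: has_field_derivative_iff)
  have "filterlim (\<lambda>n. complex_of_real (s n)) (at 0) sequentially"
    unfolding filterlim_at using assms tendsto_of_real[OF assms(1), where 'a=complex]
    by (auto simp: less_imp_neq[symmetric])
  from filterlim_compose[OF lim this] show ?thesis by simp
qed

section \<open>Levy measures and exponents\<close>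

lemma one_minus_cos_le: "1 - cos (x::real) \<le> 2 * min 1 (x\<^sup>2)"
proof -
  have "1 - cos x = 2 * (sin (x / 2))\<^sup>2"
    using cos_double_sin[of "x / 2"] by simp
  also have "(sin (x / 2))\<^sup>2 \<le> (x / 2)\<^sup>2"
    using abs_sin_x_le_abs_x[of "x / 2"] by (simp only: abs_le_square_iff)
  finally have "1 - cos x \<le> 2 * (x / 2)\<^sup>2"
    by simp
  also have "\<dots> \<le> 2 * x\<^sup>2" by (simp add: power_divide)
  finally show ?thesis
    using cos_ge_minus_one[of x] by linarith
qed

lemma measurable_vec_nth [measurable]: "(\<lambda>y :: real ^ 'd. y $ j) \<in> borel_measurable borel"
  by (intro borel_measurable_continuous_onI continuous_intros)

lemma min_one_scaled_square_le:
  fixes x \<epsilon> :: real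
  assumes "0 < \<epsilon>"
  shows "min 1 ((x / \<epsilon>)\<^sup>2) \<le> max 1 (1 / \<epsilon>\<^sup>2) * min 1 (x\<^sup>2)"
proof (cases "\<epsilon> \<ge> 1")
  case True
  then have "x\<^sup>2 * 1 \<le> x\<^sup>2 * \<epsilon>\<^sup>2" by (intro mult_left_mono) auto
  then have "x\<^sup>2 / \<epsilon>\<^sup>2 \<le> x\<^sup>2" using assms by (simp add: divide_le_eq)
  moreover have "1 / \<epsilon>\<^sup>2 \<le> 1" using True by simp
  moreover from this have "max 1 (1 / \<epsilon>\<^sup>2) = 1" by simp
  ultimately show ?thesis by (simp add: power_divide min.coboundedI2)
next
  case False
  then have "1 \<le> 1 / \<epsilon>\<^sup>2" using assms by (simp add: power_le_one)
  then have max: "max 1 (1 / \<epsilon>\<^sup>2) = 1 / \<epsilon>\<^sup>2" by simp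
  show ?thesis
    unfolding max using \<open>1 \<le> 1 / \<epsilon>\<^sup>2\<close> by (simp add: power_divide min_def)
qed

text \<open>Testing with \<xi> = vR e_j and averaging over v in [0,1] bounds the
  \<open>sinc_weight\<close> integral of each coordinate by \<open>B\<close>. The coordinates are
  recombined by subadditivity of \<open>min 1\<close>; 8 is the constant of
  \<open>sinc_weight_ge\<close>, with one such term per coordinate. The measure is general because
  the lemma serves both for \<nu> and for the law of X at a fixed time.\<close>

lemma truncated_second_moment_le:
  fixes \<mu> :: "(real ^ 'd) measure"
  assumes sets_\<mu> [measurable_cong]: "sets \<mu> = sets borel" and "sigma_finite_measure \<mu>"
    and "0 \<le> R"
    and B: "\<And>\<xi>. norm \<xi> \<le> R \<Longrightarrow> (\<integral>\<^sup>+y. ennreal (1 - cos (\<xi> \<bullet> y)) \<partial>\<mu>) \<le> B"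
  shows "(\<integral>\<^sup>+y. ennreal (min 1 ((R * norm y)\<^sup>2)) \<partial>\<mu>) \<le> of_nat (8 * CARD('d)) * B"
proof -
  interpret \<mu>: sigma_finite_measure \<mu> by fact
  interpret U: prob_space unit_uniform by (rule prob_space_unit_uniform)
  interpret pair_sigma_finite \<mu> unit_uniform ..
  have coord: "(\<integral>\<^sup>+y. ennreal (sinc_weight (R * y $ j)) \<partial>\<mu>) \<le> B" for j
  proof -
    have "(\<integral>\<^sup>+y. ennreal (sinc_weight (R * y $ j)) \<partial>\<mu>) =
        (\<integral>\<^sup>+y. (\<integral>\<^sup>+v. ennreal (1 - cos (v * (R * y $ j))) \<partial>unit_uniform) \<partial>\<mu>)"
    proof (rule nn_integral_cong)
      fix y :: "real ^ 'd"
      show "ennreal (sinc_weight (R * y $ j)) =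
          (\<integral>\<^sup>+v. ennreal (1 - cos (v * (R * y $ j))) \<partial>unit_uniform)"
        using has_bochner_integral_sinc_weight[of "R * y $ j"]
        by (subst nn_integral_eq_integral) (auto simp: has_bochner_integral_iff)
    qed
    also have "\<dots> = (\<integral>\<^sup>+v. (\<integral>\<^sup>+y. ennreal (1 - cos (v * (R * y $ j))) \<partial>\<mu>) \<partial>unit_uniform)"
      by (rule Fubini'[symmetric]) measurable
    also have "\<dots> \<le> (\<integral>\<^sup>+v. B \<partial>unit_uniform)"
    proof (rule nn_integral_mono_AE)
      show "AE v in unit_uniform. (\<integral>\<^sup>+y. ennreal (1 - cos (v * (R * y $ j))) \<partial>\<mu>) \<le> B"
        using AE_unit_uniform
      proof eventually_elim
        case (elim v)
        have "norm ((v * R) *\<^sub>R axis j (1::real)) \<le> R"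
          using elim \<open>0 \<le> R\<close> by (simp add: norm_axis_1 abs_mult mult_left_le_one_le)
        from B[OF this] show ?case
          by (simp add: inner_axis' mult.assoc)
      qed
    qed
    also have "\<dots> = B" by (simp add: U.emeasure_space_1)
    finally show ?thesis .
  qed
  have "(\<integral>\<^sup>+y. ennreal (min 1 ((R * norm y)\<^sup>2)) \<partial>\<mu>) \<le>
      (\<integral>\<^sup>+y. (\<Sum>j\<in>UNIV. 8 * ennreal (sinc_weight (R * y $ j))) \<partial>\<mu>)"
  proof (rule nn_integral_mono)
    fix y :: "real ^ 'd"
    have min_sum: "min 1 (sum a S) \<le> (\<Sum>j\<in>S. min 1 (a j))"
      if "finite S" "\<And>j. 0 \<le> a j" for a :: "'d \<Rightarrow> real" and S
      using that
    proof (induction S rule: finite_induct)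
      case (insert j S)
      then have "min 1 (sum a S) \<le> (\<Sum>j\<in>S. min 1 (a j))" "0 \<le> a j" "0 \<le> sum a S"
        by (auto intro: sum_nonneg)
      moreover have "min 1 (a j + sum a S) \<le> min 1 (a j) + min 1 (sum a S)"
        using \<open>0 \<le> a j\<close> \<open>0 \<le> sum a S\<close> by linarith
      ultimately show ?case using insert.hyps by simp
    qed simp
    have "min 1 ((R * norm y)\<^sup>2) = min 1 (\<Sum>j\<in>UNIV. (R * y $ j)\<^sup>2)"
      by (simp add: power_mult_distrib norm_vec_def L2_set_def sum_nonneg sum_distrib_left)
    also have "\<dots> \<le> (\<Sum>j\<in>UNIV. min 1 ((R * y $ j)\<^sup>2))"
      by (rule min_sum) auto
    also have "\<dots> \<le> (\<Sum>j\<in>UNIV. 8 * sinc_weight (R * y $ j))"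
      by (intro sum_mono sinc_weight_ge)
    finally have "ennreal (min 1 ((R * norm y)\<^sup>2)) \<le>
        ennreal (\<Sum>j\<in>UNIV. 8 * sinc_weight (R * y $ j))"
      by (rule ennreal_leI)
    also have "\<dots> = (\<Sum>j\<in>UNIV. ennreal (8 * sinc_weight (R * y $ j)))"
      by (rule sum_ennreal[symmetric]) simp
    also have "\<dots> = (\<Sum>j\<in>UNIV. 8 * ennreal (sinc_weight (R * y $ j)))"
      by (subst ennreal_mult') simp_all
    finally show "ennreal (min 1 ((R * norm y)\<^sup>2)) \<le>
        (\<Sum>j\<in>UNIV. 8 * ennreal (sinc_weight (R * y $ j)))" .
  qed
  also have "\<dots> = (\<Sum>j\<in>UNIV. 8 * (\<integral>\<^sup>+y. ennreal (sinc_weight (R * y $ j)) \<partial>\<mu>))"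
    by (simp add: nn_integral_sum nn_integral_cmult)
  also have "\<dots> \<le> (\<Sum>j\<in>(UNIV :: 'd set). 8 * B)"
    by (intro sum_mono mult_left_mono coord) auto
  also have "\<dots> = of_nat (8 * CARD('d)) * B"
    by (simp add: mult_ac)
  finally show ?thesis .
qed

definition levy_integrand :: "real ^ 'd \<Rightarrow> real ^ 'd \<Rightarrow> complex" where
  "levy_integrand \<xi> y = indicator (- {0}) y *\<^sub>R (1 - iexp (y \<bullet> \<xi>) +
        \<i> * complex_of_real (y \<bullet> \<xi> * indicator {0<..<1} (norm y)))"

lemma levy_integrand_measurable [measurable]: "levy_integrand \<xi> \<in> borel_measurable borel"
  unfolding levy_integrand_def by measurable

lemma inner_square_le: "(y \<bullet> \<xi>)\<^sup>2 \<le> (norm \<xi>)\<^sup>2 * (norm (y::real^'d))\<^sup>2"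
  using Cauchy_Schwarz_ineq[of y \<xi>] by (simp add: power2_norm_eq_inner mult.commute)

text \<open>The function \<open>K\<close> of the opening paragraph.\<close>

definition levy_tail :: "(real ^ 'd) measure \<Rightarrow> real \<Rightarrow> real" where
  "levy_tail \<nu> r = (\<integral>y. min 1 ((norm y / r)\<^sup>2) \<partial>\<nu>)"

context
  fixes \<nu> :: "(real ^ 'd) measure"
  assumes \<nu>: "levy_measure \<nu>"
begin

lemma sets_levy_measure [measurable_cong, simp]: "sets \<nu> = sets borel"
  using \<nu> by (simp add: levy_measure_def)

lemma space_levy_measure [simp]: "space \<nu> = UNIV"
  using sets_eq_imp_space_eq[OF sets_levy_measure] by simp

lemma integrable_truncated_square [intro, simp]: 
  assumes "0 < r" shows "integrable \<nu> (\<lambda>y. min 1 ((norm y / r)\<^sup>2))"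
proof (rule Bochner_Integration.integrable_bound)
  show "integrable \<nu> (\<lambda>y. max 1 (1 / r\<^sup>2) * min 1 ((norm y)\<^sup>2))"
    using \<nu> by (intro integrable_mult_right integrableI_nonneg) (auto simp: levy_measure_def)
  show "AE y in \<nu>. norm (min 1 ((norm y / r)\<^sup>2)) \<le> norm (max 1 (1 / r\<^sup>2) * min 1 ((norm y)\<^sup>2))"
    using min_one_scaled_square_le[OF assms] by (auto simp: abs_mult)
qed auto

lemma levy_tail_nonneg [simp]: "0 \<le> levy_tail \<nu> r"
  unfolding levy_tail_def by (rule integral_nonneg_AE) auto

lemma ennreal_levy_tail:
  "0 < r \<Longrightarrow> ennreal (levy_tail \<nu> r) = (\<integral>\<^sup>+y. ennreal (min 1 ((norm y / r)\<^sup>2)) \<partial>\<nu>)"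
  unfolding levy_tail_def by (rule nn_integral_eq_integral[symmetric]) auto

lemma levy_tail_antimono: "0 < r \<Longrightarrow> r \<le> s \<Longrightarrow> levy_tail \<nu> s \<le> levy_tail \<nu> r"
  unfolding levy_tail_def
  by (intro integral_mono integrable_truncated_square min.mono power_mono divide_left_mono) auto

text \<open>A plain tail of \<nu> may grow without control when its radius shrinks by a factor, but
  the truncated second moment changes by at most a constant. This is what makes one constant in
  front of f as good as any other.\<close>

lemma levy_tail_scale_le:
  assumes "0 < \<epsilon>" "0 < r"
  shows "levy_tail \<nu> (\<epsilon> * r) \<le> max 1 (1 / \<epsilon>\<^sup>2) * levy_tail \<nu> r"
proof -
  have "levy_tail \<nu> (\<epsilon> * r) \<le> (\<integral>y. max 1 (1 / \<epsilon>\<^sup>2) * min 1 ((norm y / r)\<^sup>2) \<partial>\<nu>)"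
    unfolding levy_tail_def
    using assms min_one_scaled_square_le[OF assms(1), of "norm y / r" for y]
    by (intro integral_mono integrable_truncated_square integrable_mult_right)
       (auto simp: mult.commute)
  then show ?thesis by (simp add: levy_tail_def)
qed

lemma emeasure_le_levy_tail:
  assumes "0 < r" shows "emeasure \<nu> {y. r \<le> norm y} \<le> ennreal (levy_tail \<nu> r)"
proof -
  have "emeasure \<nu> {y. r \<le> norm y} = (\<integral>\<^sup>+y. indicator {y. r \<le> norm y} y \<partial>\<nu>)"
    by simp
  also have "\<dots> \<le> (\<integral>\<^sup>+y. ennreal (min 1 ((norm y / r)\<^sup>2)) \<partial>\<nu>)"
    using assms by (intro nn_integral_mono) (auto simp: indicator_def)
  finally show ?thesis using ennreal_levy_tail[OF assms] by simp
qed

lemma emeasure_levy_finite: "0 < r \<Longrightarrow> emeasure \<nu> {y. r \<le> norm y} < \<infinity>"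
  using emeasure_le_levy_tail[of r] by (auto intro: le_less_trans)

lemma sigma_finite_levy_measure: "sigma_finite_measure \<nu>"
proof
  let ?A = "insert {0} (range (\<lambda>n::nat. {y::real^'d. inverse (real (Suc n)) \<le> norm y}))"
  have "\<exists>n. inverse (real (Suc n)) \<le> norm y" if "y \<noteq> 0" for y :: "real ^ 'd"
    using reals_Archimedean[of "norm y"] that by (auto intro: less_imp_le)
  then have "\<Union>?A = UNIV" by fastforce
  moreover have "\<forall>a\<in>?A. emeasure \<nu> a \<noteq> \<infinity>"
    using \<nu> emeasure_levy_finite by (auto simp: levy_measure_def less_top[symmetric])
  ultimately show "\<exists>A. countable A \<and> A \<subseteq> sets \<nu> \<and> \<Union> A = space \<nu> \<and> (\<forall>a\<in>A. emeasure \<nu> a \<noteq> \<infinity>)"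
    by (intro exI[of _ ?A]) auto
qed

lemma integrable_truncated_square_one: "integrable \<nu> (\<lambda>y. min 1 ((norm y)\<^sup>2))"
  using integrable_truncated_square[of 1] by simp

text \<open>Near 0 the compensator leaves a Taylor remainder of size at most (y . \<xi>)^2/2. For
  |y| >= 1 the compensator is absent and the integrand has modulus at most 2.\<close>

lemma integrable_levy_integrand: "integrable \<nu> (levy_integrand \<xi>)"
proof (rule Bochner_Integration.integrable_bound)
  show "integrable \<nu> (\<lambda>y. (2 + (norm \<xi>)\<^sup>2) * min 1 ((norm y)\<^sup>2))"
    using integrable_truncated_square_one by (rule integrable_mult_right)
  have "norm (levy_integrand \<xi> y) \<le> (2 + (norm \<xi>)\<^sup>2) * min 1 ((norm y)\<^sup>2)" for y
  proof -
    consider "y = 0" | "0 < norm y" "norm y < 1" | "1 \<le> norm y" by fastforce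
    then show ?thesis
    proof cases
      case 2
      have "norm (levy_integrand \<xi> y) = cmod (iexp (y \<bullet> \<xi>) - (\<Sum>k\<le>1. (\<i> * (y \<bullet> \<xi>)) ^ k / fact k))"
        using 2 by (subst norm_minus_commute) (auto simp: levy_integrand_def algebra_simps)
      also have "\<dots> \<le> (y \<bullet> \<xi>)\<^sup>2 / 2"
        using iexp_approx1[of "y \<bullet> \<xi>" 1] by (simp add: eval_nat_numeral)
      also have "\<dots> \<le> (norm \<xi>)\<^sup>2 * (norm y)\<^sup>2"
        using inner_square_le[of y \<xi>] by (smt (verit) field_sum_of_halves zero_le_power2)
      also have "\<dots> \<le> (2 + (norm \<xi>)\<^sup>2) * (norm y)\<^sup>2"
        by (intro mult_right_mono) auto
      finally show ?thesis using 2 power_le_one[of "norm y" 2] by (simp add: min_absorb2)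
    next
      case 3
      have "norm (levy_integrand \<xi> y) \<le> 1 + 1"
        unfolding levy_integrand_def using 3 norm_triangle_ineq4[of 1 "iexp (y \<bullet> \<xi>)"] by (auto simp: indicator_def)
      also have "\<dots> \<le> (2 + (norm \<xi>)\<^sup>2) * min 1 ((norm y)\<^sup>2)"
        using 3 by simp
      finally show ?thesis .
    qed (simp add: levy_integrand_def)
  qed
  then show "AE y in \<nu>. norm (levy_integrand \<xi> y) \<le> norm ((2 + (norm \<xi>)\<^sup>2) * min 1 ((norm y)\<^sup>2))"
    by (auto simp: abs_mult)
qed auto

lemma levy_exponent_eq:
  "levy_exponent b 0 \<nu> \<xi> = - \<i> * complex_of_real (b \<bullet> \<xi>) + (\<integral>y. levy_integrand \<xi> y \<partial>\<nu>)"
  by (simp add: levy_exponent_def set_lebesgue_integral_def levy_integrand_def)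

lemma Re_levy_exponent: 
  "integrable \<nu> (\<lambda>y. 1 - cos (\<xi> \<bullet> y))"
  "Re (levy_exponent b 0 \<nu> \<xi>) = (\<integral>y. 1 - cos (\<xi> \<bullet> y) \<partial>\<nu>)"
proof -
  have eq: "Re (levy_integrand \<xi> y) = 1 - cos (\<xi> \<bullet> y)" for y
    by (auto simp: levy_integrand_def Re_exp inner_commute indicator_def)
  show "integrable \<nu> (\<lambda>y. 1 - cos (\<xi> \<bullet> y))"
    using integrable_Re[OF integrable_levy_integrand[of \<xi>]] by (simp add: eq)
  show "Re (levy_exponent b 0 \<nu> \<xi>) = (\<integral>y. 1 - cos (\<xi> \<bullet> y) \<partial>\<nu>)"
    by (simp add: levy_exponent_eq integral_Re[OF integrable_levy_integrand, symmetric] eq)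
qed

lemma Re_levy_exponent_nonneg: "0 \<le> Re (levy_exponent b 0 \<nu> \<xi>)"
  unfolding Re_levy_exponent by (rule integral_nonneg_AE) auto

lemma Re_levy_exponent_le:
  assumes "0 < r" "norm \<xi> \<le> 1 / r"
  shows "Re (levy_exponent b 0 \<nu> \<xi>) \<le> 2 * levy_tail \<nu> r"
proof -
  have "1 - cos (\<xi> \<bullet> y) \<le> 2 * min 1 ((norm y / r)\<^sup>2)" for y
  proof -
    have "1 - cos (\<xi> \<bullet> y) \<le> 2 * min 1 ((\<xi> \<bullet> y)\<^sup>2)" by (rule one_minus_cos_le)
    also have "(\<xi> \<bullet> y)\<^sup>2 \<le> (norm y)\<^sup>2 * (norm \<xi>)\<^sup>2" by (rule inner_square_le)
    also have "\<dots> \<le> (norm y)\<^sup>2 * (1 / r)\<^sup>2"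
      using assms by (intro mult_left_mono power_mono) auto
    finally show ?thesis by (simp add: power_divide)
  qed
  then have "(\<integral>y. 1 - cos (\<xi> \<bullet> y) \<partial>\<nu>) \<le> (\<integral>y. 2 * min 1 ((norm y / r)\<^sup>2) \<partial>\<nu>)"
    using assms by (intro integral_mono Re_levy_exponent integrable_mult_right) auto
  then show ?thesis
    by (simp add: Re_levy_exponent levy_tail_def)
qed

text \<open>\<open>B\<close> lives in \<open>ennreal\<close> so that it can later be the supremum of
  |\<psi>| over the ball, finite or not.\<close>

lemma levy_tail_le_Re_levy_exponent:
  assumes "0 < r" and B: "\<And>\<xi>. norm \<xi> \<le> 1 / r \<Longrightarrow> ennreal (Re (levy_exponent b 0 \<nu> \<xi>)) \<le> B"
  shows "ennreal (levy_tail \<nu> r) \<le> of_nat (8 * CARD('d)) * B"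
proof -
  have "(\<integral>\<^sup>+y. ennreal (min 1 ((1 / r * norm y)\<^sup>2)) \<partial>\<nu>) \<le> of_nat (8 * CARD('d)) * B"
  proof (rule truncated_second_moment_le)
    show "(\<integral>\<^sup>+y. ennreal (1 - cos (\<xi> \<bullet> y)) \<partial>\<nu>) \<le> B" if "norm \<xi> \<le> 1 / r" for \<xi>
      using B[OF that] by (subst nn_integral_eq_integral) (auto simp: Re_levy_exponent)
  qed (use assms sigma_finite_levy_measure in auto)
  then show ?thesis by (simp add: ennreal_levy_tail assms)
qed

text \<open>Drift and compensator are linear in \<xi> and cancel; what remains is integrable against
  \<nu> without compensation.\<close>

lemma levy_exponent_second_difference:
  "levy_exponent b 0 \<nu> (\<xi> + \<eta>) + levy_exponent b 0 \<nu> (\<xi> - \<eta>) - 2 * levy_exponent b 0 \<nu> \<xi> =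
    2 * (\<integral>y. iexp (\<xi> \<bullet> y) * (1 - cos (\<eta> \<bullet> y)) \<partial>\<nu>)"
proof -
  have eq: "levy_integrand (\<xi> + \<eta>) y + levy_integrand (\<xi> - \<eta>) y - 2 * levy_integrand \<xi> y =
      2 * (iexp (\<xi> \<bullet> y) * (1 - cos (\<eta> \<bullet> y)))" for y
    using iexp_second_difference[of "\<xi> \<bullet> y" "\<eta> \<bullet> y"]
    by (cases "y = 0")
       (auto simp: levy_integrand_def inner_add_left inner_diff_left inner_commute[of y] algebra_simps)
  have "(\<integral>y. 2 * (iexp (\<xi> \<bullet> y) * (1 - cos (\<eta> \<bullet> y))) \<partial>\<nu>) =
     (\<integral>y. levy_integrand (\<xi> + \<eta>) y \<partial>\<nu>) + (\<integral>y. levy_integrand (\<xi> - \<eta>) y \<partial>\<nu>) -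
     2 * (\<integral>y. levy_integrand \<xi> y \<partial>\<nu>)"
    unfolding eq[symmetric] by (simp add: integrable_levy_integrand)
  then show ?thesis
    unfolding levy_exponent_eq integral_mult_right_zero
    by (simp only: inner_add_right inner_diff_right of_real_add of_real_diff) (simp add: algebra_simps)
qed

end

section \<open>Maximal inequalities on grids\<close>

text \<open>Decompose according to the first index i at which the partial sum reaches a + b. That
  event depends only on the increments before i, hence is independent of the event that the
  remaining increments sum to less than b in norm, whose probability is at least 1 - q. When both
  occur, the full sum has norm at least a.\<close>

lemma (in prob_space) ottaviani_inequality:
  fixes D :: "nat \<Rightarrow> 'a \<Rightarrow> 'b::euclidean_space"
  assumes indep: "indep_vars (\<lambda>_. borel) D {..<n}"
    and q: "\<And>i. i \<le> n \<Longrightarrow> prob {\<omega> \<in> space M. b \<le> norm (\<Sum>k\<in>{i..<n}. D k \<omega>)} \<le> q"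
  shows "(1 - q) * prob {\<omega> \<in> space M. \<exists>i\<le>n. a + b \<le> norm (\<Sum>k<i. D k \<omega>)}
    \<le> prob {\<omega> \<in> space M. a \<le> norm (\<Sum>k<n. D k \<omega>)}"
proof -
  have rv: "D k \<in> borel_measurable M" if "k < n" for k
    using indep that by (auto simp: indep_vars_def)
  have sum_rv [measurable]: "(\<lambda>\<omega>. \<Sum>k\<in>J. D k \<omega>) \<in> borel_measurable M" if "J \<subseteq> {..<n}" for J
    using rv that by (intro borel_measurable_sum) auto
  define A where "A i = {\<omega> \<in> space M. a + b \<le> norm (\<Sum>k<i. D k \<omega>) \<and>
    (\<forall>j<i. norm (\<Sum>k<j. D k \<omega>) < a + b)}" for i
  define B where "B i = {\<omega> \<in> space M. norm (\<Sum>k\<in>{i..<n}. D k \<omega>) < b}" for i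
  have A_sets: "A i \<in> events" if "i \<le> n" for i
  proof -
    have [measurable]: "(\<lambda>\<omega>. \<Sum>k<j. D k \<omega>) \<in> borel_measurable M" if "j \<le> i" for j
      using that \<open>i \<le> n\<close> by (intro sum_rv) auto
    have "A i = {\<omega> \<in> space M. a + b \<le> norm (\<Sum>k<i. D k \<omega>)} \<inter>
        (\<Inter>j\<in>{..<i}. {\<omega> \<in> space M. norm (\<Sum>k<j. D k \<omega>) < a + b}) \<inter> space M"
      by (auto simp: A_def)
    also have "\<dots> \<in> events"
      by (cases "i = 0") (auto intro!: sets.Int sets.finite_INT)
    finally show ?thesis .
  qed
  have B_sets: "B i \<in> events" for i
    unfolding B_def using sum_rv[of "{i..<n}"] by measurable auto
  have indep_AB: "prob (A i \<inter> B i) = prob (A i) * prob (B i)" if "i \<le> n" for i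
  proof -
    let ?P = "\<lambda>J :: nat set. PiM J (\<lambda>_. borel :: 'b measure)"
    define PA where "PA = {d \<in> space (?P {..<i}). a + b \<le> norm (\<Sum>k<i. d k) \<and>
      (\<forall>j\<in>{..<i}. norm (\<Sum>k<j. d k) < a + b)}"
    define PB where "PB = {d \<in> space (?P {i..<n}). norm (\<Sum>k\<in>{i..<n}. d k) < b}"
    have comp: "(\<lambda>d. \<Sum>k\<in>J. d k) \<in> borel_measurable (?P I)" if "J \<subseteq> I" for I J
      using that by (intro borel_measurable_sum measurable_component_singleton) auto
    have "PA = {d \<in> space (?P {..<i}). a + b \<le> norm (\<Sum>k<i. d k)} \<inter>
        (\<Inter>j\<in>{..<i}. {d \<in> space (?P {..<i}). norm (\<Sum>k<j. d k) < a + b}) \<inter> space (?P {..<i})"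
      by (auto simp: PA_def)
    also have "\<dots> \<in> sets (?P {..<i})"
    proof -
      have [measurable]: "(\<lambda>d. \<Sum>k<j. d k) \<in> borel_measurable (?P {..<i})" if "j \<le> i" for j
        using that by (intro comp) auto
      show ?thesis
        by (cases "i = 0") (auto intro!: sets.Int sets.finite_INT)
    qed
    finally have PA: "PA \<in> sets (?P {..<i})" .
    have PB: "PB \<in> sets (?P {i..<n})"
      unfolding PB_def using comp[of "{i..<n}" "{i..<n}"] by measurable
    have "indep_var (?P {..<i}) (\<lambda>\<omega>. restrict (\<lambda>k. D k \<omega>) {..<i})
        (?P {i..<n}) (\<lambda>\<omega>. restrict (\<lambda>k. D k \<omega>) {i..<n})"
      using that by (intro indep_var_restrict[OF indep]) auto
    from indep_varD[OF this PA PB] show ?thesis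
      by (simp add: A_def B_def PA_def PB_def space_PiM vimage_def Int_def conj_ac Ball_def)
  qed
  have disj: "disjoint_family_on A {..n}"
    unfolding disjoint_family_on_def A_def by (auto simp: not_less[symmetric]) (metis linorder_neqE_nat)
  have union: "{\<omega> \<in> space M. \<exists>i\<le>n. a + b \<le> norm (\<Sum>k<i. D k \<omega>)} = (\<Union>i\<in>{..n}. A i)"
  proof safe
    fix \<omega> i assume "\<omega> \<in> space M" "i \<le> n" "a + b \<le> norm (\<Sum>k<i. D k \<omega>)"
    then have "\<exists>i. i \<le> n \<and> a + b \<le> norm (\<Sum>k<i. D k \<omega>)" by blast
    then obtain i where i: "i \<le> n" "a + b \<le> norm (\<Sum>k<i. D k \<omega>)"
      "\<And>j. j < i \<Longrightarrow> \<not> (j \<le> n \<and> a + b \<le> norm (\<Sum>k<j. D k \<omega>))"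
      using exists_least_iff[of "\<lambda>i. i \<le> n \<and> a + b \<le> norm (\<Sum>k<i. D k \<omega>)"] by blast
    then have "\<omega> \<in> A i" using \<open>\<omega> \<in> space M\<close> by (force simp: A_def)
    then show "\<omega> \<in> (\<Union>i\<in>{..n}. A i)" using i by blast
  qed (auto simp: A_def)
  have B_prob: "1 - q \<le> prob (B i)" if "i \<le> n" for i
  proof -
    have "prob (space M - {\<omega> \<in> space M. b \<le> norm (\<Sum>k\<in>{i..<n}. D k \<omega>)}) =
        1 - prob {\<omega> \<in> space M. b \<le> norm (\<Sum>k\<in>{i..<n}. D k \<omega>)}"
      using sum_rv[of "{i..<n}"] by (intro prob_compl) (measurable, auto)
    moreover have "space M - {\<omega> \<in> space M. b \<le> norm (\<Sum>k\<in>{i..<n}. D k \<omega>)} = B i"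
      by (auto simp: B_def)
    ultimately show ?thesis using q[OF that] by simp
  qed
  have "(1 - q) * prob (\<Union>i\<in>{..n}. A i) = (\<Sum>i\<in>{..n}. (1 - q) * prob (A i))"
    using A_sets disj by (subst finite_measure_finite_Union) (auto simp: sum_distrib_left)
  also have "\<dots> \<le> (\<Sum>i\<in>{..n}. prob (A i \<inter> B i))"
    using B_prob
    by (intro sum_mono) (simp add: indep_AB mult.commute[of "prob (A _)"] mult_right_mono)
  also have "\<dots> = prob (\<Union>i\<in>{..n}. A i \<inter> B i)"
    using A_sets B_sets disjoint_family_on_bisimulation[OF disj, of "\<lambda>i. A i \<inter> B i"]
    by (intro finite_measure_finite_Union[symmetric]) auto
  also have "\<dots> \<le> prob {\<omega> \<in> space M. a \<le> norm (\<Sum>k<n. D k \<omega>)}"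
  proof (rule finite_measure_mono)
    show "(\<Union>i\<in>{..n}. A i \<inter> B i) \<subseteq> {\<omega> \<in> space M. a \<le> norm (\<Sum>k<n. D k \<omega>)}"
    proof
      fix \<omega> assume "\<omega> \<in> (\<Union>i\<in>{..n}. A i \<inter> B i)"
      then obtain i where i: "i \<le> n" "\<omega> \<in> A i" "\<omega> \<in> B i" by auto
      have "(\<Sum>k<n. D k \<omega>) = (\<Sum>k<i. D k \<omega>) + (\<Sum>k\<in>{i..<n}. D k \<omega>)"
        using i(1) by (simp add: lessThan_atLeast0 sum.atLeastLessThan_concat)
      then show "\<omega> \<in> {\<omega> \<in> space M. a \<le> norm (\<Sum>k<n. D k \<omega>)}"
        using i norm_diff_ineq[of "\<Sum>k<i. D k \<omega>" "\<Sum>k\<in>{i..<n}. D k \<omega>"]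
        by (auto simp: A_def B_def)
    qed
  qed (use sum_rv[of "{..<n}"] in measurable)
  finally show ?thesis unfolding union .
qed

text \<open>By independence the probability is a product, each factor being at most 1 - p <=
  exp(-p).\<close>

lemma (in prob_space) prob_all_small_le_exp:
  fixes D :: "nat \<Rightarrow> 'a \<Rightarrow> 'b::euclidean_space"
  assumes indep: "indep_vars (\<lambda>_. borel) D I" and J: "J \<subseteq> I" "finite J"
    and p: "\<And>i. i \<in> J \<Longrightarrow> p i \<le> prob {\<omega> \<in> space M. c i < norm (D i \<omega>)}"
  shows "prob {\<omega> \<in> space M. \<forall>i\<in>J. norm (D i \<omega>) \<le> c i} \<le> exp (- (\<Sum>i\<in>J. p i))"
proof (cases "J = {}")
  case False
  have rv: "D k \<in> borel_measurable M" if "k \<in> J" for k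
    using indep that J by (auto simp: indep_vars_def)
  have "{\<omega> \<in> space M. \<forall>i\<in>J. norm (D i \<omega>) \<le> c i} = (\<Inter>i\<in>J. D i -` {y. norm y \<le> c i} \<inter> space M)"
    using False by auto
  also have "prob \<dots> = (\<Prod>i\<in>J. prob (D i -` {y. norm y \<le> c i} \<inter> space M))"
    using J False by (intro indep_varsD[OF indep]) auto
  also have "\<dots> \<le> (\<Prod>i\<in>J. exp (- p i))"
  proof (intro prod_mono conjI)
    fix i assume i: "i \<in> J"
    note rv[OF i, measurable]
    have "D i -` {y. norm y \<le> c i} \<inter> space M = space M - {\<omega> \<in> space M. c i < norm (D i \<omega>)}"
      by auto
    then have "prob (D i -` {y. norm y \<le> c i} \<inter> space M) = 1 - prob {\<omega> \<in> space M. c i < norm (D i \<omega>)}"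
      by (simp add: prob_compl)
    also have "\<dots> \<le> 1 + - p i" using p[OF i] by simp
    also have "\<dots> \<le> exp (- p i)" by (rule exp_ge_add_one_self)
    finally show "prob (D i -` {y. norm y \<le> c i} \<inter> space M) \<le> exp (- p i)" .
  qed auto
  also have "\<dots> = exp (- (\<Sum>i\<in>J. p i))"
    using J by (simp add: exp_sum sum_negf[symmetric])
  finally show ?thesis .
qed simp

text \<open>The grid point used is the first one strictly to the right of s. Right-continuity keeps
  the norm above r on an interval there, and the mesh is chosen shorter than that interval. For s =
  t there is no room to the right, but t is itself a grid point.\<close>

lemma right_continuous_dyadic_witness:
  fixes x :: "real \<Rightarrow> 'a::real_normed_vector"
  assumes x: "\<And>t. 0 \<le> t \<Longrightarrow> (x \<longlongrightarrow> x t) (at_right t)"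
    and s: "0 \<le> s" "s \<le> t" "r < norm (x s)"
  shows "\<exists>n i :: nat. i \<le> 2 ^ n \<and> r < norm (x (t * real i / 2 ^ n))"
proof (cases "s = t")
  case True
  then show ?thesis using s by (intro exI[of _ 0] exI[of _ 1]) simp
next
  case False
  then have "0 < t" "s < t" using s by auto
  have "((\<lambda>u. norm (x u)) \<longlongrightarrow> norm (x s)) (at_right s)"
    using x[OF s(1)] by (rule tendsto_norm)
  from order_tendstoD(1)[OF this s(3)] obtain e where e: "e > s" "\<And>u. s < u \<Longrightarrow> u < e \<Longrightarrow> r < norm (x u)"
    unfolding eventually_at_right_field by blast
  define d where "d = min e t - s"
  have "d > 0" using e(1) \<open>s < t\<close> by (simp add: d_def)
  obtain n where n: "t / d < 2 ^ n"
    using real_arch_pow[of 2 "t / d"] by auto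
  define i where "i = nat \<lfloor>s * 2 ^ n / t\<rfloor> + 1"
  have "real i = of_int \<lfloor>s * 2 ^ n / t\<rfloor> + 1"
    using s \<open>0 < t\<close> by (simp add: i_def)
  then have "s * 2 ^ n / t < real i" "real i \<le> s * 2 ^ n / t + 1"
    by linarith+
  then have 1: "s < t * real i / 2 ^ n" and "t * real i / 2 ^ n \<le> s + t / 2 ^ n"
    using \<open>0 < t\<close> by (simp_all add: field_simps)
  moreover have "t / 2 ^ n < d"
    using n \<open>d > 0\<close> by (simp add: field_simps)
  ultimately have 2: "t * real i / 2 ^ n < min e t"
    unfolding d_def by linarith
  then have "real i < 2 ^ n" using \<open>0 < t\<close> by (simp add: field_simps)
  then have "i \<le> 2 ^ n" by (metis less_imp_le of_nat_less_iff of_nat_numeral of_nat_power)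
  with 1 2 e(2) show ?thesis by (intro exI[of _ n] exI[of _ i]) auto
qed

text \<open>Countably many times suffice, which is the source of the measurability of
  \<open>running_sup\<close>.\<close>

lemma running_sup_eq_dyadic:
  assumes x: "\<And>s. 0 \<le> s \<Longrightarrow> ((\<lambda>u. X u \<omega>) \<longlongrightarrow> X s \<omega>) (at_right s)" and "0 \<le> t"
  shows "running_sup X t \<omega> = (SUP n. SUP i\<in>{..2 ^ n}. ennreal (norm (X (t * real i / 2 ^ n) \<omega>)))"
    (is "_ = ?S")
proof (rule antisym)
  show "running_sup X t \<omega> \<le> ?S"
    unfolding running_sup_def
  proof (rule SUP_least, rule ccontr)
    fix s assume s: "s \<in> {0..t}" and "\<not> ennreal (norm (X s \<omega>)) \<le> ?S"
    then have less: "?S < ennreal (norm (X s \<omega>))" by simp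
    then obtain r where r: "?S = ennreal r" "0 \<le> r"
      by (cases ?S) auto
    then have "r < norm (X s \<omega>)" using less by (simp only: ennreal_less_iff)
    then obtain n i :: nat where ni: "i \<le> 2 ^ n" "r < norm (X (t * real i / 2 ^ n) \<omega>)"
      using right_continuous_dyadic_witness[of "\<lambda>u. X u \<omega>" s t r] x s by auto
    have "ennreal r < ennreal (norm (X (t * real i / 2 ^ n) \<omega>))"
      using ni r by (simp add: ennreal_less_iff)
    also have "\<dots> \<le> ?S"
      using ni by (intro SUP_upper2[of n] SUP_upper2[of i]) auto
    finally show False using r by simp
  qed
  show "?S \<le> running_sup X t \<omega>"
    unfolding running_sup_def
  proof (intro SUP_least)
    fix n i :: nat assume "i \<in> {..2 ^ n}"
    then have "real i \<le> 2 ^ n" by (metis atMost_iff of_nat_le_iff of_nat_numeral of_nat_power)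
    then have "t * real i / 2 ^ n \<in> {0..t}"
      using \<open>0 \<le> t\<close> by (auto simp: divide_le_eq mult_left_mono)
    then show "ennreal (norm (X (t * real i / 2 ^ n) \<omega>)) \<le> (SUP s\<in>{0..t}. ennreal (norm (X s \<omega>)))"
      by (rule SUP_upper)
  qed
qed

section \<open>Grid increments and running supremum of a Levy process\<close>

context levy_process
begin

lemma right_continuous: "\<omega> \<in> space M \<Longrightarrow> 0 \<le> t \<Longrightarrow> ((\<lambda>u. X u \<omega>) \<longlongrightarrow> X t \<omega>) (at_right t)"
  using cadlag_paths by (auto simp: cadlag_def)

lemma running_sup_measurable [measurable]:
  assumes "0 \<le> t" shows "running_sup X t \<in> borel_measurable M"
proof -
  have [measurable]: "X (t * real i / 2 ^ n) \<in> borel_measurable M" for i n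
    using assms by (intro random_variable_X) simp
  have "(\<lambda>\<omega>. SUP n. SUP i\<in>{..2 ^ n}. ennreal (norm (X (t * real i / 2 ^ n) \<omega>))) \<in> borel_measurable M"
    by measurable
  moreover have "running_sup X t \<omega> = (SUP n. SUP i\<in>{..2 ^ n}. ennreal (norm (X (t * real i / 2 ^ n) \<omega>)))"
    if "\<omega> \<in> space M" for \<omega>
    using running_sup_eq_dyadic[of X \<omega> t] right_continuous[OF that] assms by simp
  ultimately show ?thesis
    by (subst measurable_cong) auto
qed

lemma prob_increment:
  assumes "0 \<le> s" "s \<le> t" "S \<in> sets borel"
  shows "prob {\<omega> \<in> space M. X t \<omega> - X s \<omega> \<in> S} = prob {\<omega> \<in> space M. X (t - s) \<omega> \<in> S}"
proof -
  have [measurable]: "X t \<in> borel_measurable M" "X s \<in> borel_measurable M" "X (t - s) \<in> borel_measurable M"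
    using assms by (auto intro: random_variable_X)
  have "measure (distr M borel (\<lambda>\<omega>. X t \<omega> - X s \<omega>)) S = measure (distr M borel (X (t - s))) S"
    using stationary_increments[OF assms(1,2)] by simp
  then show ?thesis
    using assms(3) by (simp add: measure_distr vimage_def Int_def conj_commute)
qed

definition increment :: "real \<Rightarrow> nat \<Rightarrow> 'w \<Rightarrow> real ^ 'd" where
  "increment h i \<omega> = X (real (Suc i) * h) \<omega> - X (real i * h) \<omega>"

lemma indep_increment:
  assumes "0 < h" shows "indep_vars (\<lambda>_. borel) (increment h) {..<n}"
  unfolding increment_def
  by (rule independent_increments[of "\<lambda>i. real i * h"]) (use assms in auto)

lemma sum_increment: "i \<le> n \<Longrightarrow> (\<Sum>k\<in>{i..<n}. increment h k \<omega>) = X (real n * h) \<omega> - X (real i * h) \<omega>"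
  unfolding increment_def by (rule sum_Suc_diff')

lemma sum_increment0:
  "\<omega> \<in> space M \<Longrightarrow> (\<Sum>k<n. increment h k \<omega>) = X (real n * h) \<omega>"
  using sum_increment[of 0 n h \<omega>] by (simp add: lessThan_atLeast0 start_at_zero)

lemma prob_increment_grid:
  assumes "0 < h" "S \<in> sets borel"
  shows "prob {\<omega> \<in> space M. increment h i \<omega> \<in> S} = prob {\<omega> \<in> space M. X h \<omega> \<in> S}"
  using prob_increment[of "real i * h" "real (Suc i) * h" S] assms
  by (simp add: increment_def algebra_simps)

text \<open>By stationarity the increments from i to n sum to a copy of X at time (n - i)h, so a
  bound on one-time probabilities over [0, nh] supplies the q of Ottaviani's inequality.\<close>

lemma prob_max_grid_le:
  assumes "0 < h" and q: "\<And>u. 0 \<le> u \<Longrightarrow> u \<le> real n * h \<Longrightarrow> prob {\<omega> \<in> space M. b \<le> norm (X u \<omega>)} \<le> q"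
  shows "(1 - q) * prob {\<omega> \<in> space M. \<exists>i\<le>n. a + b \<le> norm (X (real i * h) \<omega>)}
    \<le> prob {\<omega> \<in> space M. a \<le> norm (X (real n * h) \<omega>)}"
proof -
  have "(1 - q) * prob {\<omega> \<in> space M. \<exists>i\<le>n. a + b \<le> norm (\<Sum>k<i. increment h k \<omega>)}
    \<le> prob {\<omega> \<in> space M. a \<le> norm (\<Sum>k<n. increment h k \<omega>)}"
  proof (rule ottaviani_inequality[OF indep_increment[OF assms(1)]])
    fix i assume "i \<le> n"
    then have *: "real i * h \<le> real n * h" using assms by simp
    have "prob {\<omega> \<in> space M. b \<le> norm (\<Sum>k = i..<n. increment h k \<omega>)} =
      prob {\<omega> \<in> space M. X (real n * h) \<omega> - X (real i * h) \<omega> \<in> {y. b \<le> norm y}}"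
      using \<open>i \<le> n\<close> by (simp add: sum_increment)
    also have "\<dots> = prob {\<omega> \<in> space M. X (real n * h - real i * h) \<omega> \<in> {y. b \<le> norm y}}"
      using * assms by (intro prob_increment) auto
    also have "\<dots> \<le> q"
      using q[of "real n * h - real i * h"] * assms by simp
    finally show "prob {\<omega> \<in> space M. b \<le> norm (\<Sum>k = i..<n. increment h k \<omega>)} \<le> q" .
  qed
  then show ?thesis
    by (simp add: sum_increment0 cong: conj_cong)
qed

text \<open>The supremum need not be attained, so a level c for it only yields a time with norm
  above the smaller level a + b, and then a dyadic time of this kind. The dyadic grids are nested,
  hence the grid events increase and their probabilities converge to that of the union.\<close>

lemma prob_running_sup_le:
  assumes "0 < t" "q \<le> 1" "a + b < c"
    and q: "\<And>u. 0 \<le> u \<Longrightarrow> u \<le> t \<Longrightarrow> prob {\<omega> \<in> space M. b \<le> norm (X u \<omega>)} \<le> q"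
    and "0 < a + b"
  shows "(1 - q) * prob {\<omega> \<in> space M. ennreal c \<le> running_sup X t \<omega>}
    \<le> prob {\<omega> \<in> space M. a \<le> norm (X t \<omega>)}"
proof -
  define A where "A n = {\<omega> \<in> space M. \<exists>i\<le>2 ^ n. a + b \<le> norm (X (real i * (t / 2 ^ n)) \<omega>)}" for n :: nat
  have rv [measurable]: "X (real i * (t / 2 ^ n)) \<in> borel_measurable M" for i n
    using assms by (intro random_variable_X) simp
  have A_sets [measurable]: "A n \<in> events" for n
    unfolding A_def by measurable
  have "incseq A"
  proof (rule incseq_SucI, safe)
    fix n \<omega> assume "\<omega> \<in> A n"
    then obtain i where i: "\<omega> \<in> space M" "i \<le> 2 ^ n" "a + b \<le> norm (X (real i * (t / 2 ^ n)) \<omega>)"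
      by (auto simp: A_def)
    moreover have "real (2 * i) * (t / 2 ^ Suc n) = real i * (t / 2 ^ n)" by simp
    ultimately show "\<omega> \<in> A (Suc n)"
      unfolding A_def by (intro CollectI conjI exI[of _ "2 * i"]) (simp_all only:, simp_all)
  qed
  then have lim: "(\<lambda>n. prob (A n)) \<longlonglongrightarrow> prob (\<Union>n. A n)"
    by (intro finite_Lim_measure_incseq) auto
  have "(1 - q) * prob (A n) \<le> prob {\<omega> \<in> space M. a \<le> norm (X t \<omega>)}" for n
    using prob_max_grid_le[of "t / 2 ^ n" "2 ^ n" b q a] assms by (simp add: A_def)
  then have "(1 - q) * prob (\<Union>n. A n) \<le> prob {\<omega> \<in> space M. a \<le> norm (X t \<omega>)}"
    by (intro LIMSEQ_le_const2[OF tendsto_mult_left[OF lim]]) auto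
  moreover have "prob {\<omega> \<in> space M. ennreal c \<le> running_sup X t \<omega>} \<le> prob (\<Union>n. A n)"
  proof (rule finite_measure_mono)
    show "{\<omega> \<in> space M. ennreal c \<le> running_sup X t \<omega>} \<subseteq> (\<Union>n. A n)"
    proof safe
      fix \<omega> assume \<omega>: "\<omega> \<in> space M" "ennreal c \<le> running_sup X t \<omega>"
      have "ennreal (a + b) < ennreal c" using assms by (simp add: ennreal_less_iff)
      also note \<omega>(2)
      finally obtain s where s: "s \<in> {0..t}" "ennreal (a + b) < ennreal (norm (X s \<omega>))"
        unfolding running_sup_def less_SUP_iff by blast
      then have "a + b < norm (X s \<omega>)" using assms by (simp add: ennreal_less_iff)
      then obtain n i :: nat where "i \<le> 2 ^ n" "a + b < norm (X (t * real i / 2 ^ n) \<omega>)"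
        using right_continuous_dyadic_witness[of "\<lambda>u. X u \<omega>" s t "a + b"]
          right_continuous[OF \<omega>(1)] s by auto
      then show "\<omega> \<in> (\<Union>n. A n)"
        using \<omega> by (intro UN_I[of n]) (auto simp: A_def mult.commute intro!: exI[of _ i])
    qed
  qed auto
  ultimately show ?thesis
    using mult_left_mono[of "prob {\<omega> \<in> space M. ennreal c \<le> running_sup X t \<omega>}" "prob (\<Union>n. A n)" "1 - q"]
      assms(2) by linarith
qed

end

section \<open>Dyadic blocks\<close>

definition dyadic_block :: "nat \<Rightarrow> real set" where
  "dyadic_block k = {(1/2) ^ Suc k <.. (1/2) ^ k}"

lemma dyadic_block_measurable [measurable]: "dyadic_block k \<in> sets borel"
  by (simp add: dyadic_block_def)

lemma dyadic_block_exists: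
  assumes "0 < t" "t \<le> (1/2) ^ m" shows "\<exists>k\<ge>m. t \<in> dyadic_block k"
proof -
  have "\<exists>n. (1/2) ^ n < t" using assms real_arch_pow_inv[of t "1/2"] by auto
  then obtain n where n: "(1/2) ^ n < t" "\<And>i. i < n \<Longrightarrow> \<not> (1/2) ^ i < t"
    using exists_least_iff[of "\<lambda>n. (1/2) ^ n < t"] by blast
  have "m < n"
    by (rule ccontr) (use n(1) assms(2) power_decreasing[of n m "1/2 :: real"] in linarith)
  then obtain k where k: "n = Suc k" "m \<le> k" by (cases n) auto
  then show ?thesis using n by (auto simp: dyadic_block_def not_less intro!: exI[of _ k])
qed

lemma disjoint_dyadic_block: "disjoint_family dyadic_block"
proof -
  have "dyadic_block i \<inter> dyadic_block j = {}" if "i < j" for i j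
    using power_decreasing[of "Suc i" j "1/2 :: real"] that by (auto simp: dyadic_block_def)
  then show ?thesis
    unfolding disjoint_family_on_def by (metis Int_commute linorder_neqE_nat)
qed

lemma emeasure_dyadic_block: "emeasure lborel (dyadic_block k) = ennreal ((1/2) ^ Suc k)"
  by (simp add: dyadic_block_def power_decreasing)

lemma nn_integral_dyadic_blocks:
  assumes [measurable]: "g \<in> borel_measurable borel"
  shows "(\<integral>\<^sup>+t\<in>{0<..(1/2) ^ m}. g t \<partial>lborel) = (\<Sum>k. \<integral>\<^sup>+t\<in>dyadic_block (k + m). g t \<partial>lborel)"
proof -
  have disj: "disjoint_family (\<lambda>k. dyadic_block (k + m))"
    using disjoint_dyadic_block by (auto simp: disjoint_family_on_def)
  have "t \<in> (\<Union>k. dyadic_block (k + m)) \<longleftrightarrow> t \<in> {0<..(1/2) ^ m}" for t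
  proof
    assume "t \<in> (\<Union>k. dyadic_block (k + m))"
    then obtain k where k: "t \<in> dyadic_block (k + m)" by auto
    have "(0::real) < (1/2) ^ Suc (k + m)" "(1/2::real) ^ (k + m) \<le> (1/2) ^ m"
      by (auto intro: power_decreasing)
    then show "t \<in> {0<..(1/2) ^ m}" using k unfolding dyadic_block_def greaterThanAtMost_iff by linarith
  next
    assume "t \<in> {0<..(1/2) ^ m}"
    then obtain k where "k \<ge> m" "t \<in> dyadic_block k" using dyadic_block_exists[of t m] by auto
    then show "t \<in> (\<Union>k. dyadic_block (k + m))"
      by (intro UN_I[of "k - m"]) auto
  qed
  then have union: "(\<Union>k. dyadic_block (k + m)) = {0<..(1/2) ^ m}" by blast
  have "(\<Sum>k. \<integral>\<^sup>+t\<in>dyadic_block (k + m). g t \<partial>lborel) =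
      (\<integral>\<^sup>+t. (\<Sum>k. g t * indicator (dyadic_block (k + m)) t) \<partial>lborel)"
    by (rule nn_integral_suminf[symmetric]) measurable
  also have "\<dots> = (\<integral>\<^sup>+t. g t * indicator {0<..(1/2) ^ m} t \<partial>lborel)"
    by (simp add: ennreal_suminf_cmult suminf_indicator[OF disj] union)
  finally show ?thesis by simp
qed

text \<open>On a block a non-increasing g lies between its values at the end points. This bound uses
  the right end point and feeds Borel--Cantelli; the next lemma uses the left one and transfers
  divergence of an integral to a series.\<close>

lemma dyadic_sum_le_nn_integral:
  fixes g :: "real \<Rightarrow> ennreal"
  assumes "g \<in> borel_measurable borel" and anti: "\<And>s t. 0 < s \<Longrightarrow> s \<le> t \<Longrightarrow> g t \<le> g s"
  shows "(\<Sum>k. ennreal ((1/2) ^ Suc (k + m)) * g ((1/2) ^ (k + m))) \<le> (\<integral>\<^sup>+t\<in>{0<..(1/2) ^ m}. g t \<partial>lborel)"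
  unfolding nn_integral_dyadic_blocks[OF assms(1)]
proof (rule suminf_le)
  fix k
  let ?D = "dyadic_block (k + m)"
  have "ennreal ((1/2) ^ Suc (k + m)) * g ((1/2) ^ (k + m)) = (\<integral>\<^sup>+t\<in>?D. g ((1/2) ^ (k + m)) \<partial>lborel)"
    by (subst nn_integral_cmult_indicator) (simp_all add: emeasure_dyadic_block mult.commute)
  also have "\<dots> \<le> (\<integral>\<^sup>+t\<in>?D. g t \<partial>lborel)"
  proof (rule nn_integral_mono)
    fix t :: real
    have "0 < t" "t \<le> (1/2) ^ (k + m)" if "t \<in> ?D"
      using that zero_less_power[of "1/2::real" "Suc (k + m)"] unfolding dyadic_block_def by auto
    then show "g ((1/2) ^ (k + m)) * indicator ?D t \<le> g t * indicator ?D t"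
      using anti by (auto simp: indicator_def)
  qed
  finally show "ennreal ((1/2) ^ Suc (k + m)) * g ((1/2) ^ (k + m)) \<le> (\<integral>\<^sup>+t\<in>?D. g t \<partial>lborel)" .
qed auto

lemma nn_integral_le_dyadic_sum:
  fixes g :: "real \<Rightarrow> ennreal"
  assumes "g \<in> borel_measurable borel" and anti: "\<And>s t. 0 < s \<Longrightarrow> s \<le> t \<Longrightarrow> g t \<le> g s"
  shows "(\<integral>\<^sup>+t\<in>{0<..(1/2) ^ m}. g t \<partial>lborel) \<le> (\<Sum>k. ennreal ((1/2) ^ Suc (k + m)) * g ((1/2) ^ Suc (k + m)))"
  unfolding nn_integral_dyadic_blocks[OF assms(1)]
proof (rule suminf_le)
  fix k
  let ?D = "dyadic_block (k + m)"
  have "(\<integral>\<^sup>+t\<in>?D. g t \<partial>lborel) \<le> (\<integral>\<^sup>+t\<in>?D. g ((1/2) ^ Suc (k + m)) \<partial>lborel)"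
  proof (rule nn_integral_mono)
    fix t :: real
    have "0 < (1/2::real) ^ Suc (k + m)" "(1/2) ^ Suc (k + m) \<le> t" if "t \<in> ?D"
      using that unfolding dyadic_block_def by auto
    then show "g t * indicator ?D t \<le> g ((1/2) ^ Suc (k + m)) * indicator ?D t"
      using anti by (auto simp: indicator_def)
  qed
  also have "\<dots> = ennreal ((1/2) ^ Suc (k + m)) * g ((1/2) ^ Suc (k + m))"
    by (subst nn_integral_cmult_indicator) (simp_all add: emeasure_dyadic_block mult.commute)
  finally show "(\<integral>\<^sup>+t\<in>?D. g t \<partial>lborel) \<le> ennreal ((1/2) ^ Suc (k + m)) * g ((1/2) ^ Suc (k + m))" .
qed auto

text \<open>Since \<open>f\<close> is non-decreasing, \<open>|X\<^sub>s| \<le> y f(s)\<close> for all \<open>s \<le> t\<close> yields \<open>|X\<^sub>s| \<le> y f(t)\<close>, so (L5) and (L6)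
  coincide path by path.\<close>

lemma Limsup_running_sup:
  fixes X :: "real \<Rightarrow> 'w \<Rightarrow> 'a::real_normed_vector"
  assumes "X 0 \<omega> = 0" and f: "mono f" "\<And>t. 0 < t \<Longrightarrow> 0 < f t"
  shows "Limsup (at_right 0) (\<lambda>t. running_sup X t \<omega> / ennreal (f t)) =
    Limsup (at_right 0) (\<lambda>t. ennreal (norm (X t \<omega>)) / ennreal (f t))" (is "?R = ?L")
proof (rule antisym)
  show "?R \<le> ?L"
  proof (rule dense_ge)
    fix y assume "?L < y"
    then have "\<forall>\<^sub>F t in at_right 0. ennreal (norm (X t \<omega>)) / ennreal (f t) < y"
      by (rule Limsup_lessD)
    then obtain d where d: "0 < d"
      "\<And>t. 0 < t \<Longrightarrow> t < d \<Longrightarrow> ennreal (norm (X t \<omega>)) / ennreal (f t) < y"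
      unfolding eventually_at_right_field by blast
    have "running_sup X t \<omega> / ennreal (f t) \<le> y" if t: "0 < t" "t < d" for t
    proof (rule divide_le_posI_ennreal)
      show "running_sup X t \<omega> \<le> ennreal (f t) * y"
        unfolding running_sup_def
      proof (rule SUP_least)
        fix s assume s: "s \<in> {0..t}"
        show "ennreal (norm (X s \<omega>)) \<le> ennreal (f t) * y"
        proof (cases "s = 0")
          case False
          then have "0 < s" "0 < f s" using s f by auto
          then have "ennreal (norm (X s \<omega>)) / ennreal (f s) < y" using d s t by auto
          then have "ennreal (norm (X s \<omega>)) / ennreal (f s) * ennreal (f s) \<le> y * ennreal (f s)"
            by (intro mult_right_mono) auto
          then have "ennreal (norm (X s \<omega>)) \<le> y * ennreal (f s)"
            using \<open>0 < f s\<close> by (simp add: divide_ennreal flip: ennreal_mult')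
          also have "\<dots> \<le> y * ennreal (f t)"
            using s f by (intro mult_left_mono ennreal_leI) (auto dest: monoD)
          finally show ?thesis by (simp add: mult.commute)
        qed (simp add: assms)
      qed
    qed (use f t in auto)
    then show "?R \<le> y"
      using d(1) by (intro Limsup_bounded) (auto simp: eventually_at_right_field)
  qed
  show "?L \<le> ?R"
  proof (rule Limsup_mono)
    have "ennreal (norm (X t \<omega>)) / ennreal (f t) \<le> running_sup X t \<omega> / ennreal (f t)" if "0 < t" for t
      unfolding running_sup_def using that by (intro divide_right_mono_ennreal SUP_upper) auto
    then show "\<forall>\<^sub>F t in at_right 0. ennreal (norm (X t \<omega>)) / ennreal (f t) \<le> running_sup X t \<omega> / ennreal (f t)"
      by (auto simp: eventually_at_right_field intro!: exI[of _ 1])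
  qed
qed

section \<open>Tail bounds under the sector condition\<close>

locale sector_levy_process = levy_process M X
  for M :: "'w measure" and X :: "real \<Rightarrow> 'w \<Rightarrow> real ^ 'd" +
  fixes b :: "real ^ 'd" and \<nu> :: "(real ^ 'd) measure" and C :: real
  assumes triplet: "has_levy_triplet M X b 0 \<nu>" and C_pos: "0 < C"
    and sector: "\<And>\<xi>. \<bar>Im (levy_exponent b 0 \<nu> \<xi>)\<bar> \<le> C * Re (levy_exponent b 0 \<nu> \<xi>)"
begin

abbreviation \<psi> :: "real ^ 'd \<Rightarrow> complex" where
  "\<psi> \<equiv> levy_exponent b 0 \<nu>"

lemma levy: "levy_measure \<nu>"
  using triplet by (simp add: has_levy_triplet_def)

lemmas [measurable_cong, simp] = sets_levy_measure[OF levy]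
lemmas [simp] = space_levy_measure[OF levy] levy_tail_nonneg[OF levy]

lemma measurable_levy_measure_iff [simp]: "g \<in> \<nu> \<rightarrow>\<^sub>M N \<longleftrightarrow> g \<in> borel \<rightarrow>\<^sub>M N"
  by (simp cong: measurable_cong_sets)

lemma char_eq: "0 \<le> t \<Longrightarrow> (CLINT \<omega>|M. iexp (\<xi> \<bullet> X t \<omega>)) = exp (- complex_of_real t * \<psi> \<xi>)"
  using triplet by (simp add: has_levy_triplet_def)

lemma levy_tail_measurable [measurable]: "levy_tail \<nu> \<in> borel_measurable borel"
proof -
  interpret sigma_finite_measure \<nu> by (rule sigma_finite_levy_measure[OF levy])
  have "(\<lambda>p :: real \<times> (real ^ 'd). min 1 ((norm (snd p) / fst p)\<^sup>2)) \<in> borel_measurable (borel \<Otimes>\<^sub>M borel)"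
    by measurable
  also have "borel_measurable (borel \<Otimes>\<^sub>M borel) = borel_measurable (borel \<Otimes>\<^sub>M \<nu>)"
    by (intro measurable_cong_sets sets_pair_measure_cong) auto
  finally show ?thesis
    unfolding levy_tail_def
    by (intro borel_measurable_lebesgue_integral) (simp add: case_prod_unfold)
qed

lemma emeasure_tail_measurable [measurable]:
  "(\<lambda>r. emeasure \<nu> {y. r \<le> norm y}) \<in> borel_measurable borel"
proof -
  interpret sigma_finite_measure \<nu> by (rule sigma_finite_levy_measure[OF levy])
  have "(\<lambda>p :: real \<times> (real ^ 'd). indicator {p. fst p \<le> norm (snd p)} p :: ennreal) \<in> borel_measurable (borel \<Otimes>\<^sub>M borel)"
    by measurable
  also have "borel_measurable (borel \<Otimes>\<^sub>M borel) = borel_measurable (borel \<Otimes>\<^sub>M \<nu>)"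
    by (intro measurable_cong_sets sets_pair_measure_cong) auto
  finally have "(\<lambda>r. \<integral>\<^sup>+y. indicator {p. fst p \<le> norm (snd p)} (r, y) \<partial>\<nu>) \<in> borel_measurable borel"
    by (intro borel_measurable_nn_integral) (simp add: case_prod_unfold)
  moreover have "(\<integral>\<^sup>+y. indicator {p. fst p \<le> norm (snd p)} (r, y) \<partial>\<nu>) = emeasure \<nu> {y. r \<le> norm y}" for r
  proof -
    have "(\<integral>\<^sup>+y. indicator {p. fst p \<le> norm (snd p)} (r, y) \<partial>\<nu>) = (\<integral>\<^sup>+y. indicator {y. r \<le> norm y} y \<partial>\<nu>)"
      by (intro nn_integral_cong) (simp add: indicator_def)
    then show ?thesis by simp
  qed
  ultimately show ?thesis by simp
qed

text \<open>This is where the sector condition acts: the modulus of \<psi>, drift included, is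
  controlled by the real part, which sees only \<nu>.\<close>

lemma norm_exponent_le:
  assumes "0 < r" "norm \<xi> \<le> 1 / r"
  shows "cmod (\<psi> \<xi>) \<le> 2 * (1 + C) * levy_tail \<nu> r"
proof -
  have "cmod (\<psi> \<xi>) \<le> \<bar>Re (\<psi> \<xi>)\<bar> + \<bar>Im (\<psi> \<xi>)\<bar>" by (rule cmod_le)
  also have "\<dots> \<le> (1 + C) * Re (\<psi> \<xi>)"
    using sector[of \<xi>] Re_levy_exponent_nonneg[OF levy, of b \<xi>] by (simp add: algebra_simps)
  also have "\<dots> \<le> (1 + C) * (2 * levy_tail \<nu> r)"
    using Re_levy_exponent_le[OF levy assms] C_pos by (intro mult_left_mono) auto
  finally show ?thesis by (simp only: mult_ac)
qed

text \<open>The real part of 1 - exp(-s\<psi>) also depends on the imaginary part of \<psi>, so the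
  bound is in terms of the modulus; \<open>norm_exponent_le\<close> leads back to
  \<open>levy_tail\<close>.\<close>

lemma expectation_one_minus_cos_le:
  assumes "0 \<le> s" shows "expectation (\<lambda>\<omega>. 1 - cos (\<xi> \<bullet> X s \<omega>)) \<le> s * cmod (\<psi> \<xi>)"
proof -
  note [measurable] = random_variable_X[OF assms]
  have int: "integrable M (\<lambda>\<omega>. iexp (\<xi> \<bullet> X s \<omega>))"
    by (intro integrable_iexp) auto
  have "expectation (\<lambda>\<omega>. 1 - cos (\<xi> \<bullet> X s \<omega>)) = expectation (\<lambda>\<omega>. Re (1 - iexp (\<xi> \<bullet> X s \<omega>)))"
    by (simp add: Re_exp)
  also have "\<dots> = Re (CLINT \<omega>|M. 1 - iexp (\<xi> \<bullet> X s \<omega>))"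
    using int by (intro integral_Re) auto
  also have "\<dots> = Re (1 - exp (- (complex_of_real s * \<psi> \<xi>)))"
    using int char_eq[OF assms, of \<xi>] by (simp add: prob_space)
  also have "\<dots> \<le> cmod (1 - exp (- (complex_of_real s * \<psi> \<xi>)))"
    by (rule complex_Re_le_cmod)
  also have "\<dots> \<le> cmod (complex_of_real s * \<psi> \<xi>)"
    using Re_levy_exponent_nonneg[OF levy, of b \<xi>] assms by (intro norm_one_minus_exp_le) simp
  finally show ?thesis using assms by (simp add: norm_mult)
qed

text \<open>8d comes from \<open>truncated_second_moment_le\<close> and 2(1 + C) from
  \<open>norm_exponent_le\<close>.\<close>

definition tail_const :: real where
  "tail_const = 8 * real CARD('d) * (2 * (1 + C))"

lemma tail_const_nonneg [simp]: "0 \<le> tail_const"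
  using C_pos by (simp add: tail_const_def)

lemma prob_tail_le:
  assumes "0 \<le> s" "0 < r"
  shows "prob {\<omega> \<in> space M. r \<le> norm (X s \<omega>)} \<le> tail_const * s * levy_tail \<nu> r"
proof -
  note [measurable] = random_variable_X[OF assms(1)]
  let ?B = "s * (2 * (1 + C) * levy_tail \<nu> r)"
  have B_nonneg: "0 \<le> ?B" using assms C_pos by simp
  have "(\<integral>\<^sup>+y. ennreal (min 1 ((1 / r * norm y)\<^sup>2)) \<partial>distr M borel (X s)) \<le>
      of_nat (8 * CARD('d)) * ennreal ?B"
  proof (rule truncated_second_moment_le)
    fix \<xi> :: "real ^ 'd" assume \<xi>: "norm \<xi> \<le> 1 / r"
    have "(\<integral>\<^sup>+y. ennreal (1 - cos (\<xi> \<bullet> y)) \<partial>distr M borel (X s)) =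
        (\<integral>\<^sup>+\<omega>. ennreal (1 - cos (\<xi> \<bullet> X s \<omega>)) \<partial>M)"
      by (rule nn_integral_distr) simp_all
    also have "\<dots> = ennreal (expectation (\<lambda>\<omega>. 1 - cos (\<xi> \<bullet> X s \<omega>)))"
      by (intro nn_integral_eq_integral integrable_const_bound[of _ 2])
         (auto simp: abs_le_iff intro: order_trans[OF _ cos_ge_minus_one] order_trans[OF cos_le_one])
    also have "\<dots> \<le> ennreal ?B"
      using expectation_one_minus_cos_le[OF assms(1), of \<xi>]
        mult_left_mono[OF norm_exponent_le[OF assms(2) \<xi>] assms(1)]
      by (intro ennreal_leI) linarith
    finally show "(\<integral>\<^sup>+y. ennreal (1 - cos (\<xi> \<bullet> y)) \<partial>distr M borel (X s)) \<le> ennreal ?B" .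
  next
    show "sigma_finite_measure (distr M borel (X s))"
      by (intro prob_space_imp_sigma_finite prob_space_distr) simp
  qed (use assms in auto)
  also have "of_nat (8 * CARD('d)) * ennreal ?B = ennreal (tail_const * s * levy_tail \<nu> r)"
    using B_nonneg by (simp add: tail_const_def ennreal_of_nat_eq_real_of_nat algebra_simps flip: ennreal_mult)
  finally have bound: "(\<integral>\<^sup>+y. ennreal (min 1 ((1 / r * norm y)\<^sup>2)) \<partial>distr M borel (X s)) \<le>
      ennreal (tail_const * s * levy_tail \<nu> r)" .
  have "ennreal (prob {\<omega> \<in> space M. r \<le> norm (X s \<omega>)}) = emeasure (distr M borel (X s)) {y. r \<le> norm y}"
    by (simp add: emeasure_distr emeasure_eq_measure vimage_def Int_def conj_commute)
  also have "\<dots> = (\<integral>\<^sup>+y. indicator {y. r \<le> norm y} y \<partial>distr M borel (X s))"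
    by (rule nn_integral_indicator[symmetric]) simp
  also have "\<dots> \<le> (\<integral>\<^sup>+y. ennreal (min 1 ((1 / r * norm y)\<^sup>2)) \<partial>distr M borel (X s))"
    using assms by (intro nn_integral_mono) (auto simp: indicator_def)
  also note bound
  finally show ?thesis using assms by (subst (asm) ennreal_le_iff) auto
qed

text \<open>Ottaviani's inequality with a = b = c/4. If q <= 1/2 the factor 1 - q costs 2; otherwise
  2q exceeds 1 and the bound is trivial. Going from c/4 back to c costs 16, hence 32.\<close>

lemma prob_running_sup_tail_le:
  assumes "0 < t" "0 < c"
  shows "prob {\<omega> \<in> space M. ennreal c \<le> running_sup X t \<omega>} \<le> 32 * tail_const * t * levy_tail \<nu> c"
proof -
  define q where "q = tail_const * t * levy_tail \<nu> (c / 4)"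
  have "prob {\<omega> \<in> space M. ennreal c \<le> running_sup X t \<omega>} \<le> 2 * q"
  proof (cases "q \<le> 1 / 2")
    case True
    have "(1 - q) * prob {\<omega> \<in> space M. ennreal c \<le> running_sup X t \<omega>} \<le>
        prob {\<omega> \<in> space M. c / 4 \<le> norm (X t \<omega>)}"
    proof (rule prob_running_sup_le)
      fix u assume "0 \<le> u" "u \<le> t"
      then have "tail_const * u * levy_tail \<nu> (c / 4) \<le> q"
        unfolding q_def by (intro mult_right_mono mult_left_mono) auto
      then show "prob {\<omega> \<in> space M. c / 4 \<le> norm (X u \<omega>)} \<le> q"
        using prob_tail_le[of u "c / 4"] \<open>0 \<le> u\<close> assms by simp
    qed (use assms True in auto)
    also have "\<dots> \<le> q"
      using prob_tail_le[of t "c / 4"] assms by (simp add: q_def)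
    finally have "(1 - q) * prob {\<omega> \<in> space M. ennreal c \<le> running_sup X t \<omega>} \<le> q" .
    moreover have "1 / 2 * prob {\<omega> \<in> space M. ennreal c \<le> running_sup X t \<omega>} \<le>
        (1 - q) * prob {\<omega> \<in> space M. ennreal c \<le> running_sup X t \<omega>}"
      using True by (intro mult_right_mono) auto
    ultimately show ?thesis by simp
  next
    case False
    then show ?thesis using prob_le_1[of "{\<omega> \<in> space M. ennreal c \<le> running_sup X t \<omega>}"] by linarith
  qed
  also have "levy_tail \<nu> (1 / 4 * c) \<le> max 1 (1 / (1 / 4)\<^sup>2) * levy_tail \<nu> c"
    by (rule levy_tail_scale_le[OF levy]) (use assms in auto)
  then have "2 * q \<le> 2 * (tail_const * t * (16 * levy_tail \<nu> c))"
    unfolding q_def using assms by (intro mult_left_mono) (auto simp: power2_eq_square)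
  finally show ?thesis by (simp add: mult_ac)
qed

end

section \<open>From (L1) to the other statements\<close>

text \<open>For \<open>b = 0\<close> the convention a/0 = infinity for a > 0 forces a = 0. Thus a
  vanishing tail in (A1) comes with a vanishing truncated second moment once the ratio is
  bounded.\<close>

lemma ennreal_le_of_divide_less:
  fixes a b c :: ennreal
  assumes "a / b < c" "c < \<top>" "b < \<top>"
  shows "a \<le> c * b"
proof (cases "b = 0")
  case True
  then show ?thesis using assms by (auto split: if_splits)
next
  case False
  have "a = a / b * b"
    using False assms by (simp add: divide_ennreal_def mult.assoc ennreal_inverse_mult mult.commute[of "inverse b"])
      (metis ennreal_divide_self divide_ennreal_def mult.right_neutral)
  also have "\<dots> \<le> c * b" using assms by (intro mult_right_mono) auto
  finally show ?thesis .
qed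

text \<open>Monotonicity on the whole line makes \<open>f\<close> Borel and removes domain
  conditions; the theorem is reduced to this setting by extending its function from (0, 1].\<close>

locale sector_levy_bound = sector_levy_process M X b \<nu> C
  for M :: "'w measure" and X :: "real \<Rightarrow> 'w \<Rightarrow> real ^ 'd" and b \<nu> C +
  fixes f :: "real \<Rightarrow> real"
  assumes mono_f: "mono f" and f_pos: "\<And>t. 0 < t \<Longrightarrow> 0 < f t"
begin

lemma f_measurable [measurable]: "f \<in> borel_measurable borel"
  using mono_f by (rule borel_measurable_mono)

lemma f_le: "s \<le> t \<Longrightarrow> f s \<le> f t"
  using mono_f by (auto dest: monoD)

text \<open>Finiteness of this integral is (L2) with \<epsilon> = c, by
  \<open>L2_if_tail_integral\<close> and \<open>tail_integral_if_L2\<close>. It is the hub through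
  which (L1) reaches the other statements.\<close>

definition tail_integral :: "real \<Rightarrow> ennreal" where
  "tail_integral c = (\<integral>\<^sup>+t\<in>{0<..1}. ennreal (levy_tail \<nu> (c * f t)) \<partial>lborel)"

lemma tail_integral_scale:
  assumes "0 < c" "0 < \<epsilon>" "tail_integral c < \<infinity>"
  shows "tail_integral \<epsilon> < \<infinity>"
proof -
  define k where "k = max 1 (1 / (\<epsilon> / c)\<^sup>2)"
  have "tail_integral \<epsilon> \<le> (\<integral>\<^sup>+t. ennreal k * (ennreal (levy_tail \<nu> (c * f t)) * indicator {0<..1} t) \<partial>lborel)"
    unfolding tail_integral_def
  proof (rule nn_integral_mono)
    fix t :: real
    show "ennreal (levy_tail \<nu> (\<epsilon> * f t)) * indicator {0<..1} t
        \<le> ennreal k * (ennreal (levy_tail \<nu> (c * f t)) * indicator {0<..1} t)"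
    proof (cases "t \<in> {0<..1}")
      case True
      then have "levy_tail \<nu> (\<epsilon> / c * (c * f t)) \<le> k * levy_tail \<nu> (c * f t)"
        unfolding k_def using assms f_pos by (intro levy_tail_scale_le[OF levy]) auto
      moreover have "\<epsilon> / c * (c * f t) = \<epsilon> * f t" using assms by simp
      ultimately have "ennreal (levy_tail \<nu> (\<epsilon> * f t)) \<le> ennreal (k * levy_tail \<nu> (c * f t))"
        by (intro ennreal_leI) simp
      then show ?thesis
        using True by (simp add: k_def ennreal_mult')
    qed simp
  qed
  also have "\<dots> = ennreal k * tail_integral c"
    unfolding tail_integral_def by (rule nn_integral_cmult) measurable
  also have "\<dots> < \<infinity>"
    using assms by (simp add: ennreal_mult_less_top)
  finally show ?thesis .
qed

lemma L1_if_tail_integral: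
  assumes "0 < c" "tail_integral c < \<infinity>"
  shows "(\<integral>\<^sup>+t\<in>{0<..1}. emeasure \<nu> {y. norm y \<ge> c * f t} \<partial>lborel) < \<infinity>"
proof -
  have "(\<integral>\<^sup>+t\<in>{0<..1}. emeasure \<nu> {y. norm y \<ge> c * f t} \<partial>lborel) \<le> tail_integral c"
    unfolding tail_integral_def
    using emeasure_le_levy_tail[OF levy, of "c * f t" for t] f_pos assms
    by (intro nn_integral_mono) (auto simp: indicator_def)
  then show ?thesis using assms(2) by (rule le_less_trans)
qed

lemma L2_if_tail_integral:
  assumes "0 < \<epsilon>" "tail_integral \<epsilon> < \<infinity>"
  shows "(\<integral>\<^sup>+t\<in>{0<..1}. (SUP \<xi>\<in>{\<xi>. norm \<xi> \<le> 1 / (\<epsilon> * f t)}. ennreal (cmod (\<psi> \<xi>))) \<partial>lborel) < \<infinity>"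
proof -
  have "(\<integral>\<^sup>+t\<in>{0<..1}. (SUP \<xi>\<in>{\<xi>. norm \<xi> \<le> 1 / (\<epsilon> * f t)}. ennreal (cmod (\<psi> \<xi>))) \<partial>lborel)
    \<le> (\<integral>\<^sup>+t. ennreal (2 * (1 + C)) * (ennreal (levy_tail \<nu> (\<epsilon> * f t)) * indicator {0<..1} t) \<partial>lborel)"
  proof (rule nn_integral_mono)
    fix t :: real
    have "(SUP \<xi>\<in>{\<xi>. norm \<xi> \<le> 1 / (\<epsilon> * f t)}. ennreal (cmod (\<psi> \<xi>))) \<le>
        ennreal (2 * (1 + C)) * ennreal (levy_tail \<nu> (\<epsilon> * f t))" if "0 < t"
    proof (rule SUP_least)
      fix \<xi> :: "real ^ 'd" assume "\<xi> \<in> {\<xi>. norm \<xi> \<le> 1 / (\<epsilon> * f t)}"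
      then have "cmod (\<psi> \<xi>) \<le> 2 * (1 + C) * levy_tail \<nu> (\<epsilon> * f t)"
        using assms f_pos that by (intro norm_exponent_le) auto
      then show "ennreal (cmod (\<psi> \<xi>)) \<le> ennreal (2 * (1 + C)) * ennreal (levy_tail \<nu> (\<epsilon> * f t))"
        using C_pos by (subst ennreal_mult[symmetric]) (simp_all only: ennreal_leI levy_tail_nonneg[OF levy], simp)
    qed
    then show "(SUP \<xi>\<in>{\<xi>. norm \<xi> \<le> 1 / (\<epsilon> * f t)}. ennreal (cmod (\<psi> \<xi>))) * indicator {0<..1} t
      \<le> ennreal (2 * (1 + C)) * (ennreal (levy_tail \<nu> (\<epsilon> * f t)) * indicator {0<..1} t)"
      by (auto simp: indicator_def)
  qed
  also have "\<dots> = ennreal (2 * (1 + C)) * tail_integral \<epsilon>"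
    unfolding tail_integral_def by (rule nn_integral_cmult) measurable
  also have "\<dots> < \<infinity>"
    using assms by (simp add: ennreal_mult_less_top)
  finally show ?thesis .
qed

lemma tail_integral_if_L2:
  assumes "0 < \<epsilon>"
    "(\<integral>\<^sup>+t\<in>{0<..1}. (SUP \<xi>\<in>{\<xi>. norm \<xi> \<le> 1 / (\<epsilon> * f t)}. ennreal (cmod (\<psi> \<xi>))) \<partial>lborel) < \<infinity>"
  shows "tail_integral \<epsilon> < \<infinity>"
proof -
  let ?N = "of_nat (8 * CARD('d)) :: ennreal"
  let ?S = "\<lambda>t. SUP \<xi>\<in>{\<xi>. norm \<xi> \<le> 1 / (\<epsilon> * f t)}. ennreal (cmod (\<psi> \<xi>))"
  have N: "?N \<noteq> 0" "?N \<noteq> \<top>" "0 < ?N"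
    using ennreal_of_nat_neq_top[of "8 * CARD('d)"] by (auto simp: zero_less_iff_neq_zero)
  \<comment> \<open>The constant is divided out on the left because \<open>nn_integral_cmult\<close>
    is then applied to \<open>levy_tail\<close>, which is known to be measurable, rather than to the
    supremum \<open>?S\<close>.\<close>
  have "(\<integral>\<^sup>+t. inverse ?N * (ennreal (levy_tail \<nu> (\<epsilon> * f t)) * indicator {0<..1} t) \<partial>lborel)
     \<le> (\<integral>\<^sup>+t\<in>{0<..1}. ?S t \<partial>lborel)"
  proof (rule nn_integral_mono)
    fix t :: real
    have "inverse ?N * ennreal (levy_tail \<nu> (\<epsilon> * f t)) \<le> ?S t" if "0 < t"
    proof -
      have "ennreal (levy_tail \<nu> (\<epsilon> * f t)) \<le> ?N * ?S t"
      proof (rule levy_tail_le_Re_levy_exponent[OF levy])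
        fix \<xi> :: "real ^ 'd" assume "norm \<xi> \<le> 1 / (\<epsilon> * f t)"
        then have "ennreal (cmod (\<psi> \<xi>)) \<le> ?S t" by (intro SUP_upper) auto
        then show "ennreal (Re (\<psi> \<xi>)) \<le> ?S t"
          using complex_Re_le_cmod[of "\<psi> \<xi>"] by (meson ennreal_leI order_trans)
      qed (use assms f_pos that in auto)
      then show ?thesis
        using divide_le_posI_ennreal[OF N(3), of "ennreal (levy_tail \<nu> (\<epsilon> * f t))" "?S t"]
        by (simp add: divide_ennreal_def mult.commute)
    qed
    then show "inverse ?N * (ennreal (levy_tail \<nu> (\<epsilon> * f t)) * indicator {0<..1} t) \<le> ?S t * indicator {0<..1} t"
      by (auto simp: indicator_def)
  qed
  also note assms(2)
  finally have fin: "(\<integral>\<^sup>+t. inverse ?N * (ennreal (levy_tail \<nu> (\<epsilon> * f t)) * indicator {0<..1} t) \<partial>lborel) < \<infinity>" .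
  have "(\<integral>\<^sup>+t. inverse ?N * (ennreal (levy_tail \<nu> (\<epsilon> * f t)) * indicator {0<..1} t) \<partial>lborel) =
      inverse ?N * tail_integral \<epsilon>"
    unfolding tail_integral_def by (rule nn_integral_cmult) measurable
  with fin have "inverse ?N * tail_integral \<epsilon> < \<infinity>" by simp
  moreover have "inverse ?N \<noteq> 0" using N(2) by (simp add: ennreal_inverse_eq_0_iff)
  ultimately show ?thesis
    by (auto simp: ennreal_mult_less_top)
qed

lemma L3_if_tail_integral:
  assumes "0 < \<epsilon>" "tail_integral \<epsilon> < \<infinity>"
  shows "(\<integral>\<^sup>+t\<in>{0<..1}. ennreal
          (measure M {\<omega> \<in> space M. running_sup X t \<omega> \<ge> ennreal (\<epsilon> * f t)} * (1 / t)) \<partial>lborel) < \<infinity>"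
proof -
  have "(\<integral>\<^sup>+t\<in>{0<..1}. ennreal
          (measure M {\<omega> \<in> space M. running_sup X t \<omega> \<ge> ennreal (\<epsilon> * f t)} * (1 / t)) \<partial>lborel)
    \<le> (\<integral>\<^sup>+t. ennreal (32 * tail_const) * (ennreal (levy_tail \<nu> (\<epsilon> * f t)) * indicator {0<..1} t) \<partial>lborel)"
  proof (rule nn_integral_mono)
    fix t :: real
    have "measure M {\<omega> \<in> space M. running_sup X t \<omega> \<ge> ennreal (\<epsilon> * f t)} * (1 / t) \<le>
        32 * tail_const * levy_tail \<nu> (\<epsilon> * f t)" if "0 < t"
      using prob_running_sup_tail_le[of t "\<epsilon> * f t"] that assms f_pos by (simp add: field_simps)
    then show "ennreal (measure M {\<omega> \<in> space M. running_sup X t \<omega> \<ge> ennreal (\<epsilon> * f t)} * (1 / t)) * indicator {0<..1} t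
      \<le> ennreal (32 * tail_const) * (ennreal (levy_tail \<nu> (\<epsilon> * f t)) * indicator {0<..1} t)"
      by (auto simp: indicator_def ennreal_leI simp flip: ennreal_mult')
  qed
  also have "\<dots> = ennreal (32 * tail_const) * tail_integral \<epsilon>"
    unfolding tail_integral_def by (rule nn_integral_cmult) measurable
  also have "\<dots> < \<infinity>"
    using assms by (simp add: ennreal_mult_less_top)
  finally show ?thesis .
qed

lemma AE_Limsup_le_if_tail_integral:
  assumes "0 < \<epsilon>" "tail_integral \<epsilon> < \<infinity>"
  shows "AE \<omega> in M. Limsup (at_right 0) (\<lambda>t. ennreal (norm (X t \<omega>)) / ennreal (f t)) \<le> ennreal \<epsilon>"
proof -
  \<comment> \<open>The supremum runs up to the right end of block k, while the threshold uses f at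
    its left end. Outside \<open>A k\<close> the bound therefore holds at every t of the
    block.\<close>
  define A where "A k = {\<omega> \<in> space M. ennreal (\<epsilon> * f ((1/2) ^ Suc k)) \<le> running_sup X ((1/2) ^ k) \<omega>}" for k
  have [measurable]: "running_sup X ((1/2) ^ k) \<in> borel_measurable M" for k
    by (rule running_sup_measurable) simp
  have A_sets: "A k \<in> events" for k unfolding A_def by measurable
  \<comment> \<open>The sum comparison attaches weight (1/2)^(k+2) to the point (1/2)^(k+1), while
    the supremum in \<open>A k\<close> runs up to time (1/2)^k; hence the factor 4 below.\<close>
  define p where "p k = (1/2) ^ Suc (k + 1) * levy_tail \<nu> (\<epsilon> * f ((1/2) ^ (k + 1)))" for k
  have "(\<Sum>k. ennreal (p k)) = (\<Sum>k. ennreal ((1/2) ^ Suc (k + 1)) * ennreal (levy_tail \<nu> (\<epsilon> * f ((1/2) ^ (k + 1)))))"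
    unfolding p_def by (subst ennreal_mult) auto
  also have "\<dots> \<le> (\<integral>\<^sup>+t\<in>{0<..(1/2) ^ 1}. ennreal (levy_tail \<nu> (\<epsilon> * f t)) \<partial>lborel)"
    using assms f_pos f_le
    by (intro dyadic_sum_le_nn_integral ennreal_leI levy_tail_antimono[OF levy]) auto
  also have "\<dots> \<le> tail_integral \<epsilon>"
    unfolding tail_integral_def by (intro nn_integral_mono) (auto simp: indicator_def)
  finally have "(\<Sum>k. ennreal (p k)) \<noteq> \<top>" using assms by (auto simp: top_unique)
  then have "summable p"
    by (intro summable_suminf_not_top) (auto simp: p_def)
  then have "summable (\<lambda>k. 32 * tail_const * 4 * p k)" by (rule summable_mult)
  then have "summable (\<lambda>k. prob (A k))"
  proof (rule summable_comparison_test_ev[rotated], intro always_eventually allI)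
    fix k
    have "prob (A k) \<le> 32 * tail_const * (1/2) ^ k * levy_tail \<nu> (\<epsilon> * f ((1/2) ^ Suc k))"
      unfolding A_def using assms f_pos by (intro prob_running_sup_tail_le) auto
    then show "norm (prob (A k)) \<le> 32 * tail_const * 4 * p k"
      by (simp add: p_def)
  qed
  then have "AE \<omega> in M. \<forall>\<^sub>F k in sequentially. \<omega> \<in> space M - A k"
    using A_sets by (intro borel_cantelli_AE1) (auto simp: less_top[symmetric])
  then show ?thesis
  proof eventually_elim
    case (elim \<omega>)
    then obtain m where m: "\<And>k. m \<le> k \<Longrightarrow> \<omega> \<in> space M - A k"
      unfolding eventually_sequentially by blast
    have "ennreal (norm (X t \<omega>)) / ennreal (f t) \<le> ennreal \<epsilon>" if t: "0 < t" "t < (1/2) ^ m" for t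
    proof (rule divide_le_posI_ennreal)
      obtain k where k: "m \<le> k" "t \<in> dyadic_block k"
        using dyadic_block_exists[of t m] t by auto
      have "ennreal (norm (X t \<omega>)) \<le> running_sup X ((1/2) ^ k) \<omega>"
        unfolding running_sup_def using k t by (intro SUP_upper) (auto simp: dyadic_block_def)
      also have "\<dots> \<le> ennreal (\<epsilon> * f ((1/2) ^ Suc k))"
        using m[OF k(1)] by (auto simp: A_def)
      also have "\<dots> \<le> ennreal (\<epsilon> * f t)"
        using k assms by (intro ennreal_leI mult_left_mono f_le) (auto simp: dyadic_block_def)
      finally show "ennreal (norm (X t \<omega>)) \<le> ennreal (f t) * ennreal \<epsilon>"
        using assms by (simp add: ennreal_mult' mult.commute)
    qed (use t f_pos in auto)
    then show ?case
      by (intro Limsup_bounded) (auto simp: eventually_at_right_field intro!: exI[of _ "(1/2) ^ m"])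
  qed
qed

lemma AE_Limsup_eq_0:
  assumes "\<And>\<epsilon>. 0 < \<epsilon> \<Longrightarrow> tail_integral \<epsilon> < \<infinity>"
  shows "AE \<omega> in M. Limsup (at_right 0) (\<lambda>t. ennreal (norm (X t \<omega>)) / ennreal (f t)) = 0"
proof -
  let ?L = "\<lambda>\<omega>. Limsup (at_right 0) (\<lambda>t. ennreal (norm (X t \<omega>)) / ennreal (f t))"
  have "AE \<omega> in M. \<forall>n. ?L \<omega> \<le> ennreal (inverse (real (Suc n)))"
    unfolding AE_all_countable using assms by (intro allI AE_Limsup_le_if_tail_integral) auto
  then show ?thesis
  proof eventually_elim
    case (elim \<omega>)
    have "(\<lambda>n. ennreal (inverse (real (Suc n)))) \<longlonglongrightarrow> ennreal 0"
      by (intro tendsto_ennrealI LIMSEQ_inverse_real_of_nat)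
    then have "?L \<omega> \<le> ennreal 0"
      using elim by (intro LIMSEQ_le_const) auto
    then show ?case by simp
  qed
qed

text \<open>For r below some d, (A1) bounds the contribution of jumps of size at most r to
  \<open>levy_tail\<close> by A times the tail, and larger jumps contribute the tail itself: the
  factor 1 + A. When c f(t) >= d, \<open>levy_tail\<close> is bounded by a constant, which is
  integrable over (0, 1].\<close>

lemma tail_integral_if_L1_A1:
  assumes "0 < c" "(\<integral>\<^sup>+t\<in>{0<..1}. emeasure \<nu> {y. norm y \<ge> c * f t} \<partial>lborel) < \<infinity>"
    and "condition_A1 \<nu>"
  shows "tail_integral c < \<infinity>"
proof -
  let ?Q = "\<lambda>r::real. (\<integral>\<^sup>+y\<in>{y. norm y \<le> r}. ennreal ((norm y)\<^sup>2) \<partial>\<nu>) /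
       (ennreal (r\<^sup>2) * emeasure \<nu> {y. norm y > r})"
  obtain A where A: "Limsup (at_right 0) ?Q < A" "A < \<infinity>"
    using assms(3) unfolding condition_A1_def by (meson dense)
  obtain d where d: "0 < d" "\<And>r. 0 < r \<Longrightarrow> r < d \<Longrightarrow> ?Q r < A"
    using Limsup_lessD[OF A(1)] unfolding eventually_at_right_field by blast
  have small: "ennreal (levy_tail \<nu> r) \<le> (1 + A) * emeasure \<nu> {y. r \<le> norm y}" if r: "0 < r" "r < d" for r
  proof -
    have fin: "emeasure \<nu> {y. norm y > r} \<le> emeasure \<nu> {y. r \<le> norm y}"
      by (intro emeasure_mono) auto
    then have fin': "emeasure \<nu> {y. norm y > r} < \<infinity>"
      using emeasure_levy_finite[OF levy r(1)] by (rule le_less_trans)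
    have "(\<integral>\<^sup>+y\<in>{y. norm y \<le> r}. ennreal ((norm y)\<^sup>2) \<partial>\<nu>) \<le> A * (ennreal (r\<^sup>2) * emeasure \<nu> {y. norm y > r})"
      using d(2)[OF r] A(2) fin' by (intro ennreal_le_of_divide_less) (auto simp: ennreal_mult_less_top)
    then have "ennreal (1 / r\<^sup>2) * (\<integral>\<^sup>+y\<in>{y. norm y \<le> r}. ennreal ((norm y)\<^sup>2) \<partial>\<nu>) \<le>
        ennreal (1 / r\<^sup>2) * (A * (ennreal (r\<^sup>2) * emeasure \<nu> {y. norm y > r}))"
      by (rule mult_left_mono) simp
    also have "\<dots> = ennreal (1 / r\<^sup>2) * ennreal (r\<^sup>2) * (A * emeasure \<nu> {y. norm y > r})"
      by (simp add: mult_ac)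
    also have "ennreal (1 / r\<^sup>2) * ennreal (r\<^sup>2) = 1"
      using r by (simp flip: ennreal_mult')
    finally have inner: "ennreal (1 / r\<^sup>2) * (\<integral>\<^sup>+y\<in>{y. norm y \<le> r}. ennreal ((norm y)\<^sup>2) \<partial>\<nu>) \<le>
        A * emeasure \<nu> {y. norm y > r}" by simp
    have "ennreal (levy_tail \<nu> r) \<le> (\<integral>\<^sup>+y. indicator {y. r < norm y} y +
        ennreal (1 / r\<^sup>2) * (ennreal ((norm y)\<^sup>2) * indicator {y. norm y \<le> r} y) \<partial>\<nu>)"
      unfolding ennreal_levy_tail[OF levy r(1)]
      by (intro nn_integral_mono) (auto simp: indicator_def power_divide ennreal_leI simp flip: ennreal_mult')
    also have "\<dots> = emeasure \<nu> {y. r < norm y} + ennreal (1 / r\<^sup>2) * (\<integral>\<^sup>+y\<in>{y. norm y \<le> r}. ennreal ((norm y)\<^sup>2) \<partial>\<nu>)"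
      by (subst nn_integral_add) (auto simp: nn_integral_cmult)
    also have "\<dots> \<le> emeasure \<nu> {y. r < norm y} + A * emeasure \<nu> {y. r < norm y}"
      using inner by (rule add_left_mono)
    also have "\<dots> = (1 + A) * emeasure \<nu> {y. r < norm y}"
      by (simp add: distrib_right)
    also have "\<dots> \<le> (1 + A) * emeasure \<nu> {y. r \<le> norm y}"
      using fin by (intro mult_left_mono) auto
    finally show ?thesis .
  qed
  let ?E = "\<lambda>t. emeasure \<nu> {y. norm y \<ge> c * f t}"
  have "tail_integral c \<le> (\<integral>\<^sup>+t. (1 + A) * (?E t * indicator {0<..1} t) +
      ennreal (levy_tail \<nu> (d / 2)) * indicator {0<..1} t \<partial>lborel)"
    unfolding tail_integral_def
  proof (rule nn_integral_mono)
    fix t :: real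
    have "ennreal (levy_tail \<nu> (c * f t)) \<le> (1 + A) * ?E t + ennreal (levy_tail \<nu> (d / 2))" if "0 < t"
    proof (cases "c * f t < d")
      case True
      then show ?thesis using small[of "c * f t"] that f_pos assms(1)
        by (intro add_increasing2) auto
    next
      case False
      then have "levy_tail \<nu> (c * f t) \<le> levy_tail \<nu> (d / 2)"
        using d by (intro levy_tail_antimono[OF levy]) auto
      then show ?thesis by (intro add_increasing ennreal_leI) auto
    qed
    then show "ennreal (levy_tail \<nu> (c * f t)) * indicator {0<..1} t \<le>
       (1 + A) * (?E t * indicator {0<..1} t) + ennreal (levy_tail \<nu> (d / 2)) * indicator {0<..1} t"
      by (auto simp: indicator_def)
  qed
  also have "\<dots> = (1 + A) * (\<integral>\<^sup>+t\<in>{0<..1}. ?E t \<partial>lborel) + ennreal (levy_tail \<nu> (d / 2))"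
    by (subst nn_integral_add) (auto simp: nn_integral_cmult nn_integral_cmult_indicator)
  also have "\<dots> < \<infinity>"
    using assms(2) A(2) by (auto simp: ennreal_mult_less_top)
  finally show ?thesis .
qed

text \<open>By Fubini, integrate over t first. For a jump y with r = |y|/c < 1, the times with f(t)
  <= r contribute their Lebesgue measure, and the others contribute r^2 times the integral of 1/f^2,
  which \<open>A2\<close> bounds by K times that same measure. Integrating over y and applying
  Fubini backwards recovers the integral in (L1).\<close>

lemma tail_integral_if_L1_A2:
  assumes "0 < c" "(\<integral>\<^sup>+t\<in>{0<..1}. emeasure \<nu> {y. norm y \<ge> c * f t} \<partial>lborel) < \<infinity>"
    and A2: "\<And>r. 0 < r \<Longrightarrow> r < 1 \<Longrightarrow> (\<integral>\<^sup>+t\<in>{t \<in> {0<..1}. r < f t}. ennreal (1 / (f t)\<^sup>2) \<partial>lborel)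
       \<le> ennreal (K / r\<^sup>2) * emeasure lborel {t \<in> {0<..1}. f t \<le> r}" and "0 < K"
  shows "tail_integral c < \<infinity>"
proof -
  interpret \<nu>: sigma_finite_measure \<nu> by (rule sigma_finite_levy_measure[OF levy])
  interpret pair_sigma_finite \<nu> lborel ..
  have borel_pair: "g \<in> borel_measurable (\<nu> \<Otimes>\<^sub>M lborel)" if "g \<in> borel_measurable (borel \<Otimes>\<^sub>M borel)"
    for g :: "(real ^ 'd) \<times> real \<Rightarrow> ennreal"
    using that measurable_cong_sets[OF sets_pair_measure_cong[of \<nu> borel lborel borel] refl, of borel] by auto
  let ?T = "\<lambda>y. {t \<in> {0<..1}. c * f t \<le> norm y}"
  let ?h = "\<lambda>y t. ennreal (min 1 ((norm y / (c * f t))\<^sup>2)) * indicator {0<..1} t"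
  have Fubini_h: "(\<integral>\<^sup>+t. (\<integral>\<^sup>+y. ?h y t \<partial>\<nu>) \<partial>lborel) = (\<integral>\<^sup>+y. (\<integral>\<^sup>+t. ?h y t \<partial>lborel) \<partial>\<nu>)"
  proof (rule Fubini')
    have "(\<lambda>p :: (real ^ 'd) \<times> real. ?h (fst p) (snd p)) \<in> borel_measurable (borel \<Otimes>\<^sub>M borel)"
      by measurable
    from borel_pair[OF this] show "(\<lambda>(y, t). ?h y t) \<in> borel_measurable (\<nu> \<Otimes>\<^sub>M lborel)"
      by (simp only: case_prod_unfold)
  qed
  have meas_T: "(\<lambda>p :: (real ^ 'd) \<times> real. indicator (?T (fst p)) (snd p) :: ennreal) \<in> borel_measurable (borel \<Otimes>\<^sub>M borel)"
  proof -
    have "(\<lambda>p :: (real ^ 'd) \<times> real. indicator (?T (fst p)) (snd p) :: ennreal) =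
        indicator {p. 0 < snd p \<and> snd p \<le> 1 \<and> c * f (snd p) \<le> norm (fst p)}"
      by (auto simp: indicator_def)
    then show ?thesis by simp
  qed
  have Fubini_T: "(\<integral>\<^sup>+t. (\<integral>\<^sup>+y. indicator (?T y) t \<partial>\<nu>) \<partial>lborel) = (\<integral>\<^sup>+y. (\<integral>\<^sup>+t. indicator (?T y) t \<partial>lborel) \<partial>\<nu>)"
    using borel_pair[OF meas_T] by (intro Fubini') (simp only: case_prod_unfold)
  define m where "m y = emeasure lborel (?T y)" for y :: "real ^ 'd"
  have [measurable]: "m \<in> borel_measurable borel"
  proof -
    have "(\<lambda>y. \<integral>\<^sup>+t. indicator (?T y) t \<partial>lborel) \<in> borel_measurable borel"
      using meas_T measurable_cong_sets[OF sets_pair_measure_cong[of borel borel lborel borel] refl, of borel]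
      by (intro lborel.borel_measurable_nn_integral) (simp add: case_prod_unfold)
    moreover have "m = (\<lambda>y. \<integral>\<^sup>+t. indicator (?T y) t \<partial>lborel)"
      by (rule ext) (simp add: m_def)
    ultimately show ?thesis by (simp only:)
  qed
  have pointwise: "(\<integral>\<^sup>+t. ?h y t \<partial>lborel) \<le> ennreal (1 + K) * emeasure lborel (?T y) + indicator {y. c \<le> norm y} y" for y
  proof -
    \<comment> \<open>\<open>A2\<close> covers 0 < r < 1 only. Jumps with |y| >= c contribute at
      most 1 each and have finite \<nu>-mass; for y = 0 the integrand vanishes.\<close>
    consider "y = 0" | "c \<le> norm y" | "y \<noteq> 0" "norm y < c" by linarith
    then show ?thesis
    proof cases
      case 2
      have "(\<integral>\<^sup>+t. ?h y t \<partial>lborel) \<le> (\<integral>\<^sup>+t. indicator {0<..1} t \<partial>(lborel :: real measure))"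
        by (intro nn_integral_mono) (auto simp: indicator_def)
      also have "\<dots> = 1" by simp
      finally show ?thesis using 2 by (simp add: add_increasing)
    next
      case 3
      define r where "r = norm y / c"
      have r: "0 < r" "r < 1" using 3 assms(1) by (auto simp: r_def)
      have T_eq: "?T y = {t \<in> {0<..1}. f t \<le> r}"
        using assms(1) by (auto simp: r_def field_simps)
      have "(\<integral>\<^sup>+t. ?h y t \<partial>lborel) \<le> (\<integral>\<^sup>+t. indicator (?T y) t +
          ennreal (r\<^sup>2) * (ennreal (1 / (f t)\<^sup>2) * indicator {t \<in> {0<..1}. r < f t} t) \<partial>lborel)"
      proof (rule nn_integral_mono)
        fix t :: real
        have "norm y / (c * f t) = r / f t" by (simp add: r_def)
        then show "?h y t \<le> indicator (?T y) t +
          ennreal (r\<^sup>2) * (ennreal (1 / (f t)\<^sup>2) * indicator {t \<in> {0<..1}. r < f t} t)"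
          unfolding T_eq
          by (auto simp: indicator_def power_divide ennreal_leI simp flip: ennreal_mult')
      qed
      also have "\<dots> = emeasure lborel (?T y) +
          ennreal (r\<^sup>2) * (\<integral>\<^sup>+t\<in>{t \<in> {0<..1}. r < f t}. ennreal (1 / (f t)\<^sup>2) \<partial>lborel)"
        by (subst nn_integral_add) (auto simp: nn_integral_cmult)
      also have "\<dots> \<le> emeasure lborel (?T y) + ennreal (r\<^sup>2) * (ennreal (K / r\<^sup>2) * emeasure lborel (?T y))"
        using A2[OF r] unfolding T_eq by (intro add_left_mono mult_left_mono) auto
      also have "ennreal (r\<^sup>2) * (ennreal (K / r\<^sup>2) * emeasure lborel (?T y)) = ennreal K * emeasure lborel (?T y)"
        using r \<open>0 < K\<close> by (simp add: mult.assoc[symmetric] flip: ennreal_mult')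
      also have "emeasure lborel (?T y) + ennreal K * emeasure lborel (?T y) = ennreal (1 + K) * emeasure lborel (?T y)"
        using \<open>0 < K\<close> by (simp add: distrib_right)
      finally show ?thesis by (rule order_trans) simp
    qed simp
  qed
  have "tail_integral c = (\<integral>\<^sup>+t. (\<integral>\<^sup>+y. ?h y t \<partial>\<nu>) \<partial>lborel)"
    unfolding tail_integral_def
  proof (rule nn_integral_cong)
    fix t :: real
    show "ennreal (levy_tail \<nu> (c * f t)) * indicator {0<..1} t = (\<integral>\<^sup>+y. ?h y t \<partial>\<nu>)"
      using assms(1) f_pos ennreal_levy_tail[OF levy, of "c * f t"] by (cases "t \<in> {0<..1}") auto
  qed
  also have "\<dots> = (\<integral>\<^sup>+y. (\<integral>\<^sup>+t. ?h y t \<partial>lborel) \<partial>\<nu>)" by (rule Fubini_h)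
  also have "\<dots> \<le> (\<integral>\<^sup>+y. ennreal (1 + K) * m y + indicator {y. c \<le> norm y} y \<partial>\<nu>)"
    unfolding m_def by (intro nn_integral_mono pointwise)
  also have "\<dots> = ennreal (1 + K) * (\<integral>\<^sup>+y. m y \<partial>\<nu>) + emeasure \<nu> {y. c \<le> norm y}"
    by (subst nn_integral_add) (simp_all add: nn_integral_cmult)
  also have "(\<integral>\<^sup>+y. m y \<partial>\<nu>) = (\<integral>\<^sup>+y. (\<integral>\<^sup>+t. indicator (?T y) t \<partial>lborel) \<partial>\<nu>)"
    by (simp add: m_def)
  also have "\<dots> = (\<integral>\<^sup>+t. (\<integral>\<^sup>+y. indicator (?T y) t \<partial>\<nu>) \<partial>lborel)" by (rule Fubini_T[symmetric])
  also have "\<dots> = (\<integral>\<^sup>+t\<in>{0<..1}. emeasure \<nu> {y. norm y \<ge> c * f t} \<partial>lborel)"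
  proof (rule nn_integral_cong)
    fix t :: real
    have "(\<integral>\<^sup>+y. indicator (?T y) t \<partial>\<nu>) = (\<integral>\<^sup>+y. indicator {y. norm y \<ge> c * f t} y * indicator {0<..1} t \<partial>\<nu>)"
      by (intro nn_integral_cong) (auto simp: indicator_def)
    also have "\<dots> = emeasure \<nu> {y. norm y \<ge> c * f t} * indicator {0<..1} t"
      by (subst nn_integral_multc) auto
    finally show "(\<integral>\<^sup>+y. indicator (?T y) t \<partial>\<nu>) = emeasure \<nu> {y. norm y \<ge> c * f t} * indicator {0<..1} t" .
  qed
  also have "ennreal (1 + K) * \<dots> + emeasure \<nu> {y. c \<le> norm y} < \<infinity>"
    using assms emeasure_levy_finite[OF levy assms(1)] by (auto simp: ennreal_mult_less_top)
  finally show ?thesis .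
qed

end

section \<open>Small-time behaviour of the increments\<close>

lemma sinc_weight_le: "sinc_weight x \<le> 2 * min 1 (x\<^sup>2)"
proof -
  interpret U: prob_space unit_uniform by (rule prob_space_unit_uniform)
  have "sinc_weight x = (\<integral>v. 1 - cos (v * x) \<partial>unit_uniform)"
    using has_bochner_integral_sinc_weight by (simp add: has_bochner_integral_iff)
  also have "\<dots> \<le> (\<integral>v. 2 * min 1 (x\<^sup>2) \<partial>unit_uniform)"
  proof (rule integral_mono_AE)
    show "AE v in unit_uniform. 1 - cos (v * x) \<le> 2 * min 1 (x\<^sup>2)"
      using AE_unit_uniform
    proof eventually_elim
      case (elim v)
      have "1 - cos (v * x) \<le> 2 * min 1 ((v * x)\<^sup>2)" by (rule one_minus_cos_le)
      moreover have "(v * x)\<^sup>2 \<le> x\<^sup>2"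
        using elim by (simp add: power_mult_distrib mult_left_le_one_le power_le_one)
      ultimately show ?case by linarith
    qed
  qed (use has_bochner_integral_sinc_weight in \<open>auto simp: has_bochner_integral_iff\<close>)
  also have "\<dots> = 2 * min 1 (x\<^sup>2)" by (simp add: U.prob_space)
  finally show ?thesis .
qed

text \<open>Weighting by \<open>sinc_weight (g z)\<close> and normalising turns a possibly infinite
  measure into a law on the real line that does not charge 0. It is applied to a coordinate of X at
  small times and to a coordinate under \<nu>, making both accessible to the continuity
  theorem.\<close>

lemma weighted_law:
  fixes g :: "'a \<Rightarrow> real" and S :: "'a measure"
  assumes [measurable]: "g \<in> borel_measurable S"
    and int: "integrable S (\<lambda>z. sinc_weight (g z))"
    and m: "m = (\<integral>z. sinc_weight (g z) \<partial>S)" "0 < m"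
  defines "Q \<equiv> distr (density S (\<lambda>z. ennreal (sinc_weight (g z) / m))) borel g"
  shows "real_distribution Q"
    and "\<And>h :: real \<Rightarrow> 'b::{banach, second_countable_topology}. h \<in> borel_measurable borel \<Longrightarrow>
      (\<integral>x. h x \<partial>Q) = (\<integral>z. sinc_weight (g z) *\<^sub>R h (g z) \<partial>S) /\<^sub>R m"
proof -
  let ?D = "density S (\<lambda>z. ennreal (sinc_weight (g z) / m))"
  have "emeasure ?D (space ?D) = (\<integral>\<^sup>+z. ennreal (sinc_weight (g z) / m) \<partial>S)"
    by (simp add: emeasure_density cong: nn_integral_cong)
  also have "\<dots> = ennreal ((\<integral>z. sinc_weight (g z) \<partial>S) / m)"
    using int m(2) by (subst nn_integral_eq_integral) auto
  also have "\<dots> = 1" using m by simp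
  finally have "prob_space ?D" by (rule prob_spaceI)
  then have "prob_space Q" unfolding Q_def by (rule prob_space.prob_space_distr) simp
  then show "real_distribution Q"
    by (intro real_distribution.intro) (auto simp: Q_def real_distribution_axioms_def)
  fix h :: "real \<Rightarrow> 'b" assume [measurable]: "h \<in> borel_measurable borel"
  have "(\<integral>x. h x \<partial>Q) = (\<integral>z. h (g z) \<partial>?D)"
    unfolding Q_def by (rule integral_distr) simp_all
  also have "\<dots> = (\<integral>z. (sinc_weight (g z) / m) *\<^sub>R h (g z) \<partial>S)"
    using m(2) by (intro integral_density) auto
  also have "\<dots> = (\<integral>z. inverse m *\<^sub>R (sinc_weight (g z) *\<^sub>R h (g z)) \<partial>S)"
    by (simp add: divide_inverse mult.commute)
  also have "\<dots> = (\<integral>z. sinc_weight (g z) *\<^sub>R h (g z) \<partial>S) /\<^sub>R m"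
    by (rule integral_scaleR_right)
  finally show "(\<integral>x. h x \<partial>Q) = (\<integral>z. sinc_weight (g z) *\<^sub>R h (g z) \<partial>S) /\<^sub>R m" .
qed

lemma integrable_sinc_weight:
  assumes [measurable]: "g \<in> borel_measurable S" and int: "integrable S (\<lambda>z. min 1 ((g z)\<^sup>2))"
  shows "integrable S (\<lambda>z. sinc_weight (g z))"
proof (rule Bochner_Integration.integrable_bound)
  show "integrable S (\<lambda>z. 2 * min 1 ((g z)\<^sup>2))" using int by simp
  show "AE z in S. norm (sinc_weight (g z)) \<le> norm (2 * min 1 ((g z)\<^sup>2))"
    using sinc_weight_le by (auto simp: abs_mult)
qed simp

text \<open>Fubini applies because the integrand has modulus \<open>1 - cos (v * g z)\<close>, whose
  average over v is the integrable \<open>sinc_weight (g z)\<close>. The measurability in v is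
  needed for dominated convergence.\<close>

lemma integral_sinc_weight_iexp:
  fixes g :: "'a \<Rightarrow> real" and S :: "'a measure"
  assumes "sigma_finite_measure S"
    and [measurable]: "g \<in> borel_measurable S" and int: "integrable S (\<lambda>z. min 1 ((g z)\<^sup>2))"
  shows "(\<integral>z. sinc_weight (g z) *\<^sub>R iexp (u * g z) \<partial>S) =
      (\<integral>v. (\<integral>z. iexp (u * g z) * (1 - cos (v * g z)) \<partial>S) \<partial>unit_uniform)"
    and "(\<lambda>v. \<integral>z. iexp (u * g z) * (1 - cos (v * g z)) \<partial>S) \<in> borel_measurable borel"
proof -
  interpret sigma_finite_measure S by fact
  interpret U: prob_space unit_uniform by (rule prob_space_unit_uniform)
  interpret pair_sigma_finite S unit_uniform ..
  let ?F = "\<lambda>z v. iexp (u * g z) * complex_of_real (1 - cos (v * g z))"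
  have meas: "(\<lambda>(z, v). ?F z v) \<in> borel_measurable (S \<Otimes>\<^sub>M unit_uniform)"
    by measurable
  have norm_F: "norm (?F z v) = 1 - cos (v * g z)" for z v
    by (simp add: norm_mult del: of_real_diff)
  have "integrable (S \<Otimes>\<^sub>M unit_uniform) (\<lambda>(z, v). ?F z v)"
  proof (rule Fubini_integrable[OF meas])
    have "(\<lambda>z. \<integral>v. norm (case (z, v) of (z, v) \<Rightarrow> ?F z v) \<partial>unit_uniform) = (\<lambda>z. sinc_weight (g z))"
      using has_bochner_integral_sinc_weight by (simp only: prod.case norm_F has_bochner_integral_iff)
    then show "integrable S (\<lambda>z. \<integral>v. norm (case (z, v) of (z, v) \<Rightarrow> ?F z v) \<partial>unit_uniform)"
      using integrable_sinc_weight[OF assms(2,3)] by simp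
    have "integrable unit_uniform (\<lambda>v. ?F z v)" for z
      using has_bochner_integral_sinc_weight[of "g z"]
      by (intro integrable_mult_right integrable_of_real) (auto simp: has_bochner_integral_iff)
    then show "AE z in S. integrable unit_uniform (\<lambda>v. case (z, v) of (z, v) \<Rightarrow> ?F z v)"
      by simp
  qed
  then have "(\<integral>v. (\<integral>z. ?F z v \<partial>S) \<partial>unit_uniform) = (\<integral>z. (\<integral>v. ?F z v \<partial>unit_uniform) \<partial>S)"
    by (rule Fubini_integral)
  also have "\<dots> = (\<integral>z. sinc_weight (g z) *\<^sub>R iexp (u * g z) \<partial>S)"
  proof (rule Bochner_Integration.integral_cong)
    fix z
    have "(\<integral>v. ?F z v \<partial>unit_uniform) = iexp (u * g z) * complex_of_real (\<integral>v. 1 - cos (v * g z) \<partial>unit_uniform)"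
      by (simp only: integral_mult_right_zero integral_complex_of_real)
    then show "(\<integral>v. ?F z v \<partial>unit_uniform) = sinc_weight (g z) *\<^sub>R iexp (u * g z)"
      using has_bochner_integral_sinc_weight[of "g z"]
      by (simp only: has_bochner_integral_iff scaleR_conv_of_real mult.commute)
  qed simp
  finally show "(\<integral>z. sinc_weight (g z) *\<^sub>R iexp (u * g z) \<partial>S) = (\<integral>v. (\<integral>z. ?F z v \<partial>S) \<partial>unit_uniform)"
    by simp
  show "(\<lambda>v. \<integral>z. ?F z v \<partial>S) \<in> borel_measurable borel"
    by measurable
qed

section \<open>Convergence of (1/s) P(X_s in dy) to \<nu> away from the origin\<close>

context sector_levy_process
begin

text \<open>Counterpart of \<open>levy_exponent_second_difference\<close> for the law of
  \<open>X s\<close>. The constants 1 cancel; they are kept because (1 - exp(-s\<psi>))/s tends to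
  \<psi>.\<close>

lemma one_minus_char_second_difference:
  assumes "0 \<le> s"
  shows "(1 - exp (- complex_of_real s * \<psi> (\<xi> + \<eta>))) + (1 - exp (- complex_of_real s * \<psi> (\<xi> - \<eta>)))
      - 2 * (1 - exp (- complex_of_real s * \<psi> \<xi>)) =
    2 * (\<integral>\<omega>. iexp (\<xi> \<bullet> X s \<omega>) * (1 - cos (\<eta> \<bullet> X s \<omega>)) \<partial>M)"
proof -
  note [measurable] = random_variable_X[OF assms]
  have int: "integrable M (\<lambda>\<omega>. iexp (\<xi> \<bullet> X s \<omega>))" for \<xi>
    by (intro integrable_iexp) auto
  have eq: "2 * (iexp (\<xi> \<bullet> x) * (1 - cos (\<eta> \<bullet> x))) =
      2 * iexp (\<xi> \<bullet> x) - iexp ((\<xi> + \<eta>) \<bullet> x) - iexp ((\<xi> - \<eta>) \<bullet> x)" for x :: "real ^ 'd"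
    using iexp_second_difference[of "\<xi> \<bullet> x" "\<eta> \<bullet> x"]
    by (simp only: inner_add_left inner_diff_left of_real_diff of_real_1)
  have "2 * (\<integral>\<omega>. iexp (\<xi> \<bullet> X s \<omega>) * (1 - cos (\<eta> \<bullet> X s \<omega>)) \<partial>M) =
      (\<integral>\<omega>. 2 * iexp (\<xi> \<bullet> X s \<omega>) - iexp ((\<xi> + \<eta>) \<bullet> X s \<omega>) - iexp ((\<xi> - \<eta>) \<bullet> X s \<omega>) \<partial>M)"
    unfolding eq[symmetric] by (rule integral_mult_right_zero[symmetric])
  also have "\<dots> = 2 * (\<integral>\<omega>. iexp (\<xi> \<bullet> X s \<omega>) \<partial>M) - (\<integral>\<omega>. iexp ((\<xi> + \<eta>) \<bullet> X s \<omega>) \<partial>M)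
      - (\<integral>\<omega>. iexp ((\<xi> - \<eta>) \<bullet> X s \<omega>) \<partial>M)"
    using int by simp
  finally show ?thesis
    unfolding char_eq[OF assms] by simp
qed

lemma integrable_coordinate: "integrable \<nu> (\<lambda>y. min 1 ((y $ j)\<^sup>2))"
proof (rule Bochner_Integration.integrable_bound[OF integrable_truncated_square_one[OF levy]])
  have "(y $ j)\<^sup>2 \<le> (norm y)\<^sup>2" for y :: "real ^ 'd"
    using component_le_norm_cart[of y j] by (simp add: abs_le_square_iff[symmetric])
  then have "norm (min 1 ((y $ j)\<^sup>2)) \<le> norm (min 1 ((norm y)\<^sup>2))" for y :: "real ^ 'd"
    using zero_le_power2[of "y $ j"] by (smt (verit) real_norm_def)
  then show "AE y in \<nu>. norm (min 1 ((y $ j)\<^sup>2)) \<le> norm (min 1 ((norm y)\<^sup>2))"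
    by (rule AE_I2)
qed simp

text \<open>Second differences remove the drift and the compensator from \<open>\<psi>\<close>, and averaging \<open>1 - cos (v x)\<close> over
  \<open>v\<close> turns them into the Fourier transform of a finite measure.\<close>

lemma weighted_char_tendsto:
  fixes s :: "nat \<Rightarrow> real"
  assumes "s \<longlonglongrightarrow> 0" "\<And>n. 0 < s n"
  shows "(\<lambda>n. (\<integral>\<omega>. sinc_weight (X (s n) \<omega> $ j) *\<^sub>R iexp (u * X (s n) \<omega> $ j) \<partial>M) /\<^sub>R s n)
    \<longlonglongrightarrow> (\<integral>y. sinc_weight (y $ j) *\<^sub>R iexp (u * y $ j) \<partial>\<nu>)"
proof -
  interpret U: prob_space unit_uniform by (rule prob_space_unit_uniform)
  have [measurable]: "X (s n) \<in> borel_measurable M" for n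
    using assms(2)[of n] by (intro random_variable_X) simp
  have [measurable]: "(\<lambda>\<omega>. X (s n) \<omega> $ j) \<in> borel_measurable M" for n
    by measurable
  define e where "e = (axis j 1 :: real ^ 'd)"
  have e: "(u *\<^sub>R e) \<bullet> y = u * y $ j" for u and y :: "real ^ 'd"
    by (simp add: e_def inner_axis')
  let ?I = "\<lambda>n v. \<integral>\<omega>. iexp (u * X (s n) \<omega> $ j) * (1 - cos (v * X (s n) \<omega> $ j)) \<partial>M"
  let ?J = "\<lambda>v. \<integral>y. iexp (u * y $ j) * (1 - cos (v * y $ j)) \<partial>\<nu>"
  have int_X: "integrable M (\<lambda>\<omega>. min 1 ((X (s n) \<omega> $ j)\<^sup>2))" for n
    by (rule integrable_const_bound[of _ 1]) auto
  note M_fact = integral_sinc_weight_iexp[OF sigma_finite_measure_axioms _ int_X]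
  note \<nu>_fact = integral_sinc_weight_iexp[OF sigma_finite_levy_measure[OF levy] _ integrable_coordinate]
  \<comment> \<open>This quotient tends to \<psi> and is dominated by |\<psi>| uniformly in n, which
    makes the average over v converge.\<close>
  define G where "G n \<xi> = (1 - exp (- complex_of_real (s n) * \<psi> \<xi>)) / complex_of_real (s n)" for n \<xi>
  have G_lim: "(\<lambda>n. G n \<xi>) \<longlonglongrightarrow> \<psi> \<xi>" for \<xi>
    unfolding G_def using assms by (rule tendsto_one_minus_exp)
  have G_le: "cmod (G n \<xi>) \<le> cmod (\<psi> \<xi>)" for n \<xi>
  proof -
    have "cmod (1 - exp (- (complex_of_real (s n) * \<psi> \<xi>))) \<le> cmod (complex_of_real (s n) * \<psi> \<xi>)"
      using assms(2)[of n] Re_levy_exponent_nonneg[OF levy, of b \<xi>]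
      by (intro norm_one_minus_exp_le) simp
    then show ?thesis
      using assms(2)[of n] by (simp add: G_def norm_divide norm_mult field_simps)
  qed
  have I_eq: "?I n v /\<^sub>R s n = (G n ((u + v) *\<^sub>R e) + G n ((u - v) *\<^sub>R e) - 2 * G n (u *\<^sub>R e)) / 2" for n v
  proof -
    have "0 \<le> s n" "s n \<noteq> 0" using assms(2)[of n] by auto
    have "1 - exp (- complex_of_real (s n) * \<psi> \<xi>) = s n * G n \<xi>" for \<xi>
      using \<open>s n \<noteq> 0\<close> by (simp add: G_def)
    then have "s n * G n ((u + v) *\<^sub>R e) + s n * G n ((u - v) *\<^sub>R e) - 2 * (s n * G n (u *\<^sub>R e)) = 2 * ?I n v"
      using one_minus_char_second_difference[OF \<open>0 \<le> s n\<close>, of "u *\<^sub>R e" "v *\<^sub>R e"]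
      by (simp only: e scaleR_add_left scaleR_diff_left)
    then have "?I n v = s n * ((G n ((u + v) *\<^sub>R e) + G n ((u - v) *\<^sub>R e) - 2 * G n (u *\<^sub>R e)) / 2)"
      by (simp only: distrib_left right_diff_distrib mult.left_commute[of _ 2] times_divide_eq_right) simp
    moreover have "(complex_of_real (s n) * z) /\<^sub>R s n = z" for z
      using \<open>s n \<noteq> 0\<close> by (simp add: scaleR_conv_of_real)
    ultimately show ?thesis by simp
  qed
  have J_eq: "?J v = (\<psi> ((u + v) *\<^sub>R e) + \<psi> ((u - v) *\<^sub>R e) - 2 * \<psi> (u *\<^sub>R e)) / 2" for v
    using levy_exponent_second_difference[OF levy, of b "u *\<^sub>R e" "v *\<^sub>R e"]
    unfolding e scaleR_add_left scaleR_diff_left by simp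
  \<comment> \<open>For v in [0,1] the three frequencies u + v, u - v and u have modulus at most |u|
    + 1; the bound 2B is (B + B + 2B)/2.\<close>
  define B where "B = 2 * (1 + C) * levy_tail \<nu> (1 / (\<bar>u\<bar> + 1))"
  have B: "cmod (\<psi> (w *\<^sub>R e)) \<le> B" if "\<bar>w\<bar> \<le> \<bar>u\<bar> + 1" for w
    unfolding B_def using that by (intro norm_exponent_le) (auto simp: e_def norm_axis_1)
  have "(\<lambda>n. \<integral>v. ?I n v /\<^sub>R s n \<partial>unit_uniform) \<longlonglongrightarrow> (\<integral>v. ?J v \<partial>unit_uniform)"
  proof (rule integral_dominated_convergence)
    show "?J \<in> borel_measurable unit_uniform"
      unfolding measurable_cong_sets[OF sets_unit_uniform refl] by (rule \<nu>_fact(2)) simp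
    have "?I n \<in> borel_measurable borel" for n
      by (rule M_fact(2)) simp
    then show "(\<lambda>v. ?I n v /\<^sub>R s n) \<in> borel_measurable unit_uniform" for n
      unfolding measurable_cong_sets[OF sets_unit_uniform refl] by (intro borel_measurable_scaleR) auto
    show "integrable unit_uniform (\<lambda>v. 2 * B)" by simp
    show "AE v in unit_uniform. (\<lambda>n. ?I n v /\<^sub>R s n) \<longlonglongrightarrow> ?J v"
      unfolding I_eq J_eq by (intro AE_I2 tendsto_intros G_lim) simp
    show "AE v in unit_uniform. norm (?I n v /\<^sub>R s n) \<le> 2 * B" for n
      using AE_unit_uniform
    proof eventually_elim
      case (elim v)
      let ?a = "G n ((u + v) *\<^sub>R e)" and ?b = "G n ((u - v) *\<^sub>R e)" and ?c = "G n (u *\<^sub>R e)"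
      have "cmod ?a \<le> B" "cmod ?b \<le> B" "cmod ?c \<le> B"
        using elim by (auto intro!: order_trans[OF G_le B])
      moreover have "cmod (?a + ?b - 2 * ?c) \<le> cmod ?a + cmod ?b + 2 * cmod ?c"
        by (rule order_trans[OF norm_triangle_ineq4]) (simp add: norm_mult norm_triangle_ineq)
      ultimately show ?case unfolding I_eq by (simp add: norm_divide)
    qed
  qed
  moreover have "(\<integral>\<omega>. sinc_weight (X (s n) \<omega> $ j) *\<^sub>R iexp (u * X (s n) \<omega> $ j) \<partial>M) =
      (\<integral>v. ?I n v \<partial>unit_uniform)" for n
    by (rule M_fact(1)) simp
  moreover have "(\<integral>y. sinc_weight (y $ j) *\<^sub>R iexp (u * y $ j) \<partial>\<nu>) = (\<integral>v. ?J v \<partial>unit_uniform)"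
    by (rule \<nu>_fact(1)) simp
  ultimately show ?thesis
    by (simp only: integral_scaleR_right)
qed

text \<open>The frequency u = 0 of the preceding convergence; it supplies the normalising
  masses.\<close>

lemma sinc_weight_mass_tendsto:
  fixes s :: "nat \<Rightarrow> real"
  assumes "s \<longlonglongrightarrow> 0" "\<And>n. 0 < s n"
  shows "(\<lambda>n. expectation (\<lambda>\<omega>. sinc_weight (X (s n) \<omega> $ j)) / s n) \<longlonglongrightarrow> (\<integral>y. sinc_weight (y $ j) \<partial>\<nu>)"
proof -
  have "(\<lambda>n. complex_of_real (expectation (\<lambda>\<omega>. sinc_weight (X (s n) \<omega> $ j)) / s n))
      \<longlonglongrightarrow> complex_of_real (\<integral>y. sinc_weight (y $ j) \<partial>\<nu>)"
    using weighted_char_tendsto[OF assms, of j 0]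
    by (simp add: scaleR_conv_of_real divide_inverse mult.commute)
  then show ?thesis by (simp only: tendsto_of_real_iff)
qed

text \<open>Since h vanishes near 0, its quotient by \<open>sinc_weight\<close> is bounded and
  continuous, hence a test function for the weak convergence of the weighted laws. Multiplying by
  the masses \<open>p n / s n\<close>, which tend to \<open>m\<close>, undoes the weighting.\<close>

lemma small_time_limit_vanishing_near_0:
  fixes s :: "nat \<Rightarrow> real" and h :: "real \<Rightarrow> real"
  assumes s: "s \<longlonglongrightarrow> 0" "\<And>n. 0 < s n"
    and h: "\<And>x. isCont h x" "\<And>x. \<bar>h x\<bar> \<le> 1" "\<And>x. \<bar>x\<bar> \<le> a \<Longrightarrow> h x = 0" and "0 < a"
  shows "(\<lambda>n. expectation (\<lambda>\<omega>. h (X (s n) \<omega> $ j)) / s n) \<longlonglongrightarrow> (\<integral>y. h (y $ j) \<partial>\<nu>)"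
proof -
  have [measurable]: "h \<in> borel_measurable borel"
    using h(1) by (intro borel_measurable_continuous_onI continuous_at_imp_continuous_on) auto
  have [measurable]: "X (s n) \<in> borel_measurable M" for n
    using s(2)[of n] by (intro random_variable_X) simp
  have X_j [measurable]: "(\<lambda>\<omega>. X (s n) \<omega> $ j) \<in> borel_measurable M" for n
    by measurable
  \<comment> \<open>Where |x| > a, \<open>sinc_weight_ge\<close> gives 8
    \<open>sinc_weight x\<close> >= min(1, a^2), so \<open>k * sinc_weight\<close> dominates
    h.\<close>
  define k where "k = 8 / min 1 (a\<^sup>2)"
  have k: "0 < k" using \<open>0 < a\<close> by (simp add: k_def)
  have h_le: "\<bar>h x\<bar> \<le> k * sinc_weight x" for x
  proof (cases "\<bar>x\<bar> \<le> a")
    case False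
    then have "a\<^sup>2 \<le> x\<^sup>2" using \<open>0 < a\<close> by (simp add: abs_le_square_iff[symmetric])
    then have "min 1 (a\<^sup>2) \<le> 8 * sinc_weight x" using sinc_weight_ge[of x] by linarith
    then have "1 \<le> k * sinc_weight x" using \<open>0 < a\<close> by (simp add: k_def field_simps)
    then show ?thesis using h(2)[of x] by linarith
  qed (use h(3) k in simp)
  have int_X: "integrable M (\<lambda>\<omega>. sinc_weight (X (s n) \<omega> $ j))" for n
    by (intro integrable_sinc_weight integrable_const_bound[of _ 1]) auto
  have int_\<nu>: "integrable \<nu> (\<lambda>y. sinc_weight (y $ j))"
    using integrable_coordinate by (intro integrable_sinc_weight) auto
  define m where "m = (\<integral>y. sinc_weight (y $ j) \<partial>\<nu>)"
  define p where "p n = expectation (\<lambda>\<omega>. sinc_weight (X (s n) \<omega> $ j))" for n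
  have p_lim: "(\<lambda>n. p n / s n) \<longlonglongrightarrow> m"
    unfolding p_def m_def by (rule sinc_weight_mass_tendsto[OF s])
  have "0 \<le> m" unfolding m_def by (rule integral_nonneg_AE) simp
  show ?thesis
  proof (cases "m = 0")
    \<comment> \<open>For \<open>m = 0\<close> there is no limit law to normalise. Both sides
      vanish, the left because it is dominated by k times the masses.\<close>
    case True
    then have "AE y in \<nu>. sinc_weight (y $ j) = 0"
      using integral_nonneg_eq_0_iff_AE[OF int_\<nu>] by (simp add: m_def)
    then have "AE y in \<nu>. h (y $ j) = 0"
      by eventually_elim (use h_le in \<open>metis abs_le_zero_iff mult_zero_right\<close>)
    then have "(\<integral>y. h (y $ j) \<partial>\<nu>) = 0"
      by (rule integral_eq_zero_AE)
    moreover have "(\<lambda>n. expectation (\<lambda>\<omega>. h (X (s n) \<omega> $ j)) / s n) \<longlonglongrightarrow> 0"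
    proof (rule Lim_null_comparison)
      show "(\<lambda>n. k * (p n / s n)) \<longlonglongrightarrow> 0"
        using tendsto_mult_right_zero[OF p_lim[unfolded True]] by simp
      have "\<bar>expectation (\<lambda>\<omega>. h (X (s n) \<omega> $ j))\<bar> \<le> k * p n" for n
      proof -
        have "\<bar>expectation (\<lambda>\<omega>. h (X (s n) \<omega> $ j))\<bar> \<le> expectation (\<lambda>\<omega>. k * sinc_weight (X (s n) \<omega> $ j))"
        proof (rule order_trans[OF integral_abs_bound], rule integral_mono)
          show "integrable M (\<lambda>\<omega>. \<bar>h (X (s n) \<omega> $ j)\<bar>)"
            using h(2) by (intro integrable_const_bound[of _ 1]) auto
        qed (use int_X h_le in auto)
        then show ?thesis by (simp add: p_def)
      qed
      then have "norm (expectation (\<lambda>\<omega>. h (X (s n) \<omega> $ j)) / s n) \<le> k * (p n / s n)" for n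
        using s(2)[of n] by (simp add: divide_right_mono)
      then show "\<forall>\<^sub>F n in sequentially. norm (expectation (\<lambda>\<omega>. h (X (s n) \<omega> $ j)) / s n) \<le> k * (p n / s n)"
        by (intro always_eventually allI)
    qed
    ultimately show ?thesis by simp
  next
    case False
    then have "0 < m" using \<open>0 \<le> m\<close> by simp
    then have "\<forall>\<^sub>F n in sequentially. 0 < p n / s n"
      using order_tendstoD(1)[OF p_lim] by blast
    \<comment> \<open>The weighted laws exist only where \<open>p n\<close> is positive; the shift
      by \<open>n0\<close> is undone at the end by \<open>LIMSEQ_offset\<close>.\<close>
    then obtain n0 where n0: "\<And>n. n0 \<le> n \<Longrightarrow> 0 < p n / s n"
      unfolding eventually_sequentially by blast
    then have p_pos: "0 < p (n + n0)" for n
      using s(2)[of "n + n0"] n0[of "n + n0"] by (simp add: zero_less_divide_iff)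
    define Q where "Q n = distr (density M (\<lambda>\<omega>. ennreal (sinc_weight (X (s (n + n0)) \<omega> $ j) / p (n + n0))))
      borel (\<lambda>\<omega>. X (s (n + n0)) \<omega> $ j)" for n
    define Q' where "Q' = distr (density \<nu> (\<lambda>y. ennreal (sinc_weight (y $ j) / m))) borel (\<lambda>y. y $ j)"
    note Q_law = weighted_law[OF X_j int_X p_def p_pos, folded Q_def]
    note Q'_law = weighted_law[OF _ int_\<nu> m_def \<open>0 < m\<close>, folded Q'_def, simplified]
    have "weak_conv_m Q Q'"
    proof (rule levy_continuity)
      show "real_distribution (Q n)" for n by (rule Q_law(1))
      show "real_distribution Q'" by (rule Q'_law(1))
      fix u
      let ?Z = "\<lambda>n. (\<integral>\<omega>. sinc_weight (X (s n) \<omega> $ j) *\<^sub>R iexp (u * X (s n) \<omega> $ j) \<partial>M)"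
      have "(\<lambda>n. (?Z n /\<^sub>R s n) /\<^sub>R (p n / s n)) \<longlonglongrightarrow>
          (\<integral>y. sinc_weight (y $ j) *\<^sub>R iexp (u * y $ j) \<partial>\<nu>) /\<^sub>R m"
        using weighted_char_tendsto[OF s] p_lim False by (intro tendsto_intros) auto
      then have "(\<lambda>n. (?Z (n + n0) /\<^sub>R s (n + n0)) /\<^sub>R (p (n + n0) / s (n + n0))) \<longlonglongrightarrow>
          (\<integral>y. sinc_weight (y $ j) *\<^sub>R iexp (u * y $ j) \<partial>\<nu>) /\<^sub>R m"
        by (rule LIMSEQ_ignore_initial_segment)
      moreover have "(?Z (n + n0) /\<^sub>R s (n + n0)) /\<^sub>R (p (n + n0) / s (n + n0)) = char (Q n) u" for n
        using s(2)[of "n + n0"] unfolding char_def by (subst Q_law(2)) (auto simp: field_simps)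
      moreover have "char Q' u = (\<integral>y. sinc_weight (y $ j) *\<^sub>R iexp (u * y $ j) \<partial>\<nu>) /\<^sub>R m"
        unfolding char_def by (subst Q'_law(2)) auto
      ultimately show "(\<lambda>n. char (Q n) u) \<longlonglongrightarrow> char Q' u" by simp
    qed
    define g where "g x = h x / sinc_weight x" for x \<comment> \<open>\<open>g 0 = 0\<close>, since division by 0 gives 0\<close>
    have g_h: "sinc_weight x * g x = h x" for x
      using sinc_weight_pos[of x] h(3)[of x] \<open>0 < a\<close> by (cases "x = 0") (auto simp: g_def)
    have g_cont: "isCont g x" for x
    proof (cases "x = 0")
      case True
      have "\<forall>\<^sub>F x in nhds 0. g x = 0"
      proof (rule eventually_nhds_in_open[of "{-a<..<a}", THEN eventually_mono])
        show "g x = 0" if "x \<in> {-a<..<a}" for x using that h(3)[of x] by (auto simp: g_def abs_le_iff)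
      qed (use \<open>0 < a\<close> in auto)
      then have "isCont g 0 \<longleftrightarrow> isCont (\<lambda>_. 0 :: real) (0 :: real)" by (rule isCont_cong)
      then show ?thesis using True by simp
    next
      case False
      then show ?thesis
        unfolding g_def using h(1) isCont_sinc_weight sinc_weight_pos[of x]
        by (intro continuous_intros) auto
    qed
    then have [measurable]: "g \<in> borel_measurable borel"
      by (intro borel_measurable_continuous_onI continuous_at_imp_continuous_on) auto
    have g_le: "norm (g x) \<le> k" for x
      using h_le[of x] sinc_weight_pos[of x] h(3)[of 0] k \<open>0 < a\<close>
      by (cases "x = 0") (simp_all add: g_def divide_le_eq)
    have "(\<lambda>n. integral\<^sup>L (Q n) g) \<longlonglongrightarrow> integral\<^sup>L Q' g"
      using Q_law(1) Q'_law(1) \<open>weak_conv_m Q Q'\<close> g_cont g_le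
      by (rule weak_conv_imp_integral_bdd_continuous_conv)
    moreover have "integral\<^sup>L (Q n) g = expectation (\<lambda>\<omega>. h (X (s (n + n0)) \<omega> $ j)) / p (n + n0)" for n
      by (subst Q_law(2)) (simp_all add: g_h divide_inverse mult.commute)
    moreover have "integral\<^sup>L Q' g = (\<integral>y. h (y $ j) \<partial>\<nu>) / m"
      by (subst Q'_law(2)) (simp_all add: g_h divide_inverse mult.commute)
    ultimately have "(\<lambda>n. expectation (\<lambda>\<omega>. h (X (s (n + n0)) \<omega> $ j)) / p (n + n0)) \<longlonglongrightarrow> (\<integral>y. h (y $ j) \<partial>\<nu>) / m"
      by simp
    from tendsto_mult[OF this LIMSEQ_ignore_initial_segment[OF p_lim, of n0]]
    have "(\<lambda>n. expectation (\<lambda>\<omega>. h (X (s (n + n0)) \<omega> $ j)) / s (n + n0)) \<longlonglongrightarrow> (\<integral>y. h (y $ j) \<partial>\<nu>)"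
      using p_pos \<open>0 < m\<close> by (simp add: less_imp_neq[symmetric])
    then show ?thesis by (rule LIMSEQ_offset)
  qed
qed

text \<open>A vector of norm at least 2da has a coordinate of size at least 2a, and the gap between
  a and 2a leaves room for a continuous cutoff. In the denominator, d pays for selecting one
  coordinate, and 2 makes the resulting inequality strict, as the passage to the limit
  requires.\<close>

definition jump_rate :: "real \<Rightarrow> real" where
  "jump_rate a = measure \<nu> {y. 2 * real CARD('d) * a \<le> norm y} / (2 * real CARD('d))"

lemma eventually_jump_rate_le_prob:
  assumes "0 < a"
  shows "\<forall>\<^sub>F s in at_right 0. s * jump_rate a \<le> prob {\<omega> \<in> space M. a < norm (X s \<omega>)}"
proof (cases "jump_rate a = 0")
  case False
  let ?d = "real CARD('d)"
  have d: "0 < ?d" by simp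
  have sets: "{y. 2 * a \<le> \<bar>y $ j\<bar>} \<in> sets \<nu>" for j by simp
  have "{y. 2 * ?d * a \<le> norm y} \<subseteq> (\<Union>j\<in>UNIV. {y :: real ^ 'd. 2 * a \<le> \<bar>y $ j\<bar>})"
  proof (rule subsetI, rule ccontr)
    fix y :: "real ^ 'd"
    assume y: "y \<in> {y. 2 * ?d * a \<le> norm y}" "y \<notin> (\<Union>j\<in>UNIV. {y. 2 * a \<le> \<bar>y $ j\<bar>})"
    have "norm y \<le> (\<Sum>j\<in>UNIV. \<bar>y $ j\<bar>)" by (rule norm_le_l1_cart)
    also have "\<dots> < (\<Sum>j\<in>(UNIV :: 'd set). 2 * a)"
      using y(2) by (intro sum_strict_mono) (auto simp: not_le)
    finally show False using y(1) by (simp add: mult_ac)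
  qed
  have fin_j: "{y. 2 * a \<le> \<bar>y $ j\<bar>} \<in> fmeasurable \<nu>" for j
  proof (rule fmeasurableI[OF sets])
    have "emeasure \<nu> {y. 2 * a \<le> \<bar>y $ j\<bar>} \<le> emeasure \<nu> {y. 2 * a \<le> norm y}"
      using component_le_norm_cart order_trans by (intro emeasure_mono) (auto, blast)
    then show "emeasure \<nu> {y. 2 * a \<le> \<bar>y $ j\<bar>} < \<infinity>"
      using emeasure_levy_finite[OF levy, of "2 * a"] assms by (auto intro: le_less_trans)
  qed
  have "measure \<nu> {y. 2 * ?d * a \<le> norm y} \<le> measure \<nu> (\<Union>j\<in>UNIV. {y. 2 * a \<le> \<bar>y $ j\<bar>})"
    using \<open>_ \<subseteq> _\<close> fin_j by (intro measure_mono_fmeasurable fmeasurable.finite_UN) auto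
  also have "\<dots> \<le> (\<Sum>j\<in>UNIV. measure \<nu> {y. 2 * a \<le> \<bar>y $ j\<bar>})"
    by (rule measure_UNION_le) auto
  finally have sum: "2 * ?d * jump_rate a \<le> (\<Sum>j\<in>UNIV. measure \<nu> {y. 2 * a \<le> \<bar>y $ j\<bar>})"
    by (simp add: jump_rate_def)
  have pos: "0 < jump_rate a" using False by (simp add: jump_rate_def less_le)
  have "\<exists>j. jump_rate a < measure \<nu> {y. 2 * a \<le> \<bar>y $ j\<bar>}"
  proof (rule ccontr)
    assume "\<not> ?thesis"
    then have "(\<Sum>j\<in>UNIV. measure \<nu> {y. 2 * a \<le> \<bar>y $ j\<bar>}) \<le> (\<Sum>j\<in>(UNIV :: 'd set). jump_rate a)"
      by (intro sum_mono) (auto simp: not_less)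
    from order_trans[OF sum this] have "2 * ?d * jump_rate a \<le> ?d * jump_rate a"
      by (simp only: sum_constant)
    then show False using mult_pos_pos[OF d pos] by (simp only: mult.assoc)
  qed
  then obtain j where j: "jump_rate a < measure \<nu> {y. 2 * a \<le> \<bar>y $ j\<bar>}" ..
  \<comment> \<open>The cutoff rises from 0 at |x| = a to 1 at |x| = 2a, so it lies between the
    indicators of |x| >= 2a and |x| > a.\<close>
  define h where "h x = min 1 (max 0 (\<bar>x\<bar> / a - 1))" for x :: real
  have h_cont: "isCont h x" for x
    unfolding h_def using assms by (intro continuous_intros) auto
  have h_bounds: "\<bar>h x\<bar> \<le> 1" "0 \<le> h x" for x by (auto simp: h_def)
  have h_0: "h x = 0" if "\<bar>x\<bar> \<le> a" for x using that assms by (simp add: h_def)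
  have h_1: "h x = 1" if "2 * a \<le> \<bar>x\<bar>" for x using that assms by (simp add: h_def field_simps)
  have [measurable]: "h \<in> borel_measurable borel"
    unfolding h_def by measurable
  have lim: "((\<lambda>s. expectation (\<lambda>\<omega>. h (X s \<omega> $ j)) / s) \<longlongrightarrow> (\<integral>y. h (y $ j) \<partial>\<nu>)) (at_right 0)"
    by (rule tendsto_at_right_sequentially[of 0 1])
       (auto intro!: small_time_limit_vanishing_near_0[OF _ _ h_cont h_bounds(1) h_0 assms])
  have int: "integrable \<nu> (\<lambda>y. h (y $ j))"
  proof (rule Bochner_Integration.integrable_bound)
    show "integrable \<nu> (\<lambda>y. 1 / min 1 (a\<^sup>2) * min 1 ((y $ j)\<^sup>2))"
      using integrable_coordinate by (rule integrable_mult_right)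
    have "\<bar>h x\<bar> \<le> 1 / min 1 (a\<^sup>2) * min 1 (x\<^sup>2)" for x
    proof (cases "\<bar>x\<bar> \<le> a")
      case False
      then have "a\<^sup>2 \<le> x\<^sup>2" using assms by (simp add: abs_le_square_iff[symmetric])
      then have "1 \<le> 1 / min 1 (a\<^sup>2) * min 1 (x\<^sup>2)" using assms by (auto simp: field_simps min_def)
      then show ?thesis using h_bounds(1)[of x] by linarith
    qed (use h_0 assms in simp)
    then show "AE y in \<nu>. norm (h (y $ j)) \<le> norm (1 / min 1 (a\<^sup>2) * min 1 ((y $ j)\<^sup>2))"
      by (intro AE_I2) (simp add: order_trans[OF _ abs_ge_self])
  qed simp
  have "measure \<nu> {y. 2 * a \<le> \<bar>y $ j\<bar>} = (\<integral>y. indicator {y. 2 * a \<le> \<bar>y $ j\<bar>} y \<partial>\<nu>)"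
    by simp
  also have "\<dots> \<le> (\<integral>y. h (y $ j) \<partial>\<nu>)"
  proof (rule integral_mono)
    show "integrable \<nu> (indicator {y. 2 * a \<le> \<bar>y $ j\<bar>} :: _ \<Rightarrow> real)"
      using fin_j[of j] by (intro integrable_real_indicator) (auto simp: fmeasurable_def)
  qed (use int h_1 h_bounds(2) in \<open>auto simp: indicator_def\<close>)
  finally have "jump_rate a < (\<integral>y. h (y $ j) \<partial>\<nu>)" using j by simp
  from order_tendstoD(1)[OF lim this]
  have "\<forall>\<^sub>F s in at_right 0. jump_rate a < expectation (\<lambda>\<omega>. h (X s \<omega> $ j)) / s" .
  then show ?thesis
    using eventually_at_right_less[of 0]
  proof eventually_elim
    case (elim s)
    note [measurable] = random_variable_X[OF less_imp_le[OF elim(2)]]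
    have "s * jump_rate a \<le> expectation (\<lambda>\<omega>. h (X s \<omega> $ j))"
      using elim by (simp add: field_simps)
    also have "\<dots> \<le> expectation (\<lambda>\<omega>. indicator {\<omega> \<in> space M. a < norm (X s \<omega>)} \<omega>)"
    proof (rule integral_mono)
      show "integrable M (\<lambda>\<omega>. h (X s \<omega> $ j))"
        using h_bounds(1) by (intro integrable_const_bound[of _ 1]) auto
      show "h (X s \<omega> $ j) \<le> indicator {\<omega> \<in> space M. a < norm (X s \<omega>)} \<omega>" if "\<omega> \<in> space M" for \<omega>
        using that h_0[of "X s \<omega> $ j"] h_bounds(1)[of "X s \<omega> $ j"] component_le_norm_cart[of "X s \<omega>" j]
        by (auto simp: indicator_def abs_le_iff)
    qed (auto intro!: integrable_real_indicator simp: emeasure_eq_measure)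
    also have "\<dots> = prob {\<omega> \<in> space M. a < norm (X s \<omega>)}"
      by simp
    finally show ?case .
  qed
qed simp

end

context sector_levy_process
begin

lemma jump_rate_nonneg [simp]: "0 \<le> jump_rate a"
  by (simp add: jump_rate_def)

lemma jump_rate_measurable [measurable]: "jump_rate \<in> borel_measurable borel"
  unfolding jump_rate_def measure_def by measurable

lemma emeasure_eq_jump_rate:
  assumes "0 < a"
  shows "emeasure \<nu> {y. 2 * real CARD('d) * a \<le> norm y} = ennreal (2 * real CARD('d)) * ennreal (jump_rate a)"
proof -
  have "emeasure \<nu> {y. 2 * real CARD('d) * a \<le> norm y} < \<infinity>"
    using assms by (intro emeasure_levy_finite[OF levy]) simp
  then have "emeasure \<nu> {y. 2 * real CARD('d) * a \<le> norm y} =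
      ennreal (measure \<nu> {y. 2 * real CARD('d) * a \<le> norm y})"
    by (intro emeasure_eq_ennreal_measure) auto
  then show ?thesis
    by (simp add: jump_rate_def flip: ennreal_mult)
qed

lemma jump_rate_antimono:
  assumes "0 < a" "a \<le> a'" shows "jump_rate a' \<le> jump_rate a"
proof -
  have "measure \<nu> {y. 2 * real CARD('d) * a' \<le> norm y} \<le> measure \<nu> {y. 2 * real CARD('d) * a \<le> norm y}"
  proof (rule measure_mono_fmeasurable)
    show "{y :: real ^ 'd. 2 * real CARD('d) * a' \<le> norm y} \<subseteq> {y. 2 * real CARD('d) * a \<le> norm y}"
      using assms(2) by (auto intro: order_trans[rotated])
    show "{y. 2 * real CARD('d) * a \<le> norm y} \<in> fmeasurable \<nu>"
      using emeasure_levy_finite[OF levy, of "2 * real CARD('d) * a"] assms by (intro fmeasurableI) auto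
  qed simp
  then show ?thesis by (simp add: jump_rate_def divide_right_mono)
qed

end

section \<open>The upper limit when (L1) fails\<close>

context sector_levy_bound
begin

text \<open>The event on the left involves uncountably many times; \<open>G\<close> is its restriction to the grid of mesh
  \<open>2\<^sup>-\<^sup>N\<close> for a sufficiently large \<open>N\<close>.\<close>

lemma small_path_event_le_exp:
  assumes "0 < c" "m \<le> n"
  shows "\<exists>G\<in>events. {\<omega> \<in> space M. \<forall>t. 0 < t \<and> t \<le> (1/2) ^ m \<longrightarrow> norm (X t \<omega>) \<le> c * f t} \<subseteq> G \<and>
    prob G \<le> exp (- (\<Sum>k=m..<n. (1/2) ^ Suc k * jump_rate (2 * c * f ((1/2) ^ k))))"
proof -
  let ?a = "\<lambda>k. 2 * c * f ((1/2) ^ k)"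
  have "\<forall>\<^sub>F s in at_right 0. \<forall>k\<in>{m..<n}. s * jump_rate (?a k) \<le> prob {\<omega> \<in> space M. ?a k < norm (X s \<omega>)}"
    using assms f_pos by (intro eventually_ball_finite ballI eventually_jump_rate_le_prob) auto
  \<comment> \<open>The admissible range of s depends on the level \<open>?a k\<close>. Only
    finitely many k occur, so one d, and then one mesh below d, serves them all.\<close>
  then obtain d where d: "0 < d" "\<And>s k. 0 < s \<Longrightarrow> s < d \<Longrightarrow> k \<in> {m..<n} \<Longrightarrow>
      s * jump_rate (?a k) \<le> prob {\<omega> \<in> space M. ?a k < norm (X s \<omega>)}"
    unfolding eventually_at_right_field by blast
  obtain N0 where N0: "(1/2 :: real) ^ N0 < d" using real_arch_pow_inv[OF d(1), of "1/2"] by auto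
  define N where "N = max N0 n"
  define h where "h = (1/2 :: real) ^ N"
  have "h \<le> (1/2) ^ N0" unfolding h_def N_def by (intro power_decreasing) auto
  then have "h < d" using N0 by (rule le_less_trans)
  moreover have "0 < h" by (simp add: h_def)
  ultimately have h: "0 < h" "h < d" by simp_all
  have "n \<le> N" by (simp add: N_def)
  have scale: "real (2 ^ (N - k)) * h = (1/2) ^ k" if "k \<le> N" for k
  proof -
    have "(2 :: real) ^ N = 2 ^ (N - k) * 2 ^ k" using that by (simp flip: power_add)
    then show ?thesis by (simp add: h_def power_divide field_simps)
  qed
  \<comment> \<open>On a path below c f, the increment ending at (i + 1)h has norm at most c f(ih) +
    c f((i + 1)h), hence at most 2c f((i + 1)h).\<close>
  define thr where "thr i = 2 * c * f (real (Suc i) * h)" for i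
  define p where "p i = prob {\<omega> \<in> space M. thr i < norm (increment h i \<omega>)}" for i
  have p_ge: "h * jump_rate (?a k) \<le> p i" if k: "k \<in> {m..<n}" and i: "i < 2 ^ (N - k)" for i k
  proof -
    have "real (Suc i) \<le> real (2 ^ (N - k))" using i by (simp only: of_nat_le_iff Suc_le_eq)
    then have "real (Suc i) * h \<le> (1/2) ^ k"
      using scale[of k] k \<open>n \<le> N\<close> h(1) mult_right_mono[of "real (Suc i)" "real (2 ^ (N - k))" h] by auto
    then have thr: "thr i \<le> ?a k"
      unfolding thr_def using assms by (intro mult_left_mono f_le) auto
    note [measurable] = random_variable_X[OF less_imp_le[OF h(1)]]
    have "h * jump_rate (?a k) \<le> prob {\<omega> \<in> space M. ?a k < norm (X h \<omega>)}"
      using d(2)[OF h k] .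
    also have "\<dots> \<le> prob {\<omega> \<in> space M. thr i < norm (X h \<omega>)}"
      using thr by (intro finite_measure_mono) auto
    also have "\<dots> = p i"
      using prob_increment_grid[OF h(1), of "{y. thr i < norm y}" i] by (simp add: p_def)
    finally show ?thesis .
  qed
  \<comment> \<open>The grid steps with 2^(N-k-1) <= i < 2^(N-k) fill dyadic block k; their total
    length (1/2)^(k+1) is the weight of \<open>jump_rate (?a k)\<close>.\<close>
  have sum_p: "(\<Sum>k=m..<n'. (1/2) ^ Suc k * jump_rate (?a k)) \<le> (\<Sum>i\<in>{2 ^ (N - n')..<2 ^ (N - m)}. p i)"
    if "m \<le> n'" "n' \<le> n" for n'
    using that
  proof (induction n' rule: dec_induct)
    case (step k)
    then have k: "m \<le> k" "Suc k \<le> n" "Suc k \<le> N" using \<open>n \<le> N\<close> by auto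
    have eq: "(2::nat) ^ (N - k) = 2 * 2 ^ (N - Suc k)"
      using k by (metis Suc_diff_le diff_Suc_Suc power_Suc)
    have "(1/2) ^ Suc k * jump_rate (?a k) = (\<Sum>i\<in>{2 ^ (N - Suc k)..<2 ^ (N - k) :: nat}. h * jump_rate (?a k))"
      using scale[OF k(3)] by (simp add: eq)
    also have "\<dots> \<le> (\<Sum>i\<in>{2 ^ (N - Suc k)..<2 ^ (N - k)}. p i)"
      using k by (intro sum_mono p_ge) auto
    finally have "(\<Sum>k=m..<Suc k. (1/2) ^ Suc k * jump_rate (?a k)) \<le>
        (\<Sum>i\<in>{2 ^ (N - Suc k)..<2 ^ (N - k)}. p i) + (\<Sum>i\<in>{2 ^ (N - k)..<2 ^ (N - m)}. p i)"
      using step.IH k by simp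
    also have "\<dots> = (\<Sum>i\<in>{2 ^ (N - Suc k)..<2 ^ (N - m)}. p i)"
      using k by (intro sum.atLeastLessThan_concat power_increasing) auto
    finally show ?case .
  qed simp
  define J where "J = {2 ^ (N - n)..<2 ^ (N - m) :: nat}"
  define G where "G = {\<omega> \<in> space M. \<forall>i\<in>J. norm (increment h i \<omega>) \<le> thr i}"
  have [measurable]: "increment h i \<in> borel_measurable M" for i
    unfolding increment_def[abs_def] using h(1)
    by (intro borel_measurable_diff random_variable_X) auto
  show ?thesis
  proof (intro bexI conjI)
    show "G \<in> events" unfolding G_def J_def by measurable
    have "prob G \<le> exp (- (\<Sum>i\<in>J. p i))"
      unfolding G_def by (rule prob_all_small_le_exp[OF indep_increment[OF h(1), of "2 ^ (N - m)"]])
        (auto simp: J_def p_def)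
    also have "\<dots> \<le> exp (- (\<Sum>k=m..<n. (1/2) ^ Suc k * jump_rate (?a k)))"
      using sum_p[of n] assms(2) by (simp add: J_def)
    finally show "prob G \<le> exp (- (\<Sum>k=m..<n. (1/2) ^ Suc k * jump_rate (?a k)))" .
    show "{\<omega> \<in> space M. \<forall>t. 0 < t \<and> t \<le> (1/2) ^ m \<longrightarrow> norm (X t \<omega>) \<le> c * f t} \<subseteq> G"
    proof (safe, unfold G_def, safe)
      fix \<omega> i
      assume path: "\<forall>t. 0 < t \<and> t \<le> (1/2) ^ m \<longrightarrow> norm (X t \<omega>) \<le> c * f t" and i: "i \<in> J"
      \<comment> \<open>\<open>J\<close> starts at 2^(N-n) >= 1, so no increment begins at time 0,
        where the path condition is silent.\<close>
      have "0 < i" using i by (auto simp: J_def intro: less_le_trans[of 0 "2 ^ (N - n)"])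
      have "real (Suc i) \<le> real (2 ^ (N - m))"
        using i unfolding J_def by (simp only: of_nat_le_iff Suc_le_eq atLeastLessThan_iff)
      then have le: "real (Suc i) * h \<le> (1/2) ^ m"
        using scale[of m] assms(2) \<open>n \<le> N\<close> h(1) mult_right_mono[of "real (Suc i)" "real (2 ^ (N - m))" h] by auto
      have "real i * h \<le> real (Suc i) * h" using h(1) by (intro mult_right_mono) auto
      moreover from this le have "real i * h \<le> (1/2) ^ m" by (rule order_trans)
      moreover have "0 < real i * h" using \<open>0 < i\<close> h(1) by simp
      ultimately have "norm (X (real i * h) \<omega>) \<le> c * f (real i * h)" "f (real i * h) \<le> f (real (Suc i) * h)"
        using path f_le by blast+
      moreover have "norm (X (real (Suc i) * h) \<omega>) \<le> c * f (real (Suc i) * h)"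
        using path h(1) le by auto
      moreover have "norm (increment h i \<omega>) \<le> norm (X (real (Suc i) * h) \<omega>) + norm (X (real i * h) \<omega>)"
        unfolding increment_def by (rule norm_triangle_ineq4)
      ultimately show "norm (increment h i \<omega>) \<le> thr i"
        using mult_left_mono[of "f (real i * h)" "f (real (Suc i) * h)" c] assms(1)
        unfolding thr_def by linarith
    qed
  qed
qed

text \<open>The tail at 4dc f(t) is 2d times \<open>jump_rate (2 * c * f t)\<close>. Divergence of
  its integral makes the series in \<open>small_path_event_le_exp\<close> diverge, so the bound
  there becomes arbitrarily small.\<close>

lemma AE_not_small_path:
  assumes "0 < c"
    and div: "(\<integral>\<^sup>+t\<in>{0<..1}. emeasure \<nu> {y. norm y \<ge> 4 * real CARD('d) * c * f t} \<partial>lborel) = \<infinity>"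
  shows "AE \<omega> in M. \<not> (\<forall>t. 0 < t \<and> t \<le> (1/2) ^ m \<longrightarrow> norm (X t \<omega>) \<le> c * f t)"
proof -
  let ?g = "\<lambda>t. ennreal (jump_rate (2 * c * f t))"
  define x where "x k = (1/2) ^ Suc k * jump_rate (2 * c * f ((1/2) ^ k))" for k
  have x_nonneg: "0 \<le> x k" for k by (simp add: x_def)
  have "\<not> summable x"
  proof
    assume "summable x"
    \<comment> \<open>\<open>2 * x (k + 1)\<close> is the length of block k times the rate at its
      left end, the term of \<open>nn_integral_le_dyadic_sum\<close>.\<close>
    then have "summable (\<lambda>k. 2 * x (k + 1))" by (intro summable_mult summable_ignore_initial_segment)
    then have fin: "(\<Sum>k. ennreal (2 * x (k + 1))) \<noteq> \<top>"
      using x_nonneg by (intro ennreal_suminf_neq_top) auto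
    have "(\<integral>\<^sup>+t\<in>{0<..1}. emeasure \<nu> {y. norm y \<ge> 4 * real CARD('d) * c * f t} \<partial>lborel) =
        (\<integral>\<^sup>+t. ennreal (2 * real CARD('d)) * (?g t * indicator {0<..(1/2) ^ 0} t) \<partial>lborel)"
    proof (rule nn_integral_cong)
      fix t :: real
      show "emeasure \<nu> {y. norm y \<ge> 4 * real CARD('d) * c * f t} * indicator {0<..1} t =
          ennreal (2 * real CARD('d)) * (?g t * indicator {0<..(1/2) ^ 0} t)"
      proof (cases "t \<in> {0<..1}")
        case True
        then have "emeasure \<nu> {y. 2 * real CARD('d) * (2 * c * f t) \<le> norm y} = ennreal (2 * real CARD('d)) * ?g t"
          using f_pos assms by (intro emeasure_eq_jump_rate) auto
        then show ?thesis using True by (simp add: mult_ac)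
      qed simp
    qed
    also have "\<dots> = ennreal (2 * real CARD('d)) * (\<integral>\<^sup>+t\<in>{0<..(1/2) ^ 0}. ?g t \<partial>lborel)"
      by (rule nn_integral_cmult) measurable
    also have "(\<integral>\<^sup>+t\<in>{0<..(1/2) ^ 0}. ?g t \<partial>lborel) \<le> (\<Sum>k. ennreal ((1/2) ^ Suc (k + 0)) * ?g ((1/2) ^ Suc (k + 0)))"
      using assms(1) f_pos f_le
      by (intro nn_integral_le_dyadic_sum ennreal_leI jump_rate_antimono) auto
    also have "(\<Sum>k. ennreal ((1/2) ^ Suc (k + 0)) * ?g ((1/2) ^ Suc (k + 0))) = (\<Sum>k. ennreal (2 * x (k + 1)))"
      by (simp add: x_def flip: ennreal_mult)
    finally have "\<infinity> \<le> ennreal (2 * real CARD('d)) * (\<Sum>k. ennreal (2 * x (k + 1)))"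
      unfolding div by (simp add: mult_left_mono)
    then show False using fin by (simp add: top_unique ennreal_mult_eq_top_iff)
  qed
  have unbounded: "\<exists>n\<ge>m. B < (\<Sum>k=m..<n. x k)" for B
  proof (rule ccontr)
    assume *: "\<not> ?thesis"
    have "(\<Sum>k<n. x k) \<le> (\<Sum>k<m. x k) + max 0 B" for n
    proof -
      have "(\<Sum>k<n. x k) \<le> (\<Sum>k\<in>{..<m} \<union> {m..<max m n}. x k)"
        using x_nonneg by (intro sum_mono2) auto
      also have "\<dots> = (\<Sum>k<m. x k) + (\<Sum>k=m..<max m n. x k)"
        by (rule sum.union_disjoint) auto
      also have "(\<Sum>k=m..<max m n. x k) \<le> max 0 B" using * by (auto simp: not_less intro: le_max_iff_disj[THEN iffD2])
      finally show ?thesis by simp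
    qed
    with x_nonneg have "summable x" by (rule summableI_nonneg_bounded)
    then show False using \<open>\<not> summable x\<close> by simp
  qed
  let ?A = "{\<omega> \<in> space M. \<forall>t. 0 < t \<and> t \<le> (1/2) ^ m \<longrightarrow> norm (X t \<omega>) \<le> c * f t}"
  \<comment> \<open>\<open>?A\<close> has not been shown to be an event, so it is covered by events
    of probability at most 1/(j + 1), whose intersection is null.\<close>
  have "\<exists>G. G \<in> events \<and> ?A \<subseteq> G \<and> prob G \<le> inverse (real (Suc j))" for j
  proof -
    obtain n where n: "m \<le> n" "ln (real (Suc j)) < (\<Sum>k=m..<n. x k)" using unbounded by blast
    have "exp (- (\<Sum>k=m..<n. x k)) \<le> exp (- ln (real (Suc j)))" using n by simp
    also have "\<dots> = inverse (real (Suc j))" by (subst exp_minus) simp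
    finally show ?thesis
      using small_path_event_le_exp[OF assms(1) n(1)] unfolding x_def by (auto intro: order_trans)
  qed
  then have "\<forall>j. \<exists>G. G \<in> events \<and> ?A \<subseteq> G \<and> prob G \<le> inverse (real (Suc j))" by (rule allI)
  from choice[OF this] obtain G
    where G: "\<And>j. G j \<in> events" "\<And>j. ?A \<subseteq> G j" "\<And>j. prob (G j) \<le> inverse (real (Suc j))"
    by blast
  have "prob (\<Inter>j. G j) \<le> inverse (real (Suc j))" for j
  proof -
    have "prob (\<Inter>j. G j) \<le> prob (G j)"
      using G(1) by (intro finite_measure_mono) auto
    also note G(3)
    finally show ?thesis .
  qed
  then have "prob (\<Inter>j. G j) \<le> 0"
    by (intro LIMSEQ_le_const[OF LIMSEQ_inverse_real_of_nat]) auto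
  then have "(\<Inter>j. G j) \<in> null_sets M"
    using G(1) measure_nonneg[of M "\<Inter>j. G j"]
    by (intro null_setsI) (auto simp only: emeasure_eq_measure ennreal_eq_0_iff intro!: sets.countable_INT')
  then show ?thesis
    using G(2) by (intro AE_I'[of "\<Inter>j. G j"]) blast+
qed

text \<open>A finite upper limit would keep the path below an integer multiple of f on some (0,
  (1/2)^m]; this leaves countably many null events to exclude.\<close>

lemma AE_Limsup_eq_top:
  assumes "\<And>c. 0 < c \<Longrightarrow> (\<integral>\<^sup>+t\<in>{0<..1}. emeasure \<nu> {y. norm y \<ge> c * f t} \<partial>lborel) = \<infinity>"
  shows "AE \<omega> in M. Limsup (at_right 0) (\<lambda>t. ennreal (norm (X t \<omega>)) / ennreal (f t)) = \<infinity>"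
proof -
  have "AE \<omega> in M. \<forall>c m. \<not> (\<forall>t. 0 < t \<and> t \<le> (1/2) ^ m \<longrightarrow> norm (X t \<omega>) \<le> real (Suc c) * f t)"
    unfolding AE_all_countable by (intro allI AE_not_small_path assms) auto
  then show ?thesis
  proof eventually_elim
    case (elim \<omega>)
    let ?L = "Limsup (at_right 0) (\<lambda>t. ennreal (norm (X t \<omega>)) / ennreal (f t))"
    show ?case
    proof (rule ccontr)
      assume "?L \<noteq> \<infinity>"
      then have "?L < \<top>" by (simp add: less_top)
      then obtain c :: nat where c: "?L < of_nat c" using ennreal_Ex_less_of_nat by blast
      from Limsup_lessD[OF c] obtain d where d: "0 < d"
        "\<And>t. 0 < t \<Longrightarrow> t < d \<Longrightarrow> ennreal (norm (X t \<omega>)) / ennreal (f t) < of_nat c"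
        unfolding eventually_at_right_field by blast
      obtain m where m: "(1/2 :: real) ^ m < d" using real_arch_pow_inv[OF d(1), of "1/2"] by auto
      have "norm (X t \<omega>) \<le> real (Suc c) * f t" if t: "0 < t" "t \<le> (1/2) ^ m" for t
      proof -
        have "0 < f t" using t f_pos by simp
        have "ennreal (norm (X t \<omega>) / f t) < ennreal (real c)"
          using d(2)[of t] t m \<open>0 < f t\<close> by (simp add: divide_ennreal ennreal_of_nat_eq_real_of_nat)
        then have "norm (X t \<omega>) / f t < real c"
          using \<open>0 < f t\<close> by (subst (asm) ennreal_less_iff) auto
        then have "norm (X t \<omega>) \<le> real c * f t" using \<open>0 < f t\<close> by (simp add: field_simps)
        also have "\<dots> \<le> real (Suc c) * f t" using \<open>0 < f t\<close> by simp
        finally show ?thesis .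
      qed
      then show False using elim by blast
    qed
  qed
qed

text \<open>Where f is continuous the ratio is right-continuous in t, so nearby rational times do as
  well. The discontinuities of the monotone f are countable and are added to the index set
  outright.\<close>

lemma Limsup_measurable [measurable]:
  "(\<lambda>\<omega>. Limsup (at_right 0) (\<lambda>t. ennreal (norm (X t \<omega>)) / ennreal (f t))) \<in> borel_measurable M"
proof -
  let ?r = "\<lambda>\<omega> t. ennreal (norm (X t \<omega>)) / ennreal (f t)"
  define D where "D = \<rat> \<union> {t. \<not> isCont f t}"
  have D: "countable D"
    unfolding D_def using countable_rat mono_ctble_discont[OF mono_f] by auto
  have eq: "Limsup (at_right 0) (?r \<omega>) = (INF n. SUP t\<in>D \<inter> {0<..<(1/2) ^ n}. ?r \<omega> t)" if \<omega>: "\<omega> \<in> space M" for \<omega>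
  proof (rule antisym)
    show "Limsup (at_right 0) (?r \<omega>) \<le> (INF n. SUP t\<in>D \<inter> {0<..<(1/2) ^ n}. ?r \<omega> t)"
    proof (rule INF_greatest)
      fix n :: nat
      let ?S = "SUP t\<in>D \<inter> {0<..<(1/2) ^ n}. ?r \<omega> t"
      have "?r \<omega> t \<le> ?S" if t: "0 < t" "t < (1/2) ^ n" for t
      proof (rule ccontr)
        assume "\<not> ?r \<omega> t \<le> ?S"
        then have less: "?S < ?r \<omega> t" by simp
        have "t \<notin> D"
        proof
          assume "t \<in> D"
          then have "?r \<omega> t \<le> ?S" using t by (intro SUP_upper) auto
          with less show False by simp
        qed
        then have "isCont f t" by (auto simp: D_def)
        have pos: "0 < f t" using t f_pos by simp
        have "(f \<longlongrightarrow> f t) (at_right t)"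
          using \<open>isCont f t\<close> unfolding isCont_def by (rule tendsto_mono[OF at_le, rotated]) simp
        then have "((\<lambda>u. ennreal (norm (X u \<omega>) / f u)) \<longlongrightarrow> ennreal (norm (X t \<omega>) / f t)) (at_right t)"
          using right_continuous[OF \<omega>, of t] t pos
          by (intro tendsto_ennrealI tendsto_divide tendsto_norm) auto
        moreover have "?S < ennreal (norm (X t \<omega>) / f t)"
          using less pos by (simp add: divide_ennreal)
        ultimately have "\<forall>\<^sub>F u in at_right t. ?S < ennreal (norm (X u \<omega>) / f u)"
          by (rule order_tendstoD)
        then obtain e where e: "t < e" "\<And>u. t < u \<Longrightarrow> u < e \<Longrightarrow> ?S < ennreal (norm (X u \<omega>) / f u)"
          unfolding eventually_at_right_field by blast
        obtain u where u: "u \<in> \<rat>" "t < u" "u < min e ((1/2) ^ n)"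
          using Rats_dense_in_real[of t "min e ((1/2) ^ n)"] e t by auto
        then have "?S < ?r \<omega> u" using e(2)[of u] t f_pos[of u] by (simp add: divide_ennreal)
        moreover have "?r \<omega> u \<le> ?S" using u t by (intro SUP_upper) (auto simp: D_def)
        ultimately show False by simp
      qed
      then show "Limsup (at_right 0) (?r \<omega>) \<le> ?S"
        by (intro Limsup_bounded) (auto simp: eventually_at_right_field intro!: exI[of _ "(1/2) ^ n"])
    qed
    show "(INF n. SUP t\<in>D \<inter> {0<..<(1/2) ^ n}. ?r \<omega> t) \<le> Limsup (at_right 0) (?r \<omega>)"
    proof (rule dense_ge)
      fix y assume "Limsup (at_right 0) (?r \<omega>) < y"
      from Limsup_lessD[OF this] obtain d where d: "0 < d" "\<And>t. 0 < t \<Longrightarrow> t < d \<Longrightarrow> ?r \<omega> t < y"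
        unfolding eventually_at_right_field by blast
      obtain n where n: "(1/2 :: real) ^ n < d" using real_arch_pow_inv[OF d(1), of "1/2"] by auto
      have "(SUP t\<in>D \<inter> {0<..<(1/2) ^ n}. ?r \<omega> t) \<le> y"
        using d(2) n by (intro SUP_least less_imp_le) auto
      then show "(INF n. SUP t\<in>D \<inter> {0<..<(1/2) ^ n}. ?r \<omega> t) \<le> y"
        by (rule INF_lower2[rotated]) simp
    qed
  qed
  have "(\<lambda>\<omega>. INF n. SUP t\<in>D \<inter> {0<..<(1/2) ^ n}. ?r \<omega> t) \<in> borel_measurable M"
  proof (intro borel_measurable_INF borel_measurable_SUP)
    fix n :: nat and t assume "t \<in> D \<inter> {0<..<(1/2) ^ n}"
    then have [measurable]: "X t \<in> borel_measurable M" by (intro random_variable_X) auto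
    show "(\<lambda>\<omega>. ?r \<omega> t) \<in> borel_measurable M" by measurable
  qed (use D in auto)
  then show ?thesis using eq by (subst measurable_cong) auto
qed

end

section \<open>From (L4) to (L1)\<close>

lemma nn_integral_near_0_less:
  assumes [measurable]: "g \<in> borel_measurable borel"
    and fin: "(\<integral>\<^sup>+t\<in>{0<..1}. g t \<partial>lborel) < \<infinity>" and "0 < e"
  shows "\<exists>m. (\<integral>\<^sup>+t\<in>{0<..(1/2 :: real) ^ m}. g t \<partial>lborel) < e"
proof -
  have "(\<lambda>m. \<integral>\<^sup>+t\<in>{0<..(1/2 :: real) ^ m}. g t \<partial>lborel) \<longlonglongrightarrow> (\<integral>\<^sup>+t. 0 \<partial>(lborel :: real measure))"
  proof (rule nn_integral_dominated_convergence)
    show "(\<integral>\<^sup>+t. g t * indicator {0<..1} t \<partial>lborel) < \<infinity>" by (rule fin)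
    show "AE t in lborel. g t * indicator {0<..(1/2) ^ m} t \<le> g t * indicator {0<..1} t" for m
      by (intro AE_I2) (auto simp: indicator_def intro: order_trans[OF _ power_le_one])
    show "AE t in lborel. (\<lambda>m. g t * indicator {0<..(1/2) ^ m} t) \<longlonglongrightarrow> 0"
    proof (rule AE_I2)
      fix t :: real
      show "(\<lambda>m. g t * indicator {0<..(1/2) ^ m} t) \<longlonglongrightarrow> 0"
      proof (cases "0 < t")
        case True
        obtain m where m: "(1/2) ^ m < t" using real_arch_pow_inv[OF True, of "1/2"] by auto
        have "(1/2) ^ n < t" if "m \<le> n" for n
          using power_decreasing[OF that, of "1/2 :: real"] m by linarith
        then have "\<forall>\<^sub>F n in sequentially. g t * indicator {0<..(1/2) ^ n} t = 0"
          unfolding eventually_sequentially by (intro exI[of _ m]) (auto simp: indicator_def not_le[symmetric])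
        then show ?thesis by (rule tendsto_eventually)
      qed simp
    qed
  qed measurable
  then have "(\<lambda>m. \<integral>\<^sup>+t\<in>{0<..(1/2 :: real) ^ m}. g t \<partial>lborel) \<longlonglongrightarrow> 0" by simp
  from order_tendstoD(2)[OF this assms(3)] show ?thesis
    unfolding eventually_sequentially by blast
qed

lemma one_minus_exp_ge: "min 1 x / 2 \<le> 1 - exp (- x)" if "0 \<le> x" for x :: real
proof -
  have "exp (- x) \<le> 1 / (1 + x)"
    using exp_ge_add_one_self[of x] that by (simp add: exp_minus field_simps)
  then have "x / (1 + x) \<le> 1 - exp (- x)" using that by (simp add: field_simps)
  moreover have "min 1 x / 2 \<le> x / (1 + x)"
    using that by (cases "x \<le> 1") (auto simp: field_simps min_def mult_left_le)
  ultimately show ?thesis by linarith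
qed

text \<open>X at t is the limit of X at dyadic times strictly to the right of t, and each level n
  uses only countably many times. The lemma makes P(|X_t| >= f(t)) a Borel function of t;
  \<open>max 0 t\<close> is there because nothing is assumed about negative times.\<close>

lemma (in levy_process) jointly_measurable:
  "(\<lambda>(t, \<omega>). X (max 0 t) \<omega>) \<in> borel_measurable (borel \<Otimes>\<^sub>M M)"
proof (rule borel_measurable_LIMSEQ_metric)
  define \<tau> where "\<tau> n t = real (Suc (nat \<lfloor>max 0 t * 2 ^ n\<rfloor>)) / 2 ^ n" for n and t :: real
  fix n
  have "(\<lambda>p. X (real (Suc i) / 2 ^ n) (snd p)) \<in> borel_measurable (borel \<Otimes>\<^sub>M M)" for i
  proof -
    have [measurable]: "X (real (Suc i) / 2 ^ n) \<in> borel_measurable M" by (intro random_variable_X) simp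
    show ?thesis by measurable
  qed
  then have "(\<lambda>p. X (real (Suc (nat \<lfloor>max 0 (fst p) * (2::real) ^ n\<rfloor>)) / 2 ^ n) (snd p)) \<in> borel_measurable (borel \<Otimes>\<^sub>M M)"
    by (rule measurable_compose_countable) measurable
  then show "(\<lambda>p. X (\<tau> n (fst p)) (snd p)) \<in> borel_measurable (borel \<Otimes>\<^sub>M M)"
    by (simp only: \<tau>_def)
next
  define \<tau> where "\<tau> n t = real (Suc (nat \<lfloor>max 0 t * 2 ^ n\<rfloor>)) / 2 ^ n" for n and t :: real
  fix p :: "real \<times> 'w" assume "p \<in> space (borel \<Otimes>\<^sub>M M)"
  then obtain t \<omega> where p: "p = (t, \<omega>)" "\<omega> \<in> space M" by (auto simp: space_pair_measure)
  have bounds: "max 0 t < \<tau> n t" "\<tau> n t \<le> max 0 t + (1/2) ^ n" for n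
  proof -
    have "real (Suc (nat \<lfloor>max 0 t * 2 ^ n\<rfloor>)) = of_int \<lfloor>max 0 t * 2 ^ n\<rfloor> + 1" by simp
    then have 1: "max 0 t * 2 ^ n < real (Suc (nat \<lfloor>max 0 t * 2 ^ n\<rfloor>))"
      and 2: "real (Suc (nat \<lfloor>max 0 t * 2 ^ n\<rfloor>)) \<le> max 0 t * 2 ^ n + 1" by linarith+
    show "max 0 t < \<tau> n t"
      unfolding \<tau>_def by (subst pos_less_divide_eq) (simp, rule 1)
    have "(max 0 t + (1/2) ^ n) * 2 ^ n = max 0 t * 2 ^ n + 1"
      by (simp only: distrib_right power_mult_distrib[symmetric]) simp
    with 2 show "\<tau> n t \<le> max 0 t + (1/2) ^ n"
      unfolding \<tau>_def by (subst pos_divide_le_eq) (simp, simp only:)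
  qed
  have "(\<lambda>n. max 0 t + (1/2) ^ n) \<longlonglongrightarrow> max 0 t + 0"
    by (intro tendsto_intros LIMSEQ_power_zero) simp
  then have upper: "(\<lambda>n. max 0 t + (1/2) ^ n) \<longlonglongrightarrow> max 0 t" by (simp only: add_0_right)
  have "(\<lambda>n. \<tau> n t) \<longlonglongrightarrow> max 0 t"
  proof (rule tendsto_sandwich[OF _ _ tendsto_const upper])
    show "\<forall>\<^sub>F n in sequentially. max 0 t \<le> \<tau> n t"
      using bounds(1) by (intro always_eventually allI less_imp_le)
    show "\<forall>\<^sub>F n in sequentially. \<tau> n t \<le> max 0 t + (1/2) ^ n"
      using bounds(2) by (intro always_eventually allI)
  qed
  then have "filterlim (\<lambda>n. \<tau> n t) (at_right (max 0 t)) sequentially"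
    unfolding filterlim_at greaterThan_iff
    using bounds(1) less_imp_neq[OF bounds(1)] by (intro conjI always_eventually allI) (auto dest: sym)
  from filterlim_compose[OF right_continuous[OF p(2), of "max 0 t"] this]
  show "(\<lambda>n. X (\<tau> n (fst p)) (snd p)) \<longlonglongrightarrow> (case p of (t, \<omega>) \<Rightarrow> X (max 0 t) \<omega>)"
    by (simp add: p)
qed

context sector_levy_bound
begin

definition exceedance :: "real \<Rightarrow> real" where
  "exceedance t = prob {\<omega> \<in> space M. f t \<le> norm (X (max 0 t) \<omega>)}"

lemma exceedance_measurable [measurable]: "exceedance \<in> borel_measurable borel"
proof -
  let ?Q = "{p \<in> space (borel \<Otimes>\<^sub>M M). f (fst p) \<le> norm (X (max 0 (fst p)) (snd p))}"
  have [measurable]: "(\<lambda>p. X (max 0 (fst p)) (snd p)) \<in> borel_measurable (borel \<Otimes>\<^sub>M M)"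
    using jointly_measurable by (simp add: case_prod_unfold)
  have "?Q \<in> sets (borel \<Otimes>\<^sub>M M)" by measurable
  then have "(\<lambda>t. emeasure M (Pair t -` ?Q)) \<in> borel_measurable borel"
    by (rule measurable_emeasure_Pair)
  moreover have "Pair t -` ?Q = {\<omega> \<in> space M. f t \<le> norm (X (max 0 t) \<omega>)}" for t
    by (auto simp: space_pair_measure)
  ultimately show ?thesis
    unfolding exceedance_def measure_def by simp
qed

text \<open>Bad times \<open>u < s\<close>, those with exceedance probability at least \<open>1/4\<close>, fill at most a quarter of \<open>(0, s)\<close>.
  So \<open>s = u + (s - u)\<close> for two good times.\<close>

lemma prob_le_half_if_exceedance_integrable:
  assumes small: "(\<integral>\<^sup>+t\<in>{0<..d}. ennreal (exceedance t * (1 / t)) \<partial>lborel) < ennreal (1 / 16)"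
    and s: "0 \<le> s" "s \<le> t" "0 < t" "t \<le> d"
  shows "prob {\<omega> \<in> space M. 2 * f t \<le> norm (X s \<omega>)} \<le> 1 / 2"
proof (cases "s = 0")
  case True
  then have empty: "{\<omega> \<in> space M. 2 * f t \<le> norm (X s \<omega>)} = {}"
    using f_pos[OF s(3)] by (auto simp: start_at_zero)
  show ?thesis unfolding empty by simp
next
  case False
  then have "0 < s" using s by simp
  define B where "B = {u \<in> {0<..<s}. 1 / 4 \<le> exceedance u}"
  have B_sets [measurable]: "B \<in> sets borel"
    unfolding B_def by measurable
  have "emeasure lborel B = (\<integral>\<^sup>+u. indicator B u \<partial>lborel)" by simp
  \<comment> \<open>Markov's inequality: on \<open>B\<close> the integrand exceedance(u)/u is at
    least 1/(4u) > 1/(4s), and 4s times 1/16 is s/4.\<close>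
  also have "\<dots> \<le> (\<integral>\<^sup>+u. ennreal (4 * s) * (ennreal (exceedance u * (1 / u)) * indicator {0<..d} u) \<partial>lborel)"
  proof (rule nn_integral_mono)
    fix u :: real
    show "indicator B u \<le> ennreal (4 * s) * (ennreal (exceedance u * (1 / u)) * indicator {0<..d} u)"
    proof (cases "u \<in> B")
      case True
      then have u: "0 < u" "u < s" "1 \<le> 4 * exceedance u" by (auto simp: B_def)
      then have "1 * 1 \<le> (s / u) * (4 * exceedance u)" by (intro mult_mono) auto
      then have "1 \<le> 4 * s * (exceedance u * (1 / u))" by (simp add: mult_ac)
      then have "ennreal 1 \<le> ennreal (4 * s * (exceedance u * (1 / u)))" by (rule ennreal_leI)
      also have "\<dots> = ennreal (4 * s) * ennreal (exceedance u * (1 / u))"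
        using u \<open>0 < s\<close> by (intro ennreal_mult) (auto simp: exceedance_def)
      finally show ?thesis using True u s by (simp add: indicator_def)
    qed simp
  qed
  also have "\<dots> = ennreal (4 * s) * (\<integral>\<^sup>+u\<in>{0<..d}. ennreal (exceedance u * (1 / u)) \<partial>lborel)"
    by (rule nn_integral_cmult) measurable
  also have "\<dots> \<le> ennreal (4 * s) * ennreal (1 / 16)"
    using small by (intro mult_left_mono) auto
  also have "\<dots> = ennreal (s / 4)"
    using \<open>0 < s\<close> by (simp flip: ennreal_mult)
  finally have B_le: "emeasure lborel B \<le> ennreal (s / 4)" .
  \<comment> \<open>\<open>B\<close> and its reflection under u -> s - u have total measure at most
    s/2 and cannot cover (0, s).\<close>
  have "\<exists>u. 0 < u \<and> u < s \<and> u \<notin> B \<and> s - u \<notin> B"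
  proof (rule ccontr)
    assume "\<not> ?thesis"
    then have cover: "(indicator {0<..<s} u :: ennreal) \<le> indicator B u + indicator B (s - u)" for u
      by (auto simp: indicator_def)
    have "(\<integral>\<^sup>+u. indicator B u \<partial>lborel) = ennreal \<bar>-1\<bar> * (\<integral>\<^sup>+u. indicator B (s + -1 * u) \<partial>lborel)"
      by (rule nn_integral_real_affine) auto
    then have reflect: "(\<integral>\<^sup>+u. indicator B (s - u) \<partial>lborel) = emeasure lborel B" by simp
    have "ennreal s = (\<integral>\<^sup>+u. indicator {0<..<s} u \<partial>lborel)"
      using \<open>0 < s\<close> by simp
    also have "\<dots> \<le> (\<integral>\<^sup>+u. indicator B u + indicator B (s - u) \<partial>lborel)"
      using cover by (rule nn_integral_mono)
    also have "\<dots> = emeasure lborel B + emeasure lborel B"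
      by (subst nn_integral_add) (auto simp: reflect)
    also have "\<dots> \<le> ennreal (s / 4) + ennreal (s / 4)" using B_le by (intro add_mono)
    also have "\<dots> = ennreal (s / 2)" using \<open>0 < s\<close> by (simp flip: ennreal_plus)
    finally show False using \<open>0 < s\<close> by (simp add: ennreal_le_iff)
  qed
  then obtain u where u: "0 < u" "u < s" "exceedance u < 1 / 4" "exceedance (s - u) < 1 / 4"
    by (auto simp: B_def not_le)
  have [measurable]: "X s \<in> borel_measurable M" "X u \<in> borel_measurable M" "X (s - u) \<in> borel_measurable M"
    using u by (auto intro!: random_variable_X)
  have mono_le: "prob {\<omega> \<in> space M. f t \<le> norm (X v \<omega>)} \<le> exceedance v" if "0 < v" "v \<le> s" for v
  proof -
    have "X v \<in> borel_measurable M" using that by (intro random_variable_X) simp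
    then show ?thesis
      using that s f_le[of v t] unfolding exceedance_def
      by (intro finite_measure_mono) auto
  qed
  have "prob {\<omega> \<in> space M. 2 * f t \<le> norm (X s \<omega>)} \<le>
      prob ({\<omega> \<in> space M. f t \<le> norm (X u \<omega>)} \<union> {\<omega> \<in> space M. X s \<omega> - X u \<omega> \<in> {y. f t \<le> norm y}})"
  proof (rule finite_measure_mono)
    show "{\<omega> \<in> space M. 2 * f t \<le> norm (X s \<omega>)} \<subseteq>
      {\<omega> \<in> space M. f t \<le> norm (X u \<omega>)} \<union> {\<omega> \<in> space M. X s \<omega> - X u \<omega> \<in> {y. f t \<le> norm y}}"
    proof safe
      fix \<omega> assume "2 * f t \<le> norm (X s \<omega>)" "\<not> f t \<le> norm (X s \<omega> - X u \<omega>)"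
      then show "f t \<le> norm (X u \<omega>)"
        using norm_triangle_sub[of "X s \<omega>" "X u \<omega>"] by linarith
    qed
  qed measurable
  also have "\<dots> \<le> prob {\<omega> \<in> space M. f t \<le> norm (X u \<omega>)} + prob {\<omega> \<in> space M. X s \<omega> - X u \<omega> \<in> {y. f t \<le> norm y}}"
    by (rule measure_Un_le) measurable
  also have "prob {\<omega> \<in> space M. X s \<omega> - X u \<omega> \<in> {y. f t \<le> norm y}} = prob {\<omega> \<in> space M. X (s - u) \<omega> \<in> {y. f t \<le> norm y}}"
    using u by (intro prob_increment) auto
  also have "prob {\<omega> \<in> space M. f t \<le> norm (X u \<omega>)} + \<dots> \<le> 1 / 4 + 1 / 4"
    using mono_le[of u] mono_le[of "s - u"] u by simp
  finally show ?thesis by simp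
qed

text \<open>On a fine grid of [0, t], either all increments are at most 6f(t), or the path reaches
  3f(t) at a grid point. Independence bounds the first probability by the exponential. Ottaviani's
  inequality with a = f(t), b = 2f(t) and q = 1/2 bounds the second by twice
  \<open>exceedance t\<close>.\<close>

lemma exceedance_ge:
  assumes small: "(\<integral>\<^sup>+t\<in>{0<..d}. ennreal (exceedance t * (1 / t)) \<partial>lborel) < ennreal (1 / 16)"
    and t: "0 < t" "t \<le> d"
  shows "1 - exp (- (t * jump_rate (6 * f t))) \<le> 2 * exceedance t"
proof -
  let ?a = "6 * f t"
  have "\<forall>\<^sub>F s in at_right 0. s * jump_rate ?a \<le> prob {\<omega> \<in> space M. ?a < norm (X s \<omega>)}"
    using f_pos t by (intro eventually_jump_rate_le_prob) auto
  then obtain e where e: "0 < e" "\<And>s. 0 < s \<Longrightarrow> s < e \<Longrightarrow> s * jump_rate ?a \<le> prob {\<omega> \<in> space M. ?a < norm (X s \<omega>)}"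
    unfolding eventually_at_right_field by blast
  obtain n where "inverse (real (Suc n)) < e / t"
    using reals_Archimedean[of "e / t"] e t by auto
  define N where "N = Suc n"
  define h where "h = t / real N"
  have h: "0 < h" "h < e" "real N * h = t"
    using t \<open>inverse (real (Suc n)) < e / t\<close> by (auto simp: h_def N_def field_simps)
  have rv: "X (real i * h) \<in> borel_measurable M" for i
    using h by (intro random_variable_X) simp
  let ?small = "{\<omega> \<in> space M. \<forall>i\<in>{..<N}. norm (increment h i \<omega>) \<le> ?a}"
  let ?big = "{\<omega> \<in> space M. \<exists>i\<le>N. f t + 2 * f t \<le> norm (X (real i * h) \<omega>)}"
  have "prob ?small \<le> exp (- (\<Sum>i\<in>{..<N}. h * jump_rate ?a))"
  proof (rule prob_all_small_le_exp[OF indep_increment[OF h(1), of N]])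
    show "h * jump_rate ?a \<le> prob {\<omega> \<in> space M. ?a < norm (increment h i \<omega>)}" for i
      using e(2)[OF h(1,2)] prob_increment_grid[OF h(1), of "{y. ?a < norm y}" i] by simp
  qed auto
  also have "\<dots> = exp (- (t * jump_rate ?a))"
    using h(3) by (simp add: mult.assoc[symmetric])
  finally have small_le: "prob ?small \<le> exp (- (t * jump_rate ?a))" .
  have "space M \<subseteq> ?small \<union> ?big"
  proof
    fix \<omega> assume \<omega>: "\<omega> \<in> space M"
    show "\<omega> \<in> ?small \<union> ?big"
    proof (cases "\<omega> \<in> ?big")
      case False
      then have lt: "norm (X (real i * h) \<omega>) < 3 * f t" if "i \<le> N" for i
      proof -
        have "\<not> f t + 2 * f t \<le> norm (X (real i * h) \<omega>)" using False \<omega> that by blast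
        then show ?thesis by simp
      qed
      have "norm (increment h i \<omega>) \<le> ?a" if "i < N" for i
        using lt[of i] lt[of "Suc i"] that norm_triangle_ineq4[of "X (real (Suc i) * h) \<omega>" "X (real i * h) \<omega>"]
        unfolding increment_def by simp
      then show ?thesis using \<omega> by auto
    qed simp
  qed
  moreover have sets: "?small \<in> events" "?big \<in> events"
  proof -
    have [measurable]: "increment h i \<in> borel_measurable M" for i
      unfolding increment_def[abs_def] by (intro borel_measurable_diff rv)
    show "?small \<in> events" by measurable
    have "{\<omega> \<in> space M. f t + 2 * f t \<le> norm (X (real i * h) \<omega>)} \<in> events" for i
      using rv[of i] by measurable
    then have "(\<Union>i\<in>{..N}. {\<omega> \<in> space M. f t + 2 * f t \<le> norm (X (real i * h) \<omega>)}) \<in> events"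
      by (intro sets.finite_UN) auto
    moreover have "(\<Union>i\<in>{..N}. {\<omega> \<in> space M. f t + 2 * f t \<le> norm (X (real i * h) \<omega>)}) = ?big"
      by blast
    ultimately show "?big \<in> events" by (simp only:)
  qed
  ultimately have "prob (space M) \<le> prob (?small \<union> ?big)"
    by (intro finite_measure_mono sets.Un)
  also have "\<dots> \<le> prob ?small + prob ?big"
    using sets by (rule measure_Un_le)
  finally have "1 - exp (- (t * jump_rate ?a)) \<le> prob ?big"
    using small_le by (simp add: prob_space)
  also have "(1 - 1 / 2) * prob ?big \<le> prob {\<omega> \<in> space M. f t \<le> norm (X (real N * h) \<omega>)}"
    using prob_le_half_if_exceedance_integrable[OF small, of _ t] t h
    by (intro prob_max_grid_le[OF h(1)]) auto
  then have "prob ?big \<le> 2 * exceedance t"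
    using t h by (simp add: exceedance_def)
  finally show ?thesis .
qed

text \<open>12d is the 6 of \<open>exceedance_ge\<close> times the 2d of \<open>jump_rate\<close>.
  Near 0, \<open>exceedance_ge\<close> controls only min(1, t k(t)) for k(t) =
  \<open>jump_rate (6 * f t)\<close>, so the truncation has to be removed; away from 0, k is bounded
  by monotonicity.\<close>

lemma L1_if_L4:
  assumes L4: "(\<integral>\<^sup>+t\<in>{0<..1}. ennreal (measure M {\<omega> \<in> space M. norm (X t \<omega>) \<ge> f t} * (1 / t)) \<partial>lborel) < \<infinity>"
  shows "(\<integral>\<^sup>+t\<in>{0<..1}. emeasure \<nu> {y. norm y \<ge> 12 * real CARD('d) * f t} \<partial>lborel) < \<infinity>"
proof -
  let ?g = "\<lambda>t. ennreal (exceedance t * (1 / t))"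
  have "(\<integral>\<^sup>+t\<in>{0<..1}. ?g t \<partial>lborel) =
      (\<integral>\<^sup>+t\<in>{0<..1}. ennreal (measure M {\<omega> \<in> space M. norm (X t \<omega>) \<ge> f t} * (1 / t)) \<partial>lborel)"
    by (intro nn_integral_cong) (auto simp: indicator_def exceedance_def max_def)
  then have fin: "(\<integral>\<^sup>+t\<in>{0<..1}. ?g t \<partial>lborel) < \<infinity>" using L4 by simp
  have "?g \<in> borel_measurable borel" by measurable
  \<comment> \<open>1/16 is what \<open>exceedance_ge\<close> asks for, and it also bounds the
    integral of \<open>J\<close> over (0, d] by 1/4, below the 1/2 that \<open>J t = 1 / t\<close>
    would produce on (t/2, t].\<close>
  from nn_integral_near_0_less[OF this fin, of "ennreal (1 / 16)"]
  obtain m where small: "(\<integral>\<^sup>+t\<in>{0<..(1/2) ^ m}. ?g t \<partial>lborel) < ennreal (1 / 16)"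
    by (auto simp: ennreal_less_zero_iff)
  define d where "d = (1/2 :: real) ^ m"
  have d: "0 < d" "d \<le> 1" by (auto simp: d_def power_le_one)
  note small = small[folded d_def]
  let ?k = "\<lambda>t. jump_rate (6 * f t)"
  define J where "J t = min (1 / t) (?k t)" for t
  have J_le: "J t \<le> 4 * (exceedance t * (1 / t))" if t: "0 < t" "t \<le> d" for t
  proof -
    have "min 1 (t * ?k t) / 2 \<le> 2 * exceedance t"
      using one_minus_exp_ge[of "t * ?k t"] exceedance_ge[OF small t] t by simp
    moreover have "t * J t = min 1 (t * ?k t)"
      using t by (simp add: J_def min_mult_distrib_left)
    ultimately have "t * J t \<le> 4 * exceedance t" by simp
    then show ?thesis using t by (simp add: field_simps)
  qed
  have J_antimono: "J t \<le> J s" if "0 < s" "s \<le> t" for s t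
    unfolding J_def using that f_pos f_le[of s t]
    by (intro min.mono divide_left_mono jump_rate_antimono) auto
  \<comment> \<open>\<open>J\<close> is non-increasing and integrable at 0, so \<open>t J(t)\<close> is small and the minimum is not \<open>1/t\<close>.\<close>
  have k_eq: "?k t = J t" if t: "0 < t" "t \<le> d" for t
  proof (rule ccontr)
    assume "?k t \<noteq> J t"
    then have "J t = 1 / t" by (auto simp: J_def min_def split: if_splits)
    have "ennreal (1 / 2) = ennreal (1 / t) * emeasure lborel {t / 2<..t}"
      using t by (simp flip: ennreal_mult)
    also have "\<dots> = (\<integral>\<^sup>+s. ennreal (1 / t) * indicator {t / 2<..t} s \<partial>lborel)"
      by (rule nn_integral_cmult_indicator[symmetric]) simp
    also have "\<dots> \<le> (\<integral>\<^sup>+s. ennreal 4 * (?g s * indicator {0<..d} s) \<partial>lborel)"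
    proof (rule nn_integral_mono)
      fix s :: real
      show "ennreal (1 / t) * indicator {t / 2<..t} s \<le> ennreal 4 * (?g s * indicator {0<..d} s)"
      proof (cases "s \<in> {t / 2<..t}")
        case True
        then have s: "0 < s" "s \<le> t" using t by auto
        then have "1 / t \<le> 4 * (exceedance s * (1 / s))"
          using J_antimono[OF s] J_le[of s] t \<open>J t = 1 / t\<close> by simp
        then have "ennreal (1 / t) \<le> ennreal (4 * (exceedance s * (1 / s)))" by (rule ennreal_leI)
        also have "\<dots> = ennreal 4 * ?g s"
          using s by (intro ennreal_mult) (auto simp: exceedance_def)
        finally show ?thesis using s t by (simp add: indicator_def)
      qed simp
    qed
    also have "\<dots> = ennreal 4 * (\<integral>\<^sup>+s\<in>{0<..d}. ?g s \<partial>lborel)"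
      by (rule nn_integral_cmult) measurable
    also have "\<dots> \<le> ennreal 4 * ennreal (1 / 16)"
      using small by (intro mult_left_mono) auto
    also have "\<dots> = ennreal (4 * (1 / 16))" by (rule ennreal_mult[symmetric]) simp_all
    also have "\<dots> = ennreal (1 / 4)" by simp
    finally show False by (subst (asm) ennreal_le_iff) auto
  qed
  let ?c = "2 * real CARD('d)"
  have "(\<integral>\<^sup>+t\<in>{0<..1}. emeasure \<nu> {y. norm y \<ge> 12 * real CARD('d) * f t} \<partial>lborel) \<le>
      (\<integral>\<^sup>+t. ennreal ?c * (ennreal 4 * (?g t * indicator {0<..1} t) + ennreal (?k d) * indicator {0<..1} t) \<partial>lborel)"
  proof (rule nn_integral_mono)
    fix t :: real
    show "emeasure \<nu> {y. norm y \<ge> 12 * real CARD('d) * f t} * indicator {0<..1} t \<le>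
      ennreal ?c * (ennreal 4 * (?g t * indicator {0<..1} t) + ennreal (?k d) * indicator {0<..1} t)"
    proof (cases "t \<in> {0<..1}")
      case True
      then have t: "0 < t" by simp
      have "emeasure \<nu> {y. ?c * (6 * f t) \<le> norm y} = ennreal ?c * ennreal (?k t)"
        using f_pos[OF t] by (intro emeasure_eq_jump_rate) simp
      then have eq: "emeasure \<nu> {y. norm y \<ge> 12 * real CARD('d) * f t} = ennreal ?c * ennreal (?k t)"
        by (simp add: mult_ac)
      have g_eq: "ennreal 4 * ?g t = ennreal (4 * (exceedance t * (1 / t)))"
        using t by (intro ennreal_mult[symmetric]) (auto simp: exceedance_def)
      have "ennreal (?k t) \<le> ennreal 4 * ?g t + ennreal (?k d)"
      proof (cases "t \<le> d")
        case True
        then have "?k t \<le> 4 * (exceedance t * (1 / t))" using k_eq[OF t] J_le[OF t] by simp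
        then have "ennreal (?k t) \<le> ennreal 4 * ?g t" unfolding g_eq by (rule ennreal_leI)
        then show ?thesis by (intro add_increasing2) auto
      next
        case False
        then have "?k t \<le> ?k d" using d f_pos f_le[of d t] by (intro jump_rate_antimono) auto
        then have "ennreal (?k t) \<le> ennreal (?k d)" by (rule ennreal_leI)
        then show ?thesis by (intro add_increasing) auto
      qed
      then show ?thesis unfolding eq using True by (simp add: mult_left_mono)
    qed simp
  qed
  also have "\<dots> = ennreal ?c * (\<integral>\<^sup>+t. ennreal 4 * (?g t * indicator {0<..1} t) + ennreal (?k d) * indicator {0<..1} t \<partial>lborel)"
    by (rule nn_integral_cmult) measurable
  also have "(\<integral>\<^sup>+t. ennreal 4 * (?g t * indicator {0<..1} t) + ennreal (?k d) * indicator {0<..1} t \<partial>lborel) =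
      (\<integral>\<^sup>+t. ennreal 4 * (?g t * indicator {0<..1} t) \<partial>lborel) + (\<integral>\<^sup>+t. ennreal (?k d) * indicator {0<..1 :: real} t \<partial>lborel)"
    by (rule nn_integral_add) measurable
  also have "(\<integral>\<^sup>+t. ennreal 4 * (?g t * indicator {0<..1} t) \<partial>lborel) = ennreal 4 * (\<integral>\<^sup>+t\<in>{0<..1}. ?g t \<partial>lborel)"
    by (rule nn_integral_cmult) measurable
  also have "(\<integral>\<^sup>+t. ennreal (?k d) * indicator {0<..1 :: real} t \<partial>lborel) = ennreal (?k d)"
    by (subst nn_integral_cmult_indicator) auto
  also have "ennreal ?c * (ennreal 4 * (\<integral>\<^sup>+t\<in>{0<..1}. ?g t \<partial>lborel) + ennreal (?k d)) < \<infinity>"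
    using fin by (simp add: ennreal_mult_less_top del: ennreal_numeral)
  finally show ?thesis .
qed

end

section \<open>Equivalence of all statements\<close>

lemma all_equivalentI: "list_all (\<lambda>Q. Q \<longleftrightarrow> P) Ps \<Longrightarrow> all_equivalent Ps"
  by (auto simp: all_equivalent_def list_all_iff)

context sector_levy_bound
begin

text \<open>The assumption is all that is kept of (A1) or (A2). The upper limit is then almost
  surely 0 or almost surely infinite according to \<open>L1\<close>, so the events in question have
  probability 0 or 1.\<close>

lemma L1_dichotomy:
  defines "L1 \<equiv> \<exists>c>0. (\<integral>\<^sup>+t\<in>{0<..1}. emeasure \<nu> {y. norm y \<ge> c * f t} \<partial>lborel) < \<infinity>"
    and "L \<equiv> \<lambda>\<omega>. Limsup (at_right 0) (\<lambda>t. ennreal (norm (X t \<omega>)) / ennreal (f t))"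
  assumes L1: "L1 \<Longrightarrow> tail_integral 1 < \<infinity>"
  shows "(AE \<omega> in M. L \<omega> = 0) \<longleftrightarrow> L1" and "(AE \<omega> in M. L \<omega> < \<infinity>) \<longleftrightarrow> L1"
    and "0 < prob {\<omega> \<in> space M. L \<omega> = 0} \<longleftrightarrow> L1" and "0 < prob {\<omega> \<in> space M. L \<omega> < \<infinity>} \<longleftrightarrow> L1"
    and "AE \<omega> in M. L \<omega> \<in> {0, \<infinity>}"
proof -
  have [measurable]: "L \<in> borel_measurable M" unfolding L_def by measurable
  have AE_0: "AE \<omega> in M. L \<omega> = 0" if L1
    unfolding L_def
    by (rule AE_Limsup_eq_0, rule tail_integral_scale[OF zero_less_one _ L1[OF that]])
  have AE_top: "AE \<omega> in M. L \<omega> = \<infinity>" if "\<not> L1"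
    unfolding L_def using that unfolding L1_def by (intro AE_Limsup_eq_top) (auto simp: less_top[symmetric])
  have [measurable]: "{\<omega> \<in> space M. L \<omega> = 0} \<in> events" "{\<omega> \<in> space M. L \<omega> < \<infinity>} \<in> events"
    by measurable
  have prob_0: "prob {\<omega> \<in> space M. L \<omega> = 0} = (if L1 then 1 else 0)"
    using AE_0 AE_top by (auto simp: prob_Collect_eq_1 prob_Collect_eq_0 elim!: eventually_mono)
  have prob_fin: "prob {\<omega> \<in> space M. L \<omega> < \<infinity>} = (if L1 then 1 else 0)"
    using AE_0 AE_top by (auto simp: prob_Collect_eq_1 prob_Collect_eq_0 elim!: eventually_mono)
  show "0 < prob {\<omega> \<in> space M. L \<omega> = 0} \<longleftrightarrow> L1" "0 < prob {\<omega> \<in> space M. L \<omega> < \<infinity>} \<longleftrightarrow> L1"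
    unfolding prob_0 prob_fin by auto
  have "(AE \<omega> in M. L \<omega> = 0) \<longleftrightarrow> prob {\<omega> \<in> space M. L \<omega> = 0} = 1"
    by (rule prob_Collect_eq_1[symmetric]) measurable
  then show "(AE \<omega> in M. L \<omega> = 0) \<longleftrightarrow> L1" unfolding prob_0 by auto
  have "(AE \<omega> in M. L \<omega> < \<infinity>) \<longleftrightarrow> prob {\<omega> \<in> space M. L \<omega> < \<infinity>} = 1"
    by (rule prob_Collect_eq_1[symmetric]) measurable
  then show "(AE \<omega> in M. L \<omega> < \<infinity>) \<longleftrightarrow> L1" unfolding prob_fin by auto
  show "AE \<omega> in M. L \<omega> \<in> {0, \<infinity>}"
    using AE_0 AE_top by (cases L1) (auto elim!: eventually_mono)
qed

text \<open>Every item is shown equivalent to (L1). The second alternative of the hypothesis is (A2)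
  with the generalized inverse replaced by the Lebesgue measure of the sublevel set, the form that
  emerges from Fubini in \<open>tail_integral_if_L1_A2\<close>.\<close>

lemma upper_function_equivalences:
  assumes A: "condition_A1 \<nu> \<or> (\<exists>K>0. \<forall>r\<in>{0<..<1}.
      (\<integral>\<^sup>+t\<in>{t \<in> {0<..1}. r < f t}. ennreal (1 / (f t)\<^sup>2) \<partial>lborel)
        \<le> ennreal (K / r\<^sup>2) * emeasure lborel {t \<in> {0<..1}. f t \<le> r})"
  shows
    "all_equivalent
      [ \<exists>c>0. (\<integral>\<^sup>+t\<in>{0<..1}. emeasure \<nu> {y. norm y \<ge> c * f t} \<partial>lborel) < \<infinity>,
        \<exists>\<epsilon>>0. (\<integral>\<^sup>+t\<in>{0<..1}. (SUP \<xi>\<in>{\<xi>. norm \<xi> \<le> 1 / (\<epsilon> * f t)}. ennreal (cmod (\<psi> \<xi>))) \<partial>lborel) < \<infinity>,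
        \<forall>\<epsilon>>0. (\<integral>\<^sup>+t\<in>{0<..1}. (SUP \<xi>\<in>{\<xi>. norm \<xi> \<le> 1 / (\<epsilon> * f t)}. ennreal (cmod (\<psi> \<xi>))) \<partial>lborel) < \<infinity>,
        \<forall>\<epsilon>>0. (\<integral>\<^sup>+t\<in>{0<..1}. ennreal
          (measure M {\<omega> \<in> space M. running_sup X t \<omega> \<ge> ennreal (\<epsilon> * f t)} * (1 / t)) \<partial>lborel) < \<infinity>,
        \<forall>\<epsilon>>0. (\<integral>\<^sup>+t\<in>{0<..1}. ennreal
          (measure M {\<omega> \<in> space M. norm (X t \<omega>) \<ge> \<epsilon> * f t} * (1 / t)) \<partial>lborel) < \<infinity>,
        AE \<omega> in M. Limsup (at_right 0) (\<lambda>t. running_sup X t \<omega> / ennreal (f t)) = 0,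
        AE \<omega> in M. Limsup (at_right 0) (\<lambda>t. ennreal (norm (X t \<omega>)) / ennreal (f t)) = 0,
        AE \<omega> in M. Limsup (at_right 0) (\<lambda>t. ennreal (norm (X t \<omega>)) / ennreal (f t)) < \<infinity>,
        0 < measure M {\<omega> \<in> space M.
          Limsup (at_right 0) (\<lambda>t. running_sup X t \<omega> / ennreal (f t)) = 0},
        0 < measure M {\<omega> \<in> space M.
          Limsup (at_right 0) (\<lambda>t. ennreal (norm (X t \<omega>)) / ennreal (f t)) = 0},
        0 < measure M {\<omega> \<in> space M.
          Limsup (at_right 0) (\<lambda>t. ennreal (norm (X t \<omega>)) / ennreal (f t)) < \<infinity>} ]
     \<and> (AE \<omega> in M.
          Limsup (at_right 0) (\<lambda>t. ennreal (norm (X t \<omega>)) / ennreal (f t)) \<in> {0, \<infinity>})"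
proof -
  let ?L1 = "\<lambda>c. (\<integral>\<^sup>+t\<in>{0<..1}. emeasure \<nu> {y. norm y \<ge> c * f t} \<partial>lborel) < \<infinity>"
  let ?L2 = "\<lambda>\<epsilon>. (\<integral>\<^sup>+t\<in>{0<..1}. (SUP \<xi>\<in>{\<xi>. norm \<xi> \<le> 1 / (\<epsilon> * f t)}. ennreal (cmod (\<psi> \<xi>))) \<partial>lborel) < \<infinity>"
  let ?L3 = "\<lambda>\<epsilon>. (\<integral>\<^sup>+t\<in>{0<..1}. ennreal
          (measure M {\<omega> \<in> space M. running_sup X t \<omega> \<ge> ennreal (\<epsilon> * f t)} * (1 / t)) \<partial>lborel) < \<infinity>"
  let ?L4 = "\<lambda>\<epsilon>. (\<integral>\<^sup>+t\<in>{0<..1}. ennreal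
          (measure M {\<omega> \<in> space M. norm (X t \<omega>) \<ge> \<epsilon> * f t} * (1 / t)) \<partial>lborel) < \<infinity>"
  have tail: "tail_integral \<epsilon> < \<infinity>" if L1: "\<exists>c>0. ?L1 c" and "0 < \<epsilon>" for \<epsilon>
  proof -
    obtain c where c: "0 < c" "?L1 c" using L1 by blast
    have "tail_integral c < \<infinity>"
      using A
    proof
      assume "condition_A1 \<nu>"
      with c show ?thesis by (rule tail_integral_if_L1_A1)
    next
      assume "\<exists>K>0. \<forall>r\<in>{0<..<1}.
        (\<integral>\<^sup>+t\<in>{t \<in> {0<..1}. r < f t}. ennreal (1 / (f t)\<^sup>2) \<partial>lborel)
          \<le> ennreal (K / r\<^sup>2) * emeasure lborel {t \<in> {0<..1}. f t \<le> r}"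
      then obtain K where "0 < K" and K: "\<forall>r\<in>{0<..<1}.
        (\<integral>\<^sup>+t\<in>{t \<in> {0<..1}. r < f t}. ennreal (1 / (f t)\<^sup>2) \<partial>lborel)
          \<le> ennreal (K / r\<^sup>2) * emeasure lborel {t \<in> {0<..1}. f t \<le> r}" by blast
      show ?thesis
        by (rule tail_integral_if_L1_A2[OF c _ \<open>0 < K\<close>]) (use K in simp)
    qed
    with c(1) that(2) show ?thesis by (rule tail_integral_scale)
  qed
  have L1_if_tail: "\<exists>c>0. ?L1 c" if "0 < \<epsilon>" "tail_integral \<epsilon> < \<infinity>" for \<epsilon>
    using L1_if_tail_integral[OF that] that(1) by blast
  have L2_ex: "(\<exists>\<epsilon>>0. ?L2 \<epsilon>) \<longleftrightarrow> (\<exists>c>0. ?L1 c)"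
    using tail_integral_if_L2 L1_if_tail tail L2_if_tail_integral[of 1] zero_less_one by meson
  have L2_all: "(\<forall>\<epsilon>>0. ?L2 \<epsilon>) \<longleftrightarrow> (\<exists>c>0. ?L1 c)"
    using tail_integral_if_L2[of 1] L1_if_tail[of 1] tail L2_if_tail_integral zero_less_one by meson
  have L4_if_L3: "?L4 \<epsilon>" if "?L3 \<epsilon>" for \<epsilon>
  proof (rule le_less_trans[OF nn_integral_mono that])
    fix t :: real
    show "ennreal (prob {\<omega> \<in> space M. \<epsilon> * f t \<le> norm (X t \<omega>)} * (1 / t)) * indicator {0<..1} t
      \<le> ennreal (prob {\<omega> \<in> space M. ennreal (\<epsilon> * f t) \<le> running_sup X t \<omega>} * (1 / t)) * indicator {0<..1} t"
    proof (cases "t \<in> {0<..1}")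
      case True
      then have [measurable]: "running_sup X t \<in> borel_measurable M" by (intro running_sup_measurable) simp
      have "ennreal (norm (X t \<omega>)) \<le> running_sup X t \<omega>" for \<omega>
        unfolding running_sup_def using True by (intro SUP_upper) auto
      then have "prob {\<omega> \<in> space M. \<epsilon> * f t \<le> norm (X t \<omega>)} \<le> prob {\<omega> \<in> space M. ennreal (\<epsilon> * f t) \<le> running_sup X t \<omega>}"
        by (intro finite_measure_mono) (auto intro: order_trans[OF ennreal_leI])
      then have "prob {\<omega> \<in> space M. \<epsilon> * f t \<le> norm (X t \<omega>)} * (1 / t) \<le>
          prob {\<omega> \<in> space M. ennreal (\<epsilon> * f t) \<le> running_sup X t \<omega>} * (1 / t)"
        using True by (intro mult_right_mono) auto
      then show ?thesis using True by (simp add: ennreal_leI)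
    qed simp
  qed
  have L1_of_L4: "\<exists>c>0. ?L1 c" if "?L4 1"
    using L1_if_L4 that by (intro exI[of _ "12 * real CARD('d)"]) simp
  have L3: "(\<forall>\<epsilon>>0. ?L3 \<epsilon>) \<longleftrightarrow> (\<exists>c>0. ?L1 c)"
    using L3_if_tail_integral tail L4_if_L3[of 1] L1_of_L4 zero_less_one by blast
  have L4: "(\<forall>\<epsilon>>0. ?L4 \<epsilon>) \<longleftrightarrow> (\<exists>c>0. ?L1 c)"
    using L3 L4_if_L3 L1_of_L4 zero_less_one by blast
  have running: "Limsup (at_right 0) (\<lambda>t. running_sup X t \<omega> / ennreal (f t)) =
      Limsup (at_right 0) (\<lambda>t. ennreal (norm (X t \<omega>)) / ennreal (f t))" if "\<omega> \<in> space M" for \<omega>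
    using that by (intro Limsup_running_sup start_at_zero mono_f f_pos)
  have running_AE: "(AE \<omega> in M. Limsup (at_right 0) (\<lambda>t. running_sup X t \<omega> / ennreal (f t)) = 0) \<longleftrightarrow>
      (AE \<omega> in M. Limsup (at_right 0) (\<lambda>t. ennreal (norm (X t \<omega>)) / ennreal (f t)) = 0)"
    using running by (intro AE_cong) simp
  have running_prob: "{\<omega> \<in> space M. Limsup (at_right 0) (\<lambda>t. running_sup X t \<omega> / ennreal (f t)) = 0} =
      {\<omega> \<in> space M. Limsup (at_right 0) (\<lambda>t. ennreal (norm (X t \<omega>)) / ennreal (f t)) = 0}"
    using running by auto
  note dichotomy = L1_dichotomy[OF tail[OF _ zero_less_one]]
  show ?thesis
    unfolding running_AE running_prob
  proof (rule conjI[OF all_equivalentI], unfold list.pred_inject(2), intro conjI)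
    show "(\<exists>c>0. ?L1 c) \<longleftrightarrow> (\<exists>c>0. ?L1 c)" ..
  qed (rule L2_ex L2_all L3 L4 list.pred_inject(1) | (rule dichotomy, assumption))+
qed

end

theorem theorem2p1:
  fixes M :: "'w measure"
    and X :: "real \<Rightarrow> 'w \<Rightarrow> real ^ 'd"
    and b :: "real ^ 'd"
    and \<nu> :: "(real ^ 'd) measure"
    and \<psi> :: "real ^ 'd \<Rightarrow> complex"
    and f :: "real \<Rightarrow> real"
  assumes "levy_process M X"
    and "has_levy_triplet M X b 0 \<nu>"
    and "\<psi> = levy_exponent b 0 \<nu>"
    and "sector_condition \<psi>"
    and "0 \<le> f 0"
    and "\<And>t. t \<in> {0<..1} \<Longrightarrow> 0 < f t"
    and "mono_on {0..1} f"
    and "condition_A1 \<nu> \<or> condition_A2 f"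
  shows
    "all_equivalent
      [ \<comment> \<open>(L1)\<close>
        \<exists>c>0. (\<integral>\<^sup>+t\<in>{0<..1}. emeasure \<nu> {y. norm y \<ge> c * f t} \<partial>lborel) < \<infinity>,
        \<comment> \<open>(L2), for some and for all \<open>\<epsilon>\<close>\<close>
        \<exists>\<epsilon>>0. (\<integral>\<^sup>+t\<in>{0<..1}. (SUP \<xi>\<in>{\<xi>. norm \<xi> \<le> 1 / (\<epsilon> * f t)}. ennreal (cmod (\<psi> \<xi>))) \<partial>lborel) < \<infinity>,
        \<forall>\<epsilon>>0. (\<integral>\<^sup>+t\<in>{0<..1}. (SUP \<xi>\<in>{\<xi>. norm \<xi> \<le> 1 / (\<epsilon> * f t)}. ennreal (cmod (\<psi> \<xi>))) \<partial>lborel) < \<infinity>,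
        \<comment> \<open>(L3)\<close>
        \<forall>\<epsilon>>0. (\<integral>\<^sup>+t\<in>{0<..1}. ennreal
          (measure M {\<omega> \<in> space M. running_sup X t \<omega> \<ge> ennreal (\<epsilon> * f t)} * (1 / t)) \<partial>lborel) < \<infinity>,
        \<comment> \<open>(L4)\<close>
        \<forall>\<epsilon>>0. (\<integral>\<^sup>+t\<in>{0<..1}. ennreal
          (measure M {\<omega> \<in> space M. norm (X t \<omega>) \<ge> \<epsilon> * f t} * (1 / t)) \<partial>lborel) < \<infinity>,
        \<comment> \<open>(L5)-(L7), almost surely\<close>
        AE \<omega> in M. Limsup (at_right 0) (\<lambda>t. running_sup X t \<omega> / ennreal (f t)) = 0,
        AE \<omega> in M. Limsup (at_right 0) (\<lambda>t. ennreal (norm (X t \<omega>)) / ennreal (f t)) = 0,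
        AE \<omega> in M. Limsup (at_right 0) (\<lambda>t. ennreal (norm (X t \<omega>)) / ennreal (f t)) < \<infinity>,
        \<comment> \<open>(L5)-(L7), with positive probability\<close>
        0 < measure M {\<omega> \<in> space M.
          Limsup (at_right 0) (\<lambda>t. running_sup X t \<omega> / ennreal (f t)) = 0},
        0 < measure M {\<omega> \<in> space M.
          Limsup (at_right 0) (\<lambda>t. ennreal (norm (X t \<omega>)) / ennreal (f t)) = 0},
        0 < measure M {\<omega> \<in> space M.
          Limsup (at_right 0) (\<lambda>t. ennreal (norm (X t \<omega>)) / ennreal (f t)) < \<infinity>} ]
     \<and> (AE \<omega> in M.
          Limsup (at_right 0) (\<lambda>t. ennreal (norm (X t \<omega>)) / ennreal (f t)) \<in> {0, \<infinity>})"
proof -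
  interpret levy_process M X by fact
  obtain C where C: "0 < C" "\<And>\<xi>. \<bar>Im (\<psi> \<xi>)\<bar> \<le> C * Re (\<psi> \<xi>)"
    using assms(4) unfolding sector_condition_def by blast
  \<comment> \<open>A globally monotone function with the same values on \<open>(0, 1]\<close>, the only ones that matter.\<close>
  define F where "F t = (if t \<le> 0 then 0 else f (min t 1))" for t
  have F_eq: "F t = f t" if "0 < t" "t \<le> 1" for t using that by (simp add: F_def)
  interpret sector_levy_bound M X b \<nu> C F
  proof
    show "has_levy_triplet M X b 0 \<nu>" "0 < C" by fact+
    show "\<bar>Im (levy_exponent b 0 \<nu> \<xi>)\<bar> \<le> C * Re (levy_exponent b 0 \<nu> \<xi>)" for \<xi>
      using C(2) assms(3) by simp
    show pos: "0 < F t" if "0 < t" for t using that assms(6) by (auto simp: F_def min_def)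
    show "mono F"
    proof (rule monoI)
      fix s t :: real assume "s \<le> t"
      show "F s \<le> F t"
      proof (cases "s \<le> 0")
        case True
        then show ?thesis using pos[of t] by (cases "t \<le> 0") (auto simp: F_def)
      next
        case False
        then show ?thesis using \<open>s \<le> t\<close> by (auto simp: F_def intro!: mono_onD[OF assms(7)])
      qed
    qed
  qed
  \<comment> \<open>By monotonicity the interval from 0 to the generalized inverse at r lies in the
    sublevel set of level r, so the inverse is at most its Lebesgue measure. Dropping the time 0 can
    only decrease the integral on the left.\<close>
  have A: "condition_A1 \<nu> \<or> (\<exists>K>0. \<forall>r\<in>{0<..<1}.
      (\<integral>\<^sup>+t\<in>{t \<in> {0<..1}. r < F t}. ennreal (1 / (F t)\<^sup>2) \<partial>lborel)
        \<le> ennreal (K / r\<^sup>2) * emeasure lborel {t \<in> {0<..1}. F t \<le> r})"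
  proof (cases "condition_A1 \<nu>")
    case False
    then obtain K where K: "0 < K" "\<And>r. r \<in> {0<..<1} \<Longrightarrow>
        (\<integral>\<^sup>+t\<in>{t \<in> {0..1}. r < f t}. ennreal (1 / (f t)\<^sup>2) \<partial>lborel)
          \<le> ennreal (K * generalized_inverse f r / r\<^sup>2)"
      using assms(8) unfolding condition_A2_def by blast
    have "(\<integral>\<^sup>+t\<in>{t \<in> {0<..1}. r < F t}. ennreal (1 / (F t)\<^sup>2) \<partial>lborel)
        \<le> ennreal (K / r\<^sup>2) * emeasure lborel {t \<in> {0<..1}. F t \<le> r}" if r: "r \<in> {0<..<1}" for r
    proof -
      define g where "g = generalized_inverse f r"
      let ?S = "{t \<in> {0..1}. f t \<le> r}"
      have bdd: "bdd_above ?S" by (rule bdd_aboveI[of _ 1]) simp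
      have "0 \<le> g"
        unfolding g_def generalized_inverse_def using bdd by (auto intro: cSup_upper2)
      have "{0<..<g} \<subseteq> {t \<in> {0<..1}. F t \<le> r}"
      proof
        fix t assume t: "t \<in> {0<..<g}"
        then have "?S \<noteq> {}" "t < Sup ?S"
          by (auto simp: g_def generalized_inverse_def split: if_splits)
        then obtain t' where t': "t' \<in> ?S" "t < t'" using less_cSup_iff[OF _ bdd] by blast
        then have "f t \<le> f t'" using t by (intro mono_onD[OF assms(7)]) auto
        then show "t \<in> {t \<in> {0<..1}. F t \<le> r}" using t t' F_eq[of t] by auto
      qed
      then have "emeasure lborel {0<..<g} \<le> emeasure lborel {t \<in> {0<..1}. F t \<le> r}"
        by (rule emeasure_mono) simp
      then have g_le: "ennreal g \<le> emeasure lborel {t \<in> {0<..1}. F t \<le> r}"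
        using \<open>0 \<le> g\<close> by simp
      have "(\<integral>\<^sup>+t\<in>{t \<in> {0<..1}. r < F t}. ennreal (1 / (F t)\<^sup>2) \<partial>lborel)
          \<le> (\<integral>\<^sup>+t\<in>{t \<in> {0..1}. r < f t}. ennreal (1 / (f t)\<^sup>2) \<partial>lborel)"
        by (intro nn_integral_mono) (auto simp: F_eq indicator_def)
      also have "\<dots> \<le> ennreal (K * g / r\<^sup>2)" using K(2)[OF r] by (simp add: g_def)
      also have "\<dots> = ennreal (K / r\<^sup>2) * ennreal g"
        using K(1) \<open>0 \<le> g\<close> by (simp flip: ennreal_mult)
      also have "\<dots> \<le> ennreal (K / r\<^sup>2) * emeasure lborel {t \<in> {0<..1}. F t \<le> r}"
        using g_le by (rule mult_left_mono) simp
      finally show ?thesis .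
    qed
    then show ?thesis using K(1) by blast
  qed simp
  have L1_eq: "(\<integral>\<^sup>+t\<in>{0<..1}. emeasure \<nu> {y. norm y \<ge> c * F t} \<partial>lborel) =
      (\<integral>\<^sup>+t\<in>{0<..1}. emeasure \<nu> {y. norm y \<ge> c * f t} \<partial>lborel)" for c
    by (intro nn_integral_cong) (simp add: F_eq indicator_def)
  have L2_eq: "(\<integral>\<^sup>+t\<in>{0<..1}. (SUP \<xi>\<in>{\<xi>. norm \<xi> \<le> 1 / (\<epsilon> * F t)}. ennreal (cmod (levy_exponent b 0 \<nu> \<xi>))) \<partial>lborel) =
      (\<integral>\<^sup>+t\<in>{0<..1}. (SUP \<xi>\<in>{\<xi>. norm \<xi> \<le> 1 / (\<epsilon> * f t)}. ennreal (cmod (\<psi> \<xi>))) \<partial>lborel)" for \<epsilon>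
    by (intro nn_integral_cong) (simp add: F_eq indicator_def assms(3))
  have L3_eq: "(\<integral>\<^sup>+t\<in>{0<..1}. ennreal
          (measure M {\<omega> \<in> space M. running_sup X t \<omega> \<ge> ennreal (\<epsilon> * F t)} * (1 / t)) \<partial>lborel) =
      (\<integral>\<^sup>+t\<in>{0<..1}. ennreal
          (measure M {\<omega> \<in> space M. running_sup X t \<omega> \<ge> ennreal (\<epsilon> * f t)} * (1 / t)) \<partial>lborel)" for \<epsilon>
    by (intro nn_integral_cong) (simp add: F_eq indicator_def)
  have L4_eq: "(\<integral>\<^sup>+t\<in>{0<..1}. ennreal
          (measure M {\<omega> \<in> space M. norm (X t \<omega>) \<ge> \<epsilon> * F t} * (1 / t)) \<partial>lborel) =
      (\<integral>\<^sup>+t\<in>{0<..1}. ennreal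
          (measure M {\<omega> \<in> space M. norm (X t \<omega>) \<ge> \<epsilon> * f t} * (1 / t)) \<partial>lborel)" for \<epsilon>
    by (intro nn_integral_cong) (simp add: F_eq indicator_def)
  have Limsup_eq: "Limsup (at_right 0) (\<lambda>t. Y t / ennreal (F t)) = Limsup (at_right 0) (\<lambda>t. Y t / ennreal (f t))"
    for Y :: "real \<Rightarrow> ennreal"
  proof (rule Limsup_eq)
    show "\<forall>\<^sub>F t in at_right 0. Y t / ennreal (F t) = Y t / ennreal (f t)"
      unfolding eventually_at_right_field by (rule exI[of _ 1]) (simp add: F_eq)
  qed
  show ?thesis
    using upper_function_equivalences[OF A]
    unfolding L1_eq L2_eq L3_eq L4_eq Limsup_eq .
qed

end
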